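(* Let $A$ be a pro-$C^*$-algebra with multiplier algebra $M(A)$, and let $(e_\lambda)_\lambda$ be an approximate unit of $A$. (1) For every function $\nu$ assigning to each gauge $\gamma$ a $\beta$-neighborhood $V_\gamma=\nu(\gamma)$ of $0$ in $M(A)$, the polar $$W_\nu^\circ=\bigcap_{\text{gauges }\gamma}(B_\gamma\cap V_\gamma)^\circ\subset M(A)_{\beta_b}^*$$ of the absolutely convex hull $W_\nu=\mathrm{hull}\left(\bigcup_{\gamma}B_\gamma\cap V_\gamma\right)$ satisfies $$(1-e_\lambda)f(1-e_\lambda)\xrightarrow[\lambda]{}0\quad\text{strongly and uniformly in } f\in W_\nu^\circ .$$ (2) If the topologies $\tau$ and $\tau_b$ on $A$ have the same continuous functionals, then the following conditions are equivalent: (2a) $\beta=\beta_b$ on $M(A)$. (2b) For every $\nu$ as in (1), $W_\nu^\circ$ is $\tau$-equicontinuous. (2c) For every $\nu$ as in (1), there is some $p\in S(A)$ such that $W_\nu^\circ$ consists of functionals factoring through $A\to A_p$ (hence also through $M(A)\to M(A_p)$).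
   Context: A pro-$C^*$-algebra is a cofiltered limit of $C^*$-algebras in the category of topological $*$-algebras; equivalently, a complete Hausdorff topological $*$-algebra $A$ over $\mathbb{C}$ whose topology is generated by its set $S(A)$ of continuous $C^*$-seminorms. For $p\in S(A)$ put $A_p:=A/\ker p$, a $C^*$-algebra; then $A\cong\varprojlim_{p\in S(A)}A_p$. The multiplier algebra is $M(A)\cong\varprojlim_{p\in S(A)}M(A_p)$. Each $p\in S(A)$ extends to $M(A)$ as the pullback of the norm of $M(A_p)$, and $\tau$ denotes the (pro-$C^*$) topology generated by these seminorms on $M(A)$, as well as the original topology on $A$. The strict topology $\beta$ on $M(A)$ is generated by the seminorms $x\mapsto p(xa)$, $x\mapsto p(ax)$ for $p\in S(A)$, $a\in A$. For a locally convex topology $\sigma$, $\sigma_b$ is the finest locally convex topology agreeing with $\sigma$ on all $\sigma$-bounded subsets. $E_\sigma^*$ is the space of $\sigma$-continuous linear functionals on $E$. Functionals in $M(A)^*_{\beta_b}$ are identified with their restrictions to $A$ when convenient (restriction to $A$ is injective on them). An approximate unit of $A$ is an increasing net $(e_\lambda)$ of positive elements with $p(e_\lambda)\le1$ for all $p\in S(A)$ and $ae_\lambda\to a$, $e_\lambda a\to a$ for all $a\in A$. For a functional $f$, $(1-e_\lambda)f(1-e_\lambda)$ is the functional $x\mapsto f((1-e_\lambda)x(1-e_\lambda))$ on $M(A)$. The strong topology on functionals is uniform convergence on bounded subsets of $M(A)$; so "strongly and uniformly in $f\in S$" means that for every bounded $B\subset M(A)$, $f((1-e_\lambda)x(1-e_\lambda))\to0$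 uniformly in $x\in B$ and $f\in S$ (the topologies $\beta$ and $\tau$ have the same bounded subsets of $M(A)$). A gauge is a function $\gamma:S(A)\to\mathbb{R}_{>0}$, and $B_\gamma:=\{x\in M(A)\mid p(x)\le\gamma(p),\ \forall p\in S(A)\}$. The polar of $V\subseteq M(A)$ is $V^\circ:=\{f\in M(A)_{\beta_b}^*\mid |f(x)|\le1,\ \forall x\in V\}$. *)

theory Defs
  imports "HOL-Analysis.Analysis"
begin

section \<open>Complex *-algebras\<close>

class scaleC =
  fixes scaleC :: "complex \<Rightarrow> 'a \<Rightarrow> 'a"  (infixr \<open>*\<^sub>C\<close> 75)

class complex_vector = scaleC + ab_group_add +
  assumes scaleC_add_right: "c *\<^sub>C (x + y) = c *\<^sub>C x + c *\<^sub>C y"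
    and scaleC_add_left: "(c + d) *\<^sub>C x = c *\<^sub>C x + d *\<^sub>C x"
    and scaleC_scaleC: "c *\<^sub>C d *\<^sub>C x = (c * d) *\<^sub>C x"
    and scaleC_one: "1 *\<^sub>C x = x"

class complex_algebra = complex_vector + ring +
  assumes mult_scaleC_left: "(c *\<^sub>C x) * y = c *\<^sub>C (x * y)"
    and mult_scaleC_right: "x * (c *\<^sub>C y) = c *\<^sub>C (x * y)"

class complex_star_algebra = complex_algebra +
  fixes star :: "'a \<Rightarrow> 'a"
  assumes star_add: "star (x + y) = star x + star y"
    and star_scaleC: "star (c *\<^sub>C x) = cnj c *\<^sub>C star x"
    and star_mult: "star (x * y) = star y * star x"
    and star_star: "star (star x) = x"

section \<open>Locally convex topologies\<close>

definition (in complex_vector) cseminorm :: "('a \<Rightarrow> real) \<Rightarrow> bool" where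
  "cseminorm p \<longleftrightarrow> (\<forall>x y. p (x + y) \<le> p x + p y) \<and> (\<forall>c x. p (c *\<^sub>C x) = cmod c * p x)"

text \<open>Adjoining \<^term>\<open>UNIV\<close> makes the underlying space all of the type even for the empty family.\<close>

definition (in complex_vector) seminorm_topology :: "('a \<Rightarrow> real) set \<Rightarrow> 'a topology" where
  "seminorm_topology P =
     topology_generated_by (insert UNIV {{y. p (y - x) < r} |p x r. p \<in> P \<and> r > 0})"

definition locally_convex :: "'v::complex_vector topology \<Rightarrow> bool" where
  "locally_convex \<sigma> \<longleftrightarrow> (\<exists>P. (\<forall>p\<in>P. cseminorm p) \<and> \<sigma> = seminorm_topology P)"

definition nhd_zero :: "'v::complex_vector topology \<Rightarrow> 'v set \<Rightarrow> bool" where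
  "nhd_zero \<sigma> V \<longleftrightarrow> (\<exists>U. openin \<sigma> U \<and> 0 \<in> U \<and> U \<subseteq> V)"

definition tvs_bounded :: "'v::complex_vector topology \<Rightarrow> 'v set \<Rightarrow> bool" where
  "tvs_bounded \<sigma> B \<longleftrightarrow> (\<forall>V. nhd_zero \<sigma> V \<longrightarrow> (\<exists>t>0. B \<subseteq> (\<lambda>x. complex_of_real t *\<^sub>C x) ` V))"

definition agree_on_bounded :: "'v::complex_vector topology \<Rightarrow> 'v topology \<Rightarrow> bool" where
  "agree_on_bounded \<sigma> T \<longleftrightarrow> (\<forall>B. tvs_bounded \<sigma> B \<longrightarrow> subtopology T B = subtopology \<sigma> B)"

definition is_finest_agreeing :: "'v::complex_vector topology \<Rightarrow> 'v topology \<Rightarrow> bool" where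
  "is_finest_agreeing \<sigma> T \<longleftrightarrow> locally_convex T \<and> agree_on_bounded \<sigma> T \<and>
     (\<forall>T'. locally_convex T' \<and> agree_on_bounded \<sigma> T' \<longrightarrow> (\<forall>U. openin T' U \<longrightarrow> openin T U))"

text \<open>The topology usually written \<open>\<sigma>\<^sub>b\<close>; it exists by \<open>is_finest_agreeing_bdd_top\<close> below.\<close>

definition bdd_top :: "'v::complex_vector topology \<Rightarrow> 'v topology" where
  "bdd_top \<sigma> = (THE T. is_finest_agreeing \<sigma> T)"

lemma openin_seminorm_topology_mono:
  assumes "P \<subseteq> Q" "openin (seminorm_topology P) U"
  shows "openin (seminorm_topology Q) U"
proof -
  have "generate_topology_on (insert UNIV {{y. p (y - x) < r} |p x r. p \<in> P \<and> r > 0}) U"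
    using assms(2) by (simp add: seminorm_topology_def openin_topology_generated_by_iff)
  then have "generate_topology_on (insert UNIV {{y. p (y - x) < r} |p x r. p \<in> Q \<and> r > 0}) U"
  proof induction
    case (Basis s)
    then show ?case using assms(1) by (intro generate_topology_on.Basis) blast
  qed (auto intro: generate_topology_on.intros)
  then show ?thesis
    by (simp add: seminorm_topology_def openin_topology_generated_by_iff)
qed

lemma topspace_seminorm_topology [simp]: "topspace (seminorm_topology P) = UNIV"
  by (simp add: seminorm_topology_def)

lemma is_finest_agreeing_bdd_top:
  assumes "locally_convex \<sigma>"
  shows "is_finest_agreeing \<sigma> (bdd_top \<sigma>)"
proof -
  define \<P> where "\<P> = {P. (\<forall>p\<in>P. cseminorm p) \<and> agree_on_bounded \<sigma> (seminorm_topology P)}"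
  define T where "T = seminorm_topology (\<Union>\<P>)"
  obtain P0 where P0: "\<forall>p\<in>P0. cseminorm p" "\<sigma> = seminorm_topology P0"
    using assms by (auto simp: locally_convex_def)
  have "P0 \<in> \<P>" using P0 by (simp add: \<P>_def agree_on_bounded_def)
  then have \<sigma>_le: "openin T U" if "openin \<sigma> U" for U
    using openin_seminorm_topology_mono[of P0 "\<Union>\<P>" U] that P0(2) by (auto simp: T_def)
  have lc: "locally_convex T"
    unfolding locally_convex_def by (rule exI[of _ "\<Union>\<P>"]) (auto simp: T_def \<P>_def)
  have le_\<sigma>: "openin (subtopology \<sigma> B) (U \<inter> B)" if B: "tvs_bounded \<sigma> B" and U: "openin T U" for B U
  proof -
    have "generate_topology_on (insert UNIV {{y. p (y - x) < r} |p x r. p \<in> \<Union>\<P> \<and> r > 0}) U"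
      using U by (simp add: T_def seminorm_topology_def openin_topology_generated_by_iff)
    then show ?thesis
    proof induction
      case Empty
      then show ?case by simp
    next
      case (Int a b)
      have "(a \<inter> b) \<inter> B = (a \<inter> B) \<inter> (b \<inter> B)" by blast
      then show ?case using Int by (metis openin_Int)
    next
      case (UN K)
      have "\<Union>K \<inter> B = \<Union>((\<lambda>k. k \<inter> B) ` K)" by blast
      then show ?case using UN by (metis (no_types, lifting) imageE openin_Union)
    next
      case (Basis s)
      show ?case
      proof (cases "s = UNIV")
        case True
        have "topspace (subtopology \<sigma> B) = UNIV \<inter> B" using P0 by simp
        then show ?thesis using True by (metis openin_topspace)
      next
        case False
        then obtain P where P: "P \<in> \<P>" "s \<in> {{y. p (y - x) < r} |p x r. p \<in> P \<and> r > 0}"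
          using Basis by blast
        have "openin (seminorm_topology P) s"
          unfolding seminorm_topology_def using P(2) by (intro topology_generated_by_Basis) blast
        then have "openin (subtopology (seminorm_topology P) B) (s \<inter> B)"
          by (auto simp: openin_subtopology)
        then show ?thesis using P(1) B by (simp add: \<P>_def agree_on_bounded_def)
      qed
    qed
  qed
  have agree: "agree_on_bounded \<sigma> T"
    unfolding agree_on_bounded_def
  proof (intro allI impI)
    fix B assume B: "tvs_bounded \<sigma> B"
    show "subtopology T B = subtopology \<sigma> B"
      unfolding topology_eq
    proof (intro allI iffI)
      fix U assume "openin (subtopology T B) U"
      then show "openin (subtopology \<sigma> B) U"
        using le_\<sigma>[OF B] by (auto simp: openin_subtopology[of T])
    next
      fix U assume "openin (subtopology \<sigma> B) U"
      then show "openin (subtopology T B) U"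
        using \<sigma>_le by (auto simp: openin_subtopology)
    qed
  qed
  have finest: "openin T U"
    if T': "locally_convex T'" "agree_on_bounded \<sigma> T'" "openin T' U" for T' U
  proof -
    obtain P where P: "\<forall>p\<in>P. cseminorm p" "T' = seminorm_topology P"
      using T'(1) by (auto simp: locally_convex_def)
    then have "P \<in> \<P>" using T'(2) by (simp add: \<P>_def)
    then show ?thesis
      using openin_seminorm_topology_mono[of P "\<Union>\<P>" U] T'(3) P(2) by (auto simp: T_def)
  qed
  have T: "is_finest_agreeing \<sigma> T"
    using lc agree finest by (auto simp: is_finest_agreeing_def)
  show ?thesis
    unfolding bdd_top_def
  proof (rule theI[of "is_finest_agreeing \<sigma>", OF T])
    fix T' assume "is_finest_agreeing \<sigma> T'"
    then show "T' = T"
      using T unfolding is_finest_agreeing_def topology_eq by blast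
  qed
qed

definition continuous_dual :: "'v::complex_vector topology \<Rightarrow> ('v \<Rightarrow> complex) set" where
  "continuous_dual \<sigma> = {f. Vector_Spaces.linear scaleC (*) f \<and> continuous_map \<sigma> euclidean f}"

definition equicontinuous :: "'v topology \<Rightarrow> ('v \<Rightarrow> complex) set \<Rightarrow> bool" where
  "equicontinuous \<sigma> F \<longleftrightarrow> (\<forall>x\<in>topspace \<sigma>. \<forall>\<epsilon>>0. \<exists>U. openin \<sigma> U \<and> x \<in> U \<and>
     (\<forall>f\<in>F. \<forall>y\<in>U. cmod (f y - f x) < \<epsilon>))"

definition absolutely_convex :: "'v::complex_vector set \<Rightarrow> bool" where
  "absolutely_convex S \<longleftrightarrow>
     (\<forall>x\<in>S. \<forall>y\<in>S. \<forall>c d. cmod c + cmod d \<le> 1 \<longrightarrow> c *\<^sub>C x + d *\<^sub>C y \<in> S)"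

section \<open>Pro-C*-algebras\<close>

definition (in complex_star_algebra) cstar_seminorm :: "('a \<Rightarrow> real) \<Rightarrow> bool" where
  "cstar_seminorm p \<longleftrightarrow> cseminorm p \<and> (\<forall>x y. p (x * y) \<le> p x * p y) \<and>
     (\<forall>x. p (star x * x) = (p x)\<^sup>2)"

class topological_star_algebra =
  complex_star_algebra + uniform_topological_group_add + topological_semigroup_mult +
  assumes tendsto_scaleC_Pair: "LIM x (nhds c \<times>\<^sub>F nhds a). fst x *\<^sub>C snd x :> nhds (c *\<^sub>C a)"
    and tendsto_star_nhds: "(star \<longlongrightarrow> star a) (nhds a)"

text \<open>The set \<open>S(A)\<close> of continuous C*-seminorms.\<close>

definition (in topological_star_algebra) cstar_seminorms :: "('a \<Rightarrow> real) set" where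
  "cstar_seminorms = {p. cstar_seminorm p \<and> (\<forall>x. (p \<longlongrightarrow> p x) (nhds x))}"

text \<open>
  In \<^class>\<open>uniform_topological_group_add\<close> the uniformity is necessarily the one induced by the
  group topology, so completeness is completeness of the topological group.
\<close>

class pro_cstar_algebra = topological_star_algebra + t2_space +
  assumes open_iff_openin_seminorm_topology:
      "open U \<longleftrightarrow> openin (seminorm_topology cstar_seminorms) U"
    and complete_UNIV: "complete UNIV"

definition positive :: "'a::complex_star_algebra \<Rightarrow> bool" where
  "positive a \<longleftrightarrow> (\<exists>b. a = star b * b)"

definition net_filter :: "'l::preorder filter" where
  "net_filter = (INF i. principal {i..})"

definition approximate_unit :: "('l::preorder \<Rightarrow> 'a::pro_cstar_algebra) \<Rightarrow> bool" where
  "approximate_unit e \<longleftrightarrow>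
     (\<forall>i j::'l. \<exists>k. i \<le> k \<and> j \<le> k) \<and>
     (\<forall>i j. i \<le> j \<longrightarrow> positive (e j - e i)) \<and>
     (\<forall>i. positive (e i)) \<and>
     (\<forall>i. \<forall>p\<in>cstar_seminorms. p (e i) \<le> 1) \<and>
     (\<forall>a. ((\<lambda>i. a * e i) \<longlongrightarrow> a) net_filter \<and> ((\<lambda>i. e i * a) \<longlongrightarrow> a) net_filter)"

section \<open>The quotients \<open>A\<^sub>p = A / ker p\<close> and their multiplier algebras\<close>

definition coset :: "('a::complex_star_algebra \<Rightarrow> real) \<Rightarrow> 'a \<Rightarrow> 'a set" where
  "coset p a = {b. p (b - a) = 0}"

definition quot :: "('a::complex_star_algebra \<Rightarrow> real) \<Rightarrow> 'a set set" where
  "quot p = range (coset p)"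

definition rep :: "'a set \<Rightarrow> 'a" where
  "rep X = (SOME a. a \<in> X)"

text \<open>
  The operations and the norm of \<open>A\<^sub>p\<close> are computed on representatives. For \<open>q \<le> p\<close>,
  \<open>quot_map q\<close> is the canonical surjection from \<open>A\<^sub>p\<close> to \<open>A\<^sub>q\<close>.
\<close>

definition qadd :: "('a::complex_star_algebra \<Rightarrow> real) \<Rightarrow> 'a set \<Rightarrow> 'a set \<Rightarrow> 'a set" where
  "qadd p X Y = coset p (rep X + rep Y)"

definition qscale :: "('a::complex_star_algebra \<Rightarrow> real) \<Rightarrow> complex \<Rightarrow> 'a set \<Rightarrow> 'a set" where
  "qscale p c X = coset p (c *\<^sub>C rep X)"

definition qmult :: "('a::complex_star_algebra \<Rightarrow> real) \<Rightarrow> 'a set \<Rightarrow> 'a set \<Rightarrow> 'a set" where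
  "qmult p X Y = coset p (rep X * rep Y)"

definition qnorm :: "('a::complex_star_algebra \<Rightarrow> real) \<Rightarrow> 'a set \<Rightarrow> real" where
  "qnorm p X = p (rep X)"

definition quot_map :: "('a::complex_star_algebra \<Rightarrow> real) \<Rightarrow> 'a set \<Rightarrow> 'a set" where
  "quot_map q X = coset q (rep X)"

definition bounded_operators ::
  "('a::complex_star_algebra \<Rightarrow> real) \<Rightarrow> ('a set \<Rightarrow> 'a set) set" where
  "bounded_operators p = {L \<in> quot p \<rightarrow>\<^sub>E quot p.
     (\<forall>X\<in>quot p. \<forall>Y\<in>quot p. L (qadd p X Y) = qadd p (L X) (L Y)) \<and>
     (\<forall>c. \<forall>X\<in>quot p. L (qscale p c X) = qscale p c (L X)) \<and>
     (\<exists>K. \<forall>X\<in>quot p. qnorm p (L X) \<le> K * qnorm p X)}"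

text \<open>\<open>M(A\<^sub>p)\<close> as the algebra of double centralizers \<open>(L, R)\<close>.\<close>

definition double_centralizers ::
  "('a::complex_star_algebra \<Rightarrow> real) \<Rightarrow> (('a set \<Rightarrow> 'a set) \<times> ('a set \<Rightarrow> 'a set)) set" where
  "double_centralizers p = {(L, R). L \<in> bounded_operators p \<and> R \<in> bounded_operators p \<and>
     (\<forall>X\<in>quot p. \<forall>Y\<in>quot p. qmult p X (L Y) = qmult p (R X) Y)}"

definition dc_norm ::
  "('a::complex_star_algebra \<Rightarrow> real) \<Rightarrow> ('a set \<Rightarrow> 'a set) \<times> ('a set \<Rightarrow> 'a set) \<Rightarrow> real" where
  "dc_norm p m = (SUP X\<in>{X \<in> quot p. qnorm p X \<le> 1}. qnorm p (fst m X))"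

text \<open>
  The map from \<open>M(A\<^sub>p)\<close> to \<open>M(A\<^sub>q)\<close> induced by the surjection from \<open>A\<^sub>p\<close> to \<open>A\<^sub>q\<close> sends \<open>m\<close> to the
  unique \<open>n\<close> satisfying the following relation.
\<close>

definition dc_compatible :: "('a::complex_star_algebra \<Rightarrow> real) \<Rightarrow> ('a \<Rightarrow> real) \<Rightarrow>
    ('a set \<Rightarrow> 'a set) \<times> ('a set \<Rightarrow> 'a set) \<Rightarrow> ('a set \<Rightarrow> 'a set) \<times> ('a set \<Rightarrow> 'a set) \<Rightarrow> bool" where
  "dc_compatible p q m n \<longleftrightarrow> (\<forall>X\<in>quot p.
     fst n (quot_map q X) = quot_map q (fst m X) \<and>
     snd n (quot_map q X) = quot_map q (snd m X))"

subsection \<open>Elementary facts\<close>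

lemma scaleC_zero_right' [simp]: "c *\<^sub>C (0::'a::complex_vector) = 0"
  using scaleC_add_right[of c 0 0] by simp

lemma scaleC_zero_left' [simp]: "0 *\<^sub>C (x::'a::complex_vector) = 0"
  using scaleC_add_left[of 0 0 x] by simp

lemma scaleC_minus_one: "(-1) *\<^sub>C (x::'a::complex_vector) = - x"
proof -
  have "x + (-1) *\<^sub>C x = 0" using scaleC_add_left[of 1 "-1" x] by (simp add: scaleC_one)
  then show ?thesis by (simp add: eq_neg_iff_add_eq_0 add.commute)
qed

lemma scaleC_minus_right: "c *\<^sub>C (- x) = - (c *\<^sub>C (x::'a::complex_vector))"
  using scaleC_add_right[of c x "- x"] by (simp add: minus_unique)

lemma scaleC_diff_right: "c *\<^sub>C (x - y) = c *\<^sub>C x - c *\<^sub>C (y::'a::complex_vector)"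
  using scaleC_add_right[of c x "- y"] by (simp add: scaleC_minus_right)

context
  fixes p :: "'a::complex_star_algebra \<Rightarrow> real"
  assumes p: "cstar_seminorm p"
begin

lemma sn_add: "p (x + y) \<le> p x + p y"
  and sn_scale: "p (c *\<^sub>C x) = cmod c * p x"
  and sn_mult: "p (x * y) \<le> p x * p y"
  using p by (auto simp: cstar_seminorm_def cseminorm_def)

lemma sn_minus: "p (- x) = p x"
  using sn_scale[of "-1" x] by (simp add: scaleC_minus_one)

lemma sn_zero: "p 0 = 0"
  using sn_scale[of 0 0] by simp

lemma sn_nonneg: "0 \<le> p x"
  using sn_add[of x "- x"] by (simp add: sn_minus sn_zero)

lemma sn_ker_add: "p x = 0 \<Longrightarrow> p y = 0 \<Longrightarrow> p (x + y) = 0"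
  using sn_add[of x y] sn_nonneg[of "x + y"] by simp

lemma sn_ker_mult1: "p x = 0 \<Longrightarrow> p (x * y) = 0"
  using sn_mult[of x y] sn_nonneg[of "x * y"] by simp

lemma sn_ker_mult2: "p y = 0 \<Longrightarrow> p (x * y) = 0"
  using sn_mult[of x y] sn_nonneg[of "x * y"] by simp

lemma sn_diff_commute: "p (x - y) = p (y - x)"
  using sn_minus[of "x - y"] by simp

lemma sn_diff_trans: "p (x - y) = 0 \<Longrightarrow> p (y - z) = 0 \<Longrightarrow> p (x - z) = 0"
  using sn_ker_add[of "x - y" "y - z"] by simp

lemma coset_eq: "coset p a = coset p b \<longleftrightarrow> p (a - b) = 0"
proof
  assume "coset p a = coset p b"
  moreover have "a \<in> coset p a" by (simp add: coset_def sn_zero)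
  ultimately show "p (a - b) = 0" by (simp add: coset_def)
next
  assume "p (a - b) = 0"
  then show "coset p a = coset p b"
    using sn_diff_trans sn_diff_commute by (auto simp: coset_def)
qed

lemma rep_coset: "p (rep (coset p a) - a) = 0"
proof -
  have "a \<in> coset p a" by (simp add: coset_def sn_zero)
  then have "rep (coset p a) \<in> coset p a" unfolding rep_def by (rule someI)
  then show ?thesis by (simp add: coset_def)
qed

lemma qadd_coset: "qadd p (coset p a) (coset p b) = coset p (a + b)"
proof -
  have "rep (coset p a) + rep (coset p b) - (a + b) = (rep (coset p a) - a) + (rep (coset p b) - b)"
    by simp
  then show ?thesis unfolding qadd_def coset_eq using sn_ker_add rep_coset by metis
qed

lemma qscale_coset: "qscale p c (coset p a) = coset p (c *\<^sub>C a)"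
  unfolding qscale_def coset_eq by (simp add: scaleC_diff_right[symmetric] sn_scale rep_coset)

lemma qmult_coset: "qmult p (coset p a) (coset p b) = coset p (a * b)"
proof -
  have "rep (coset p a) * rep (coset p b) - a * b
      = (rep (coset p a) - a) * rep (coset p b) + a * (rep (coset p b) - b)"
    by (simp add: algebra_simps)
  then show ?thesis unfolding qmult_def coset_eq
    using sn_ker_add sn_ker_mult1 sn_ker_mult2 rep_coset by metis
qed

lemma qnorm_coset: "qnorm p (coset p a) = p a"
  unfolding qnorm_def
  using sn_add[of "rep (coset p a) - a" a] sn_add[of "a - rep (coset p a)" "rep (coset p a)"]
    rep_coset[of a] sn_diff_commute[of a "rep (coset p a)"] by simp

lemmas qsimps = qadd_coset qscale_coset qmult_coset qnorm_coset

lemma quot_map_coset: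
  assumes q: "cstar_seminorm q" "q \<le> p"
  shows "quot_map q (coset p a) = coset q a"
proof -
  have "q (rep (coset p a) - a) = 0"
    using rep_coset[of a] le_funD[OF q(2), of "rep (coset p a) - a"] 
      Defs.sn_nonneg[OF q(1), of "rep (coset p a) - a"] by simp
  then show ?thesis unfolding quot_map_def by (simp add: Defs.coset_eq[OF q(1)])
qed

end

lemma quotE: "X \<in> quot p \<Longrightarrow> (\<And>a. X = coset p a \<Longrightarrow> thesis) \<Longrightarrow> thesis"
  by (auto simp: quot_def)

lemma coset_quot [simp, intro]: "coset p a \<in> quot p"
  by (simp add: quot_def)

lemma qadd_quot [simp, intro]: "qadd p X Y \<in> quot p"
  and qscale_quot [simp, intro]: "qscale p c X \<in> quot p"
  and qmult_quot [simp, intro]: "qmult p X Y \<in> quot p"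
  and quot_map_quot [simp, intro]: "quot_map p X \<in> quot p"
  by (simp_all add: qadd_def qscale_def qmult_def quot_map_def)


lemma bounded_operators_cosetI:
  assumes p: "cstar_seminorm p" and "L \<in> extensional (quot p)"
    and l: "\<And>a. L (coset p a) = coset p (l a)"
    and add: "\<And>a b. coset p (l (a + b)) = coset p (l a + l b)"
    and scale: "\<And>c a. coset p (l (c *\<^sub>C a)) = coset p (c *\<^sub>C l a)"
    and bd: "\<And>a. p (l a) \<le> K * p a"
  shows "L \<in> bounded_operators p"
proof -
  have "L \<in> quot p \<rightarrow>\<^sub>E quot p"
    using assms(2) l by (auto simp: PiE_def quot_def)
  moreover have "\<forall>X\<in>quot p. \<forall>Y\<in>quot p. L (qadd p X Y) = qadd p (L X) (L Y)"
    by (auto simp: quot_def qsimps[OF p] l add)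
  moreover have "\<forall>c. \<forall>X\<in>quot p. L (qscale p c X) = qscale p c (L X)"
    by (auto simp: quot_def qsimps[OF p] l scale)
  moreover have "\<forall>X\<in>quot p. qnorm p (L X) \<le> K * qnorm p X"
    by (auto simp: quot_def qsimps[OF p] l bd)
  ultimately show ?thesis unfolding bounded_operators_def by blast
qed

lemma bounded_operators_cosetE:
  assumes p: "cstar_seminorm p" and L: "L \<in> bounded_operators p"
  obtains l K where "\<And>a. L (coset p a) = coset p (l a)"
    "\<And>a b. coset p (l (a + b)) = coset p (l a + l b)"
    "\<And>c a. coset p (l (c *\<^sub>C a)) = coset p (c *\<^sub>C l a)"
    "\<And>a. p (l a) \<le> K * p a" "0 \<le> K"
proof -
  have "\<forall>a. \<exists>b. L (coset p a) = coset p b"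
    using L by (fastforce simp: bounded_operators_def quot_def PiE_def Pi_def)
  then obtain l where l: "\<And>a. L (coset p a) = coset p (l a)" by metis
  obtain K where K: "\<And>X. X \<in> quot p \<Longrightarrow> qnorm p (L X) \<le> K * qnorm p X"
    using L unfolding bounded_operators_def by blast
  have L_add: "L (qadd p X Y) = qadd p (L X) (L Y)" if "X \<in> quot p" "Y \<in> quot p" for X Y
    using L that by (auto simp: bounded_operators_def)
  have L_scale: "L (qscale p c X) = qscale p c (L X)" if "X \<in> quot p" for X c
    using L that by (auto simp: bounded_operators_def)
  have 1: "coset p (l (a + b)) = coset p (l a + l b)" for a b
    using L_add[of "coset p a" "coset p b"] by (simp add: qsimps[OF p] l)
  have 2: "coset p (l (c *\<^sub>C a)) = coset p (c *\<^sub>C l a)" for a c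
    using L_scale[of "coset p a" c] by (simp add: qsimps[OF p] l)
  have 3: "p (l a) \<le> \<bar>K\<bar> * p a" for a
  proof -
    have "p (l a) \<le> K * p a"
      using K[of "coset p a"] by (simp add: qsimps[OF p] l)
    also have "\<dots> \<le> \<bar>K\<bar> * p a"
      using sn_nonneg[OF p] by (intro mult_right_mono) auto
    finally show ?thesis .
  qed
  show ?thesis using that[OF l 1 2 3] by simp
qed

lemma bounded_operators_lin:
  assumes p: "cstar_seminorm p" and L: "L \<in> bounded_operators p"
    and l: "\<And>a. L (coset p a) = coset p (l a)"
  shows "coset p (l (a + b)) = coset p (l a + l b)" "coset p (l (c *\<^sub>C a)) = coset p (c *\<^sub>C l a)"
proof -
  have "L (qadd p (coset p a) (coset p b)) = qadd p (L (coset p a)) (L (coset p b))"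
    "L (qscale p c (coset p a)) = qscale p c (L (coset p a))"
    using L coset_quot unfolding bounded_operators_def by blast+
  then show "coset p (l (a + b)) = coset p (l a + l b)"
    "coset p (l (c *\<^sub>C a)) = coset p (c *\<^sub>C l a)"
    by (simp_all add: qsimps[OF p] l)
qed

lemma coset_cong:
  assumes p: "cstar_seminorm p" and "coset p a = coset p a'" "coset p b = coset p b'"
  shows "coset p (a + b) = coset p (a' + b')" "coset p (c *\<^sub>C a) = coset p (c *\<^sub>C a')"
    "coset p (a * b) = coset p (a' * b')"
  using assms(2,3) by (simp_all flip: qsimps[OF p])

definition dc_zero where
  "dc_zero p = (\<lambda>X\<in>quot p. coset p 0, \<lambda>X\<in>quot p. coset p 0)"

definition dc_one where
  "dc_one p = (\<lambda>X\<in>quot p. X, \<lambda>X\<in>quot p. X)"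

definition dc_add where
  "dc_add p m n =
     (\<lambda>X\<in>quot p. qadd p (fst m X) (fst n X), \<lambda>X\<in>quot p. qadd p (snd m X) (snd n X))"

definition dc_scale where
  "dc_scale p c m = (\<lambda>X\<in>quot p. qscale p c (fst m X), \<lambda>X\<in>quot p. qscale p c (snd m X))"

definition dc_mult where
  "dc_mult p m n = (\<lambda>X\<in>quot p. fst m (fst n X), \<lambda>X\<in>quot p. snd n (snd m X))"

definition dc_embed where
  "dc_embed p a = (\<lambda>X\<in>quot p. qmult p (coset p a) X, \<lambda>X\<in>quot p. qmult p X (coset p a))"

lemmas dc_defs = dc_zero_def dc_one_def dc_add_def dc_scale_def dc_mult_def dc_embed_def

lemma double_centralizers_maps:
  assumes "m \<in> double_centralizers p" "X \<in> quot p"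
  shows "fst m X \<in> quot p" "snd m X \<in> quot p"
  using assms by (auto simp: double_centralizers_def bounded_operators_def)

lemma double_centralizers_ext:
  assumes "fst m \<in> extensional (quot p)" "snd m \<in> extensional (quot p)"
    "fst n \<in> extensional (quot p)" "snd n \<in> extensional (quot p)"
    "\<And>a. fst m (coset p a) = fst n (coset p a)" "\<And>a. snd m (coset p a) = snd n (coset p a)"
  shows "m = n"
proof (rule prod_eqI)
  show "fst m = fst n" using assms by (intro extensionalityI[of _ "quot p"]) (auto simp: quot_def)
  show "snd m = snd n" using assms by (intro extensionalityI[of _ "quot p"]) (auto simp: quot_def)
qed

lemma double_centralizers_extensional:
  assumes "m \<in> double_centralizers p"
  shows "fst m \<in> extensional (quot p)" "snd m \<in> extensional (quot p)"
  using assms by (auto simp: double_centralizers_def bounded_operators_def PiE_def)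

lemma bounded_operators_add:
  assumes p: "cstar_seminorm p" and L: "L \<in> bounded_operators p" and M: "M \<in> bounded_operators p"
  shows "(\<lambda>X\<in>quot p. qadd p (L X) (M X)) \<in> bounded_operators p"
proof -
  obtain l K where l: "\<And>a. L (coset p a) = coset p (l a)"
    "\<And>a b. coset p (l (a + b)) = coset p (l a + l b)"
    "\<And>c a. coset p (l (c *\<^sub>C a)) = coset p (c *\<^sub>C l a)"
    "\<And>a. p (l a) \<le> K * p a" "0 \<le> K"
    using bounded_operators_cosetE[OF p L] by metis
  obtain m K' where m: "\<And>a. M (coset p a) = coset p (m a)"
    "\<And>a b. coset p (m (a + b)) = coset p (m a + m b)"
    "\<And>c a. coset p (m (c *\<^sub>C a)) = coset p (c *\<^sub>C m a)"
    "\<And>a. p (m a) \<le> K' * p a" "0 \<le> K'"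
    using bounded_operators_cosetE[OF p M] by metis
  show ?thesis
  proof (rule bounded_operators_cosetI[OF p, where l = "\<lambda>a. l a + m a" and K = "K + K'"])
    fix a b c
    show "coset p (l (a + b) + m (a + b)) = coset p (l a + m a + (l b + m b))"
      using coset_cong(1)[OF p l(2) m(2), of a b a b] by (simp add: algebra_simps)
    show "coset p (l (c *\<^sub>C a) + m (c *\<^sub>C a)) = coset p (c *\<^sub>C (l a + m a))"
      using coset_cong(1)[OF p l(3) m(3), of c a c a] by (simp add: scaleC_add_right)
    show "p (l a + m a) \<le> (K + K') * p a"
      using sn_add[OF p, of "l a" "m a"] l(4)[of a] m(4)[of a] by (simp add: distrib_right)
  qed (auto simp: l m qsimps[OF p])
qed

lemma bounded_operators_scale:
  assumes p: "cstar_seminorm p" and L: "L \<in> bounded_operators p"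
  shows "(\<lambda>X\<in>quot p. qscale p c (L X)) \<in> bounded_operators p"
proof -
  obtain l K where l: "\<And>a. L (coset p a) = coset p (l a)"
    "\<And>a b. coset p (l (a + b)) = coset p (l a + l b)"
    "\<And>c a. coset p (l (c *\<^sub>C a)) = coset p (c *\<^sub>C l a)"
    "\<And>a. p (l a) \<le> K * p a" "0 \<le> K"
    using bounded_operators_cosetE[OF p L] by metis
  show ?thesis
  proof (rule bounded_operators_cosetI[OF p, where l = "\<lambda>a. c *\<^sub>C l a" and K = "cmod c * K"])
    fix a b d
    show "coset p (c *\<^sub>C l (a + b)) = coset p (c *\<^sub>C l a + c *\<^sub>C l b)"
      using coset_cong(2)[OF p l(2) refl, of c a b] by (simp add: scaleC_add_right)
    show "coset p (c *\<^sub>C l (d *\<^sub>C a)) = coset p (d *\<^sub>C (c *\<^sub>C l a))"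
      using coset_cong(2)[OF p l(3) refl, of c d a] by (simp add: scaleC_scaleC mult.commute)
    show "p (c *\<^sub>C l a) \<le> cmod c * K * p a"
      using mult_left_mono[OF l(4)[of a], of "cmod c"] by (simp add: sn_scale[OF p] mult.assoc)
  qed (auto simp: l qsimps[OF p])
qed

lemma bounded_operators_comp:
  assumes p: "cstar_seminorm p" and L: "L \<in> bounded_operators p" and M: "M \<in> bounded_operators p"
  shows "(\<lambda>X\<in>quot p. L (M X)) \<in> bounded_operators p"
proof -
  obtain l K where l: "\<And>a. L (coset p a) = coset p (l a)"
    "\<And>a b. coset p (l (a + b)) = coset p (l a + l b)"
    "\<And>c a. coset p (l (c *\<^sub>C a)) = coset p (c *\<^sub>C l a)"
    "\<And>a. p (l a) \<le> K * p a" "0 \<le> K"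
    using bounded_operators_cosetE[OF p L] by metis
  obtain m K' where m: "\<And>a. M (coset p a) = coset p (m a)"
    "\<And>a b. coset p (m (a + b)) = coset p (m a + m b)"
    "\<And>c a. coset p (m (c *\<^sub>C a)) = coset p (c *\<^sub>C m a)"
    "\<And>a. p (m a) \<le> K' * p a" "0 \<le> K'"
    using bounded_operators_cosetE[OF p M] by metis
  show ?thesis
  proof (rule bounded_operators_cosetI[OF p, where l = "\<lambda>a. l (m a)" and K = "K * K'"])
    fix a b c
    show "coset p (l (m (a + b))) = coset p (l (m a) + l (m b))"
      by (metis l(1,2) m(2))
    show "coset p (l (m (c *\<^sub>C a))) = coset p (c *\<^sub>C l (m a))"
      by (metis l(1,3) m(3))
    show "p (l (m a)) \<le> K * K' * p a"
      using l(4)[of "m a"] mult_left_mono[OF m(4)[of a] l(5)] by (simp add: mult.assoc)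
  qed (auto simp: l m)
qed

lemma bounded_operators_zero:
  assumes p: "cstar_seminorm p"
  shows "(\<lambda>X\<in>quot p. coset p 0) \<in> bounded_operators p"
  by (rule bounded_operators_cosetI[OF p, where l = "\<lambda>_. 0" and K = 0]) (auto simp: sn_zero[OF p])

lemma bounded_operators_one:
  assumes p: "cstar_seminorm p"
  shows "(\<lambda>X\<in>quot p. X) \<in> bounded_operators p"
  by (rule bounded_operators_cosetI[OF p, where l = "\<lambda>a. a" and K = 1]) auto

lemma bounded_operators_embed:
  assumes p: "cstar_seminorm p"
  shows "(\<lambda>X\<in>quot p. qmult p (coset p a) X) \<in> bounded_operators p"
    "(\<lambda>X\<in>quot p. qmult p X (coset p a)) \<in> bounded_operators p"
proof -
  show "(\<lambda>X\<in>quot p. qmult p (coset p a) X) \<in> bounded_operators p"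
    by (rule bounded_operators_cosetI[OF p, where l = "\<lambda>b. a * b" and K = "p a"])
      (auto simp: qsimps[OF p] distrib_left mult_scaleC_right sn_mult[OF p])
  show "(\<lambda>X\<in>quot p. qmult p X (coset p a)) \<in> bounded_operators p"
  proof (rule bounded_operators_cosetI[OF p, where l = "\<lambda>b. b * a" and K = "p a"])
    show "p (b * a) \<le> p a * p b" for b
      using sn_mult[OF p, of b a] by (simp add: mult.commute)
  qed (auto simp: qsimps[OF p] distrib_right mult_scaleC_left)
qed

lemma double_centralizersI:
  assumes "fst m \<in> bounded_operators p" "snd m \<in> bounded_operators p"
    "\<And>a b. qmult p (coset p a) (fst m (coset p b)) = qmult p (snd m (coset p a)) (coset p b)"
  shows "m \<in> double_centralizers p"
  using assms by (cases m) (auto simp: double_centralizers_def quot_def)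

lemma double_centralizersD:
  assumes "m \<in> double_centralizers p"
  shows "fst m \<in> bounded_operators p" "snd m \<in> bounded_operators p"
    "X \<in> quot p \<Longrightarrow> Y \<in> quot p \<Longrightarrow> qmult p X (fst m Y) = qmult p (snd m X) Y"
  using assms by (auto simp: double_centralizers_def)

lemma double_centralizers_cosetE:
  assumes "m \<in> double_centralizers p"
  obtains l r where "\<And>a. fst m (coset p a) = coset p (l a)" "\<And>a. snd m (coset p a) = coset p (r a)"
proof -
  have "\<forall>a. \<exists>b. fst m (coset p a) = coset p b" "\<forall>a. \<exists>b. snd m (coset p a) = coset p b"
    using double_centralizers_maps[OF assms coset_quot] by (metis quotE)+
  then show ?thesis using that by metis
qed

lemma dc_closed:
  assumes p: "cstar_seminorm p"
  shows "dc_zero p \<in> double_centralizers p" "dc_one p \<in> double_centralizers p"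
    "dc_embed p a \<in> double_centralizers p"
    "m \<in> double_centralizers p \<Longrightarrow> dc_scale p c m \<in> double_centralizers p"
    "m \<in> double_centralizers p \<Longrightarrow> n \<in> double_centralizers p \<Longrightarrow> dc_add p m n \<in> double_centralizers p"
    "m \<in> double_centralizers p \<Longrightarrow> n \<in> double_centralizers p \<Longrightarrow> dc_mult p m n \<in> double_centralizers p"
proof -
  show "dc_zero p \<in> double_centralizers p"
    by (rule double_centralizersI) (auto simp: dc_defs bounded_operators_zero[OF p] qsimps[OF p])
  show "dc_one p \<in> double_centralizers p"
    by (rule double_centralizersI) (auto simp: dc_defs bounded_operators_one[OF p])
  show "dc_embed p a \<in> double_centralizers p"
    by (rule double_centralizersI)
      (auto simp: dc_defs bounded_operators_embed[OF p] qsimps[OF p] mult.assoc)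
next
  assume m: "m \<in> double_centralizers p"
  note mD = double_centralizersD[OF m]
  obtain l r where lr: "\<And>a. fst m (coset p a) = coset p (l a)" "\<And>a. snd m (coset p a) = coset p (r a)"
    using double_centralizers_cosetE[OF m] by metis
  have lr_mult: "coset p (a * l b) = coset p (r a * b)" for a b
    using mD(3)[of "coset p a" "coset p b"] by (simp add: lr qsimps[OF p])
  show "dc_scale p c m \<in> double_centralizers p"
  proof (rule double_centralizersI)
    show "qmult p (coset p a) (fst (dc_scale p c m) (coset p b)) =
      qmult p (snd (dc_scale p c m) (coset p a)) (coset p b)" for a b
      using coset_cong(2)[OF p lr_mult refl, of c a b]
      by (simp add: dc_defs lr qsimps[OF p] mult_scaleC_left mult_scaleC_right)
  qed (simp_all add: dc_defs bounded_operators_scale[OF p] mD)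
  assume n: "n \<in> double_centralizers p"
  note nD = double_centralizersD[OF n]
  obtain l' r' where lr': "\<And>a. fst n (coset p a) = coset p (l' a)" "\<And>a. snd n (coset p a) = coset p (r' a)"
    using double_centralizers_cosetE[OF n] by metis
  have lr_mult': "coset p (a * l' b) = coset p (r' a * b)" for a b
    using nD(3)[of "coset p a" "coset p b"] by (simp add: lr' qsimps[OF p])
  show "dc_add p m n \<in> double_centralizers p"
  proof (rule double_centralizersI)
    show "qmult p (coset p a) (fst (dc_add p m n) (coset p b)) =
      qmult p (snd (dc_add p m n) (coset p a)) (coset p b)" for a b
      using coset_cong(1)[OF p lr_mult lr_mult', of a b a b]
      by (simp add: dc_defs lr lr' qsimps[OF p] distrib_left distrib_right)
  qed (simp_all add: dc_defs bounded_operators_add[OF p] mD nD)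
  show "dc_mult p m n \<in> double_centralizers p"
  proof (rule double_centralizersI)
    show "qmult p (coset p a) (fst (dc_mult p m n) (coset p b)) =
      qmult p (snd (dc_mult p m n) (coset p a)) (coset p b)" for a b
      by (simp add: dc_defs lr lr' qsimps[OF p] lr_mult lr_mult')
  qed (simp_all add: dc_defs bounded_operators_comp[OF p] mD nD)
qed

lemma dc_compatible_ops:
  assumes p: "cstar_seminorm p" and q: "cstar_seminorm q" and le: "q \<le> p"
  shows "dc_compatible p q (dc_zero p) (dc_zero q)" "dc_compatible p q (dc_one p) (dc_one q)"
    "dc_compatible p q (dc_embed p a) (dc_embed q a)"
    "m \<in> double_centralizers p \<Longrightarrow> dc_compatible p q m m' \<Longrightarrow>
       dc_compatible p q (dc_scale p c m) (dc_scale q c m')"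
    "m \<in> double_centralizers p \<Longrightarrow> n \<in> double_centralizers p \<Longrightarrow>
       dc_compatible p q m m' \<Longrightarrow> dc_compatible p q n n' \<Longrightarrow>
       dc_compatible p q (dc_add p m n) (dc_add q m' n')"
    "m \<in> double_centralizers p \<Longrightarrow> n \<in> double_centralizers p \<Longrightarrow>
       dc_compatible p q m m' \<Longrightarrow> dc_compatible p q n n' \<Longrightarrow>
       dc_compatible p q (dc_mult p m n) (dc_mult q m' n')"
proof -
  note [simp] = quot_map_coset[OF p q le] qsimps[OF p] qsimps[OF q]
  show "dc_compatible p q (dc_zero p) (dc_zero q)" "dc_compatible p q (dc_one p) (dc_one q)"
    "dc_compatible p q (dc_embed p a) (dc_embed q a)"
    by (auto simp: dc_compatible_def dc_defs elim!: quotE)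
  assume m: "m \<in> double_centralizers p" and mm: "dc_compatible p q m m'"
  obtain l r where lr: "\<And>a. fst m (coset p a) = coset p (l a)" "\<And>a. snd m (coset p a) = coset p (r a)"
    using double_centralizers_cosetE[OF m] by metis
  have lr2: "fst m' (coset q a) = coset q (l a)" "snd m' (coset q a) = coset q (r a)" for a
    using mm[unfolded dc_compatible_def, rule_format, OF coset_quot, of a] by (simp_all add: lr)
  show "dc_compatible p q (dc_scale p c m) (dc_scale q c m')"
    by (auto simp: dc_compatible_def dc_defs lr lr2 elim!: quotE)
  assume n: "n \<in> double_centralizers p" and nn: "dc_compatible p q n n'"
  obtain l' r' where lr': "\<And>a. fst n (coset p a) = coset p (l' a)" "\<And>a. snd n (coset p a) = coset p (r' a)"
    using double_centralizers_cosetE[OF n] by metis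
  have lr2': "fst n' (coset q a) = coset q (l' a)" "snd n' (coset q a) = coset q (r' a)" for a
    using nn[unfolded dc_compatible_def, rule_format, OF coset_quot, of a] by (simp_all add: lr')
  show "dc_compatible p q (dc_add p m n) (dc_add q m' n')"
    "dc_compatible p q (dc_mult p m n) (dc_mult q m' n')"
    by (auto simp: dc_compatible_def dc_defs lr lr2 lr' lr2' elim!: quotE)
qed

lemma cstar_seminormsD: "p \<in> cstar_seminorms \<Longrightarrow> cstar_seminorm p"
  by (simp add: cstar_seminorms_def)

section \<open>The multiplier algebra \<open>M(A)\<close> as the inverse limit of the \<open>M(A\<^sub>p)\<close>\<close>

typedef (overloaded) 'a::topological_star_algebra multiplier =
  "{x \<in> Pi\<^sub>E (cstar_seminorms :: ('a \<Rightarrow> real) set) double_centralizers.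
      \<forall>p\<in>cstar_seminorms. \<forall>q\<in>cstar_seminorms. q \<le> p \<longrightarrow> dc_compatible p q (x p) (x q)}"
  morphisms component Abs_multiplier
proof
  show "(\<lambda>p\<in>cstar_seminorms. dc_zero p) \<in>
    {x \<in> Pi\<^sub>E (cstar_seminorms :: ('a \<Rightarrow> real) set) double_centralizers.
      \<forall>p\<in>cstar_seminorms. \<forall>q\<in>cstar_seminorms. q \<le> p \<longrightarrow> dc_compatible p q (x p) (x q)}"
    using dc_closed(1) dc_compatible_ops(1) by (auto dest!: cstar_seminormsD)
qed

setup_lifting type_definition_multiplier

text \<open>The canonical embedding of \<open>A\<close> into \<open>M(A)\<close>.\<close>

lift_definition embed :: "'a::topological_star_algebra \<Rightarrow> 'a multiplier"
  is "\<lambda>a. \<lambda>p\<in>cstar_seminorms. dc_embed p a"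
  using dc_closed(3) dc_compatible_ops(3) by (auto dest!: cstar_seminormsD)

instantiation multiplier :: (topological_star_algebra) "{complex_algebra, monoid_mult}"
begin

lift_definition zero_multiplier :: "'a multiplier" is "\<lambda>p\<in>cstar_seminorms. dc_zero p"
  using dc_closed(1) dc_compatible_ops(1) by (auto dest!: cstar_seminormsD)

lift_definition one_multiplier :: "'a multiplier" is "\<lambda>p\<in>cstar_seminorms. dc_one p"
  using dc_closed(2) dc_compatible_ops(2) by (auto dest!: cstar_seminormsD)

lift_definition plus_multiplier :: "'a multiplier \<Rightarrow> 'a multiplier \<Rightarrow> 'a multiplier"
  is "\<lambda>x y. \<lambda>p\<in>cstar_seminorms. dc_add p (x p) (y p)"
  by (auto simp: PiE_mem intro!: dc_closed(5) dc_compatible_ops(5) dest: cstar_seminormsD)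

lift_definition scaleC_multiplier :: "complex \<Rightarrow> 'a multiplier \<Rightarrow> 'a multiplier"
  is "\<lambda>c x. \<lambda>p\<in>cstar_seminorms. dc_scale p c (x p)"
  by (auto simp: PiE_mem intro!: dc_closed(4) dc_compatible_ops(4) dest: cstar_seminormsD)

lift_definition times_multiplier :: "'a multiplier \<Rightarrow> 'a multiplier \<Rightarrow> 'a multiplier"
  is "\<lambda>x y. \<lambda>p\<in>cstar_seminorms. dc_mult p (x p) (y p)"
  by (auto simp: PiE_mem intro!: dc_closed(6) dc_compatible_ops(6) dest: cstar_seminormsD)

definition uminus_multiplier :: "'a multiplier \<Rightarrow> 'a multiplier" where
  "uminus_multiplier x = (-1) *\<^sub>C x"

definition minus_multiplier :: "'a multiplier \<Rightarrow> 'a multiplier \<Rightarrow> 'a multiplier" where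
  "minus_multiplier x y = x + (- y :: 'a multiplier)"

lemma component_dc: "p \<in> cstar_seminorms \<Longrightarrow> component x p \<in> double_centralizers p"
  using component[of x] by (auto simp: PiE_mem)

lemma component_ops:
  assumes "p \<in> cstar_seminorms"
  shows "component 0 p = dc_zero p" "component 1 p = dc_one p"
    "component (x + y) p = dc_add p (component x p) (component y p)"
    "component (c *\<^sub>C x) p = dc_scale p c (component x p)"
    "component (x * y) p = dc_mult p (component x p) (component y p)"
  using assms by (transfer; simp)+

lemma multiplier_eqI:
  fixes x y :: "'a multiplier"
  assumes "\<And>p a. p \<in> cstar_seminorms \<Longrightarrow> fst (component x p) (coset p a) = fst (component y p) (coset p a)"
    "\<And>p a. p \<in> cstar_seminorms \<Longrightarrow> snd (component x p) (coset p a) = snd (component y p) (coset p a)"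
  shows "x = y"
proof -
  have "component x p = component y p" if p: "p \<in> cstar_seminorms" for p
    using assms[OF p] double_centralizers_extensional[OF component_dc[OF p]]
    by (intro double_centralizers_ext[where p = p]) auto
  moreover have "component x \<in> extensional cstar_seminorms" "component y \<in> extensional cstar_seminorms"
    using component[of x] component[of y] by (auto simp: PiE_def)
  ultimately have "component x = component y" by (intro extensionalityI) auto
  then show ?thesis by (simp add: component_inject)
qed

lemma component_cosetE:
  fixes x :: "'a multiplier"
  obtains l r where
    "\<And>p a. p \<in> cstar_seminorms \<Longrightarrow> fst (component x p) (coset p a) = coset p (l p a)"
    "\<And>p a. p \<in> cstar_seminorms \<Longrightarrow> snd (component x p) (coset p a) = coset p (r p a)"
proof -
  have "\<forall>p a. p \<in> cstar_seminorms \<longrightarrow> (\<exists>b. fst (component x p) (coset p a) = coset p b)"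
    "\<forall>p a. p \<in> cstar_seminorms \<longrightarrow> (\<exists>b. snd (component x p) (coset p a) = coset p b)"
    using double_centralizers_maps[OF component_dc coset_quot] by (metis quotE)+
  then show ?thesis using that by metis
qed

instance
proof
  note ops = component_ops dc_defs qsimps[OF cstar_seminormsD]
  fix x y z :: "'a multiplier" and c d :: complex
  obtain lx rx where x: "\<And>p a. p \<in> cstar_seminorms \<Longrightarrow> fst (component x p) (coset p a) = coset p (lx p a)"
    "\<And>p a. p \<in> cstar_seminorms \<Longrightarrow> snd (component x p) (coset p a) = coset p (rx p a)"
    using component_cosetE[of x] by metis
  obtain ly ry where y: "\<And>p a. p \<in> cstar_seminorms \<Longrightarrow> fst (component y p) (coset p a) = coset p (ly p a)"
    "\<And>p a. p \<in> cstar_seminorms \<Longrightarrow> snd (component y p) (coset p a) = coset p (ry p a)"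
    using component_cosetE[of y] by metis
  obtain lz rz where z: "\<And>p a. p \<in> cstar_seminorms \<Longrightarrow> fst (component z p) (coset p a) = coset p (lz p a)"
    "\<And>p a. p \<in> cstar_seminorms \<Longrightarrow> snd (component z p) (coset p a) = coset p (rz p a)"
    using component_cosetE[of z] by metis
  note lin = bounded_operators_lin[OF cstar_seminormsD]
  note lx = lin[OF _ double_centralizersD(1)[OF component_dc, of _ x] x(1)]
    and ry = lin[OF _ double_centralizersD(2)[OF component_dc, of _ y] y(2)]
    and rz = lin[OF _ double_centralizersD(2)[OF component_dc, of _ z] z(2)]
  show "x + y + z = x + (y + z)"
    by (rule multiplier_eqI) (simp_all add: ops x y z add.assoc)
  show "x + y = y + x"
    by (rule multiplier_eqI) (simp_all add: ops x y add.commute)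
  show "0 + x = x"
    by (rule multiplier_eqI) (simp_all add: ops x)
  show "- x + x = 0"
    by (rule multiplier_eqI) (simp_all add: uminus_multiplier_def ops x scaleC_minus_one)
  show "x - y = x + - y"
    by (simp add: minus_multiplier_def)
  show "c *\<^sub>C (x + y) = c *\<^sub>C x + c *\<^sub>C y"
    by (rule multiplier_eqI) (simp_all add: ops x y scaleC_add_right)
  show "(c + d) *\<^sub>C x = c *\<^sub>C x + d *\<^sub>C x"
    by (rule multiplier_eqI) (simp_all add: ops x scaleC_add_left)
  show "c *\<^sub>C d *\<^sub>C x = (c * d) *\<^sub>C x"
    by (rule multiplier_eqI) (simp_all add: ops x scaleC_scaleC)
  show "1 *\<^sub>C x = x"
    by (rule multiplier_eqI) (simp_all add: ops x scaleC_one)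
  show "x * y * z = x * (y * z)"
    by (rule multiplier_eqI) (simp_all add: ops x y z)
  show "(x + y) * z = x * z + y * z"
    by (rule multiplier_eqI) (simp_all add: ops x y z rz)
  show "x * (y + z) = x * y + x * z"
    by (rule multiplier_eqI) (simp_all add: ops x y z lx)
  show "1 * x = x" "x * 1 = x"
    by (rule multiplier_eqI; simp add: ops x)+
  show "(c *\<^sub>C x) * y = c *\<^sub>C (x * y)"
    by (rule multiplier_eqI) (simp_all add: ops x y ry)
  show "x * (c *\<^sub>C y) = c *\<^sub>C (x * y)"
    by (rule multiplier_eqI) (simp_all add: ops x y lx)
qed

end

section \<open>Topologies and polars on \<open>M(A)\<close>\<close>

definition mult_seminorm :: "('a::topological_star_algebra \<Rightarrow> real) \<Rightarrow> 'a multiplier \<Rightarrow> real" where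
  "mult_seminorm p x = dc_norm p (component x p)"

definition tau_topology :: "'a::topological_star_algebra multiplier topology" where
  "tau_topology = seminorm_topology (mult_seminorm ` cstar_seminorms)"

definition strict_topology :: "'a::topological_star_algebra multiplier topology" where
  "strict_topology = seminorm_topology
     ({\<lambda>x. mult_seminorm p (x * embed a) |p a. p \<in> cstar_seminorms} \<union>
      {\<lambda>x. mult_seminorm p (embed a * x) |p a. p \<in> cstar_seminorms})"

text \<open>Extensional, so that a gauge is a function on \<open>S(A)\<close> only.\<close>

definition gauges :: "(('a::topological_star_algebra \<Rightarrow> real) \<Rightarrow> real) set" where
  "gauges = cstar_seminorms \<rightarrow>\<^sub>E {0<..}"

definition gauge_ball ::
  "(('a::topological_star_algebra \<Rightarrow> real) \<Rightarrow> real) \<Rightarrow> 'a multiplier set" where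
  "gauge_ball \<gamma> = {x. \<forall>p\<in>cstar_seminorms. mult_seminorm p x \<le> \<gamma> p}"

definition polar :: "'a::topological_star_algebra multiplier set \<Rightarrow> ('a multiplier \<Rightarrow> complex) set" where
  "polar V = {f \<in> continuous_dual (bdd_top strict_topology). \<forall>x\<in>V. cmod (f x) \<le> 1}"

definition nhd_assignment ::
  "((('a::topological_star_algebra \<Rightarrow> real) \<Rightarrow> real) \<Rightarrow> 'a multiplier set) \<Rightarrow> bool" where
  "nhd_assignment \<nu> \<longleftrightarrow> (\<forall>\<gamma>\<in>gauges. nhd_zero strict_topology (\<nu> \<gamma>))"

definition W_hull ::
  "((('a::topological_star_algebra \<Rightarrow> real) \<Rightarrow> real) \<Rightarrow> 'a multiplier set) \<Rightarrow> 'a multiplier set" where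
  "W_hull \<nu> = absolutely_convex hull (\<Union>\<gamma>\<in>gauges. gauge_ball \<gamma> \<inter> \<nu> \<gamma>)"

text \<open>The canonical map from \<open>A\<close> to \<open>A\<^sub>p\<close> is \<^term>\<open>coset p\<close>, the one from \<open>M(A)\<close> to \<open>M(A\<^sub>p)\<close> is
  \<^term>\<open>\<lambda>x. component x p\<close>.\<close>

definition factors_quotient ::
  "('a::topological_star_algebra \<Rightarrow> real) \<Rightarrow> ('a multiplier \<Rightarrow> complex) \<Rightarrow> bool" where
  "factors_quotient p f \<longleftrightarrow> (\<exists>g. \<forall>a. f (embed a) = g (coset p a))"

definition factors_mult_quotient ::
  "('a::topological_star_algebra \<Rightarrow> real) \<Rightarrow> ('a multiplier \<Rightarrow> complex) \<Rightarrow> bool" where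
  "factors_mult_quotient p f \<longleftrightarrow> (\<exists>g. \<forall>x. f x = g (component x p))"

end

theory Submission
  imports Defs
begin

text \<open>
  Two facts carry the argument. First, for self-adjoint \<open>h\<close> the exponential \<open>exp (i h)\<close> is unitary for
  every continuous C*-seminorm at once. Hence \<open>sin h\<close> is bounded by 1 in all seminorms, and iterating
  a suitably scaled \<open>a \<mapsto> a - sin a\<close> lifts elements of \<open>A\<^sub>p\<close> to elements of \<open>A\<close> with all seminorms bounded by a multiple
  of their norm in \<open>A\<^sub>p\<close>; also \<open>(1 - exp (i \<pi> e\<^sub>\<lambda>)) / 2\<close> is an approximate unit with contractive complement.
  Second, such an approximate unit gives a Cohen factorization of null sequences by invertible
  approximants with Neumann series inverses. The factorization yields the uniform boundedness principle
  for strictly bounded sets.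

  On a gauge ball, \<open>x \<mapsto> (1 - e\<^sub>\<lambda>) x (1 - e\<^sub>\<lambda>)\<close> tends to 0 uniformly in the strict topology, so that
  eventually \<open>(1 - e\<^sub>\<lambda>) x (1 - e\<^sub>\<lambda>)\<close> lies in \<open>\<epsilon> (B\<^sub>\<gamma> \<inter> V\<^sub>\<gamma>)\<close> for a suitable gauge; this is (1). If the polar
  factors through \<open>A\<^sub>p\<close>, the lifts turn (1) into norm estimates on \<open>A\<^sub>p\<close>, and a telescoping
  decomposition with Cohen factorization bounds the polar by \<open>K (p (x a) + p (a x))\<close> for one \<open>a\<close>.
  By Hahn--Banach every continuous seminorm of \<open>\<beta>\<^sub>b\<close> is then strictly continuous.
\<close>

section \<open>Seminorms and locally convex topologies\<close>

text \<open>Two mismatches shape the argument. Polars are tested on gauge balls, which constrain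
  every seminorm at once, while factorization through A_p controls a single p. Lifts bounded in all
  seminorms bridge the two, and unitaries supply them, because the C*-identity turns
  \<open>star v * v = 1\<close> into a bound valid in every quotient; only a convergent power series
  enters.

  Secondly, the triangle inequality bounds the seminorms of 1 - e_\<lambda> only by 2, which would
  ruin the Neumann series behind the Cohen factorization. The function (1 - exp (i \<pi> t)) / 2
  fixes 0 and 1, and its complement is the average of 1 and a unitary; this explains the constant
  \<pi>.

  Smallness is sought for (1 - e) x (1 - e), with complements on both sides, because a strict
  neighbourhood tests x a and a x together. For \<beta>_b no explicit seminorms are at hand: what
  enters is its agreement with \<beta> on bounded sets and its being the finest such
  topology.\<close>

context
  fixes p :: "'v::complex_vector \<Rightarrow> real"
  assumes p: "cseminorm p"
begin

lemma cseminorm_add: "p (x + y) \<le> p x + p y"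
  and cseminorm_scale: "p (c *\<^sub>C x) = cmod c * p x"
  using p by (auto simp: cseminorm_def)

lemma cseminorm_scale_real: "0 \<le> t \<Longrightarrow> p (complex_of_real t *\<^sub>C x) = t * p x"
  by (simp add: cseminorm_scale)

lemma cseminorm_scale_inverse: "0 < t \<Longrightarrow> p (complex_of_real (1 / t) *\<^sub>C x) = p x / t"
  by (simp add: cseminorm_scale norm_divide)

lemma cseminorm_minus: "p (- x) = p x"
  using cseminorm_scale[of "-1" x] by (simp add: scaleC_minus_one)

lemma cseminorm_zero: "p 0 = 0"
  using cseminorm_scale[of 0 0] by simp

lemma cseminorm_nonneg: "0 \<le> p x"
  using cseminorm_add[of x "- x"] by (simp add: cseminorm_minus cseminorm_zero)

lemma cseminorm_diff: "p (x - y) \<le> p x + p y"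
  using cseminorm_add[of x "- y"] by (simp add: cseminorm_minus)

lemma cseminorm_diff_commute: "p (x - y) = p (y - x)"
  using cseminorm_minus[of "x - y"] by simp

lemma cseminorm_triangle_sub: "p x \<le> p y + p (x - y)"
  using cseminorm_add[of y "x - y"] by simp

lemma cseminorm_sum: "p (sum f I) \<le> (\<Sum>i\<in>I. p (f i))"
proof (induction I rule: infinite_finite_induct)
  case (insert i I)
  then show ?case using cseminorm_add[of "f i" "sum f I"] by simp
qed (simp_all add: cseminorm_zero)

lemma tendsto_cseminorm:
  assumes "((\<lambda>i. p (f i - x)) \<longlongrightarrow> 0) F"
  shows "((\<lambda>i. p (f i)) \<longlongrightarrow> p x) F"
proof (rule LIM_zero_cancel, rule Lim_null_comparison[OF _ assms], rule always_eventually, rule allI)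
  show "norm (p (f i) - p x) \<le> p (f i - x)" for i
    using cseminorm_triangle_sub[of "f i" x] cseminorm_triangle_sub[of x "f i"]
    by (simp add: cseminorm_diff_commute[of x])
qed

end

lemma scaleC_sum_left: "(\<Sum>i\<in>I. f i) *\<^sub>C x = (\<Sum>i\<in>I. f i *\<^sub>C (x :: 'v::complex_vector))"
  by (induction I rule: infinite_finite_induct) (simp_all add: scaleC_add_left)

lemma scaleC_minus_left: "(- c) *\<^sub>C x = - (c *\<^sub>C (x::'v::complex_vector))"
  using scaleC_add_left[of c "- c" x] by (simp add: eq_neg_iff_add_eq_0 add.commute)

lemma openin_seminorm_ball:
  assumes "Q \<subseteq> P" "finite Q" "\<delta> > 0"
  shows "openin (seminorm_topology P) {y. \<forall>q\<in>Q. q (y - x) < \<delta>}"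
  using assms(2,1)
proof (induction Q rule: finite_induct)
  case empty
  have "openin (seminorm_topology P) (topspace (seminorm_topology P))" by blast
  then show ?case by simp
next
  case (insert q Q)
  have "openin (seminorm_topology P) {y. q (y - x) < \<delta>}"
    unfolding seminorm_topology_def using insert.prems assms(3)
    by (intro topology_generated_by_Basis) blast
  moreover have "{y. \<forall>r\<in>insert q Q. r (y - x) < \<delta>} = {y. q (y - x) < \<delta>} \<inter> {y. \<forall>r\<in>Q. r (y - x) < \<delta>}"
    by blast
  ultimately show ?case using insert by auto
qed

text \<open>Subbasic balls have arbitrary centres; the triangle inequality recentres one at any of
  its points with a smaller radius, so finitely many balls around the point itself suffice.\<close>

lemma openin_seminorm_topology_iff:
  assumes P: "\<And>p. p \<in> P \<Longrightarrow> cseminorm p"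
  shows "openin (seminorm_topology P) U \<longleftrightarrow>
    (\<forall>x\<in>U. \<exists>Q \<delta>. Q \<subseteq> P \<and> finite Q \<and> \<delta> > 0 \<and> {y. \<forall>q\<in>Q. q (y - x) < \<delta>} \<subseteq> U)"
proof
  assume "openin (seminorm_topology P) U"
  then have "generate_topology_on (insert UNIV {{y. p (y - x) < r} |p x r. p \<in> P \<and> r > 0}) U"
    by (simp add: seminorm_topology_def openin_topology_generated_by_iff)
  then show "\<forall>x\<in>U. \<exists>Q \<delta>. Q \<subseteq> P \<and> finite Q \<and> \<delta> > 0 \<and> {y. \<forall>q\<in>Q. q (y - x) < \<delta>} \<subseteq> U"
  proof induction
    case Empty
    then show ?case by simp
  next
    case (Int a b)
    show ?case
    proof
      fix x assume "x \<in> a \<inter> b"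
      then have x: "x \<in> a" "x \<in> b" by auto
      obtain Q \<delta> where Q: "Q \<subseteq> P" "finite Q" "\<delta> > 0" "{y. \<forall>q\<in>Q. q (y - x) < \<delta>} \<subseteq> a"
        using bspec[OF Int.IH(1) x(1)] by (elim exE conjE) (rule that)
      obtain Q' \<delta>' where Q': "Q' \<subseteq> P" "finite Q'" "\<delta>' > 0" "{y. \<forall>q\<in>Q'. q (y - x) < \<delta>'} \<subseteq> b"
        using bspec[OF Int.IH(2) x(2)] by (elim exE conjE) (rule that)
      show "\<exists>Q \<delta>. Q \<subseteq> P \<and> finite Q \<and> \<delta> > 0 \<and> {y. \<forall>q\<in>Q. q (y - x) < \<delta>} \<subseteq> a \<inter> b"
        using Q Q' by (intro exI[of _ "Q \<union> Q'"] exI[of _ "min \<delta> \<delta>'"]) auto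
    qed
  next
    case (UN K)
    then show ?case by (meson Sup_upper UnionE order_trans)
  next
    case (Basis s)
    show ?case
    proof (cases "s = UNIV")
      case True
      then show ?thesis by (intro ballI exI[of _ "{}"] exI[of _ 1]) auto
    next
      case False
      then obtain p z r where s: "s = {y. p (y - z) < r}" "p \<in> P" "r > 0" using Basis by blast
      show ?thesis
      proof
        fix x assume "x \<in> s"
        then have x: "p (x - z) < r" by (simp add: s)
        have "p (y - z) < r" if "p (y - x) < r - p (x - z)" for y
          using cseminorm_add[OF P[OF s(2)], of "y - x" "x - z"] that by simp
        then show "\<exists>Q \<delta>. Q \<subseteq> P \<and> finite Q \<and> \<delta> > 0 \<and> {y. \<forall>q\<in>Q. q (y - x) < \<delta>} \<subseteq> s"
          using x s by (intro exI[of _ "{p}"] exI[of _ "r - p (x - z)"]) auto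
      qed
    qed
  qed
next
  assume R: "\<forall>x\<in>U. \<exists>Q \<delta>. Q \<subseteq> P \<and> finite Q \<and> \<delta> > 0 \<and> {y. \<forall>q\<in>Q. q (y - x) < \<delta>} \<subseteq> U"
  show "openin (seminorm_topology P) U"
  proof (subst openin_subopen, intro ballI)
    fix x assume "x \<in> U"
    obtain Q \<delta> where Q: "Q \<subseteq> P" "finite Q" "\<delta> > 0" "{y. \<forall>q\<in>Q. q (y - x) < \<delta>} \<subseteq> U"
      using bspec[OF R \<open>x \<in> U\<close>] by (elim exE conjE) (rule that)
    moreover have "q (x - x) < \<delta>" if "q \<in> Q" for q
      using cseminorm_zero[OF P, of q] Q(1,3) that by (simp add: subset_iff)
    ultimately show "\<exists>T. openin (seminorm_topology P) T \<and> x \<in> T \<and> T \<subseteq> U"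
      using openin_seminorm_ball[OF Q(1-3), of x] Q(4)
      by (intro exI[of _ "{y. \<forall>q\<in>Q. q (y - x) < \<delta>}"] conjI) simp_all
  qed
qed

lemma nhd_zero_seminorm_topology:
  assumes P: "\<And>p. p \<in> P \<Longrightarrow> cseminorm p"
  shows "nhd_zero (seminorm_topology P) V \<longleftrightarrow>
    (\<exists>Q \<delta>. Q \<subseteq> P \<and> finite Q \<and> \<delta> > 0 \<and> {y. \<forall>q\<in>Q. q y < \<delta>} \<subseteq> V)"
proof
  assume "nhd_zero (seminorm_topology P) V"
  then obtain U where U: "openin (seminorm_topology P) U" "0 \<in> U" "U \<subseteq> V"
    by (auto simp: nhd_zero_def)
  have "\<exists>Q \<delta>. Q \<subseteq> P \<and> finite Q \<and> \<delta> > 0 \<and> {y. \<forall>q\<in>Q. q (y - 0) < \<delta>} \<subseteq> U"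
    using iffD1[OF openin_seminorm_topology_iff[OF P] U(1)] U(2) by (rule bspec)
  then show "\<exists>Q \<delta>. Q \<subseteq> P \<and> finite Q \<and> \<delta> > 0 \<and> {y. \<forall>q\<in>Q. q y < \<delta>} \<subseteq> V"
    using U(3) by (elim ex_forward conj_forward) simp_all
next
  assume "\<exists>Q \<delta>. Q \<subseteq> P \<and> finite Q \<and> \<delta> > 0 \<and> {y. \<forall>q\<in>Q. q y < \<delta>} \<subseteq> V"
  then obtain Q \<delta> where Q: "Q \<subseteq> P" "finite Q" "\<delta> > 0" "{y. \<forall>q\<in>Q. q y < \<delta>} \<subseteq> V"
    by (elim exE conjE) (rule that)
  have "q 0 < \<delta>" if "q \<in> Q" for q
    using cseminorm_zero[OF P, of q] Q(1,3) that by (simp add: subset_iff)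
  then have "0 \<in> {y. \<forall>q\<in>Q. q (y - 0) < \<delta>}" by simp
  then show "nhd_zero (seminorm_topology P) V"
    unfolding nhd_zero_def using openin_seminorm_ball[OF Q(1-3), of 0] Q(4)
    by (intro exI[of _ "{y. \<forall>q\<in>Q. q (y - 0) < \<delta>}"]) simp
qed

lemma nhd_zero_scale:
  assumes P: "\<And>p. p \<in> P \<Longrightarrow> cseminorm p" and V: "nhd_zero (seminorm_topology P) V" and t: "t > 0"
  shows "nhd_zero (seminorm_topology P) {x. complex_of_real (1 / t) *\<^sub>C x \<in> V}"
proof (rule iffD2[OF nhd_zero_seminorm_topology[OF P]], assumption)
  have "\<exists>Q \<delta>. Q \<subseteq> P \<and> finite Q \<and> \<delta> > 0 \<and> {y. \<forall>q\<in>Q. q y < \<delta>} \<subseteq> V"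
    by (rule iffD1[OF nhd_zero_seminorm_topology[OF P] V])
  then obtain Q \<delta> where Q: "Q \<subseteq> P" "finite Q" "\<delta> > 0" "{y. \<forall>q\<in>Q. q y < \<delta>} \<subseteq> V"
    by (elim exE conjE) (rule that)
  have "q (complex_of_real (1 / t) *\<^sub>C y) < \<delta>" if "q \<in> Q" "q y < t * \<delta>" for q y
    using that(2) t unfolding cseminorm_scale_inverse[OF P[OF subsetD[OF Q(1) that(1)]] t]
    by (simp add: pos_divide_less_eq mult.commute)
  then have "{y. \<forall>q\<in>Q. q y < t * \<delta>} \<subseteq> {x. complex_of_real (1 / t) *\<^sub>C x \<in> V}" using Q(4) by blast
  then show "\<exists>Q \<delta>. Q \<subseteq> P \<and> finite Q \<and> \<delta> > 0 \<and> {y. \<forall>q\<in>Q. q y < \<delta>} \<subseteq> {x. complex_of_real (1 / t) *\<^sub>C x \<in> V}"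
    using Q(1-3) t by (intro exI[of _ Q] exI[of _ "t * \<delta>"]) simp
qed

section \<open>Completeness of \<open>A\<close>\<close>

lemma cseminorm_cstar: "p \<in> cstar_seminorms \<Longrightarrow> cseminorm p"
  using cstar_seminormsD by (auto simp: cstar_seminorm_def)

lemma cstar_seminorm_square: "p \<in> cstar_seminorms \<Longrightarrow> p (star x * x) = (p x)\<^sup>2"
  using cstar_seminormsD by (auto simp: cstar_seminorm_def)

text \<open>The C*-identity and submultiplicativity give
  \<open>(p y)^2 \<le> p (star y) * p y\<close>; cancelling \<open>p y\<close> leaves one
  inequality, and applying it to the adjoint gives the other.\<close>

lemma sn_star:
  assumes "p \<in> cstar_seminorms"
  shows "p (star x) = p x"
proof -
  have le: "p y \<le> p (star y)" for y
  proof (cases "p y = 0")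
    case False
    then have "p y > 0" using cseminorm_nonneg[OF cseminorm_cstar[OF assms], of y] by simp
    moreover have "p y * p y \<le> p (star y) * p y"
      using cstar_seminorm_square[OF assms, of y] sn_mult[OF cstar_seminormsD[OF assms], of "star y" y]
      by (simp add: power2_eq_square)
    ultimately show ?thesis by simp
  qed (simp add: cseminorm_nonneg[OF cseminorm_cstar[OF assms]])
  show ?thesis using le[of x] le[of "star x"] by (simp add: star_star)
qed

lemma zero_cstar_seminorms: "(\<lambda>_. 0) \<in> cstar_seminorms"
  by (simp add: cstar_seminorms_def cstar_seminorm_def cseminorm_def)

lemma cstar_seminorms_max:
  assumes p: "p \<in> cstar_seminorms" and q: "q \<in> cstar_seminorms"
  shows "(\<lambda>x. max (p x) (q x)) \<in> cstar_seminorms"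
proof -
  note [simp] = cseminorm_nonneg[OF cseminorm_cstar[OF p]] cseminorm_nonneg[OF cseminorm_cstar[OF q]]
  note sn = sn_add sn_mult sn_scale
  have "cseminorm (\<lambda>x. max (p x) (q x))"
    unfolding cseminorm_def
  proof (intro conjI allI)
    show "max (p (x + y)) (q (x + y)) \<le> max (p x) (q x) + max (p y) (q y)" for x y
      using sn(1)[OF cstar_seminormsD[OF p], of x y] sn(1)[OF cstar_seminormsD[OF q], of x y] by linarith
    show "max (p (c *\<^sub>C x)) (q (c *\<^sub>C x)) = cmod c * max (p x) (q x)" for c x
      by (simp add: sn(3)[OF cstar_seminormsD[OF p]] sn(3)[OF cstar_seminormsD[OF q]] max_mult_distrib_left)
  qed
  moreover have "max (p (x * y)) (q (x * y)) \<le> max (p x) (q x) * max (p y) (q y)" for x y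
  proof -
    have "p (x * y) \<le> max (p x) (q x) * max (p y) (q y)"
      by (rule order_trans[OF sn(2)[OF cstar_seminormsD[OF p]]]) (intro mult_mono; simp add: le_max_iff_disj)
    moreover have "q (x * y) \<le> max (p x) (q x) * max (p y) (q y)"
      by (rule order_trans[OF sn(2)[OF cstar_seminormsD[OF q]]]) (intro mult_mono; simp add: le_max_iff_disj)
    ultimately show ?thesis by simp
  qed
  moreover have "max (p (star x * x)) (q (star x * x)) = (max (p x) (q x))\<^sup>2" for x
    unfolding cstar_seminorm_square[OF p] cstar_seminorm_square[OF q]
    by (cases "p x \<le> q x") (simp_all add: max_def not_le)
  moreover have "((\<lambda>x. max (p x) (q x)) \<longlongrightarrow> max (p x) (q x)) (nhds x)" for x
    using p q by (intro tendsto_max) (simp_all add: cstar_seminorms_def)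
  ultimately show ?thesis
    by (simp add: cstar_seminorms_def cstar_seminorm_def)
qed

text \<open>Lets one seminorm stand for finitely many. Maxima, unlike sums, keep the C*-identity;
  the zero seminorm serves the empty family.\<close>

lemma cstar_seminorms_directed:
  assumes "finite Q" "Q \<subseteq> cstar_seminorms"
  obtains p where "p \<in> cstar_seminorms" "\<And>q. q \<in> Q \<Longrightarrow> q \<le> p"
proof -
  have "\<exists>p\<in>cstar_seminorms. \<forall>q\<in>Q. q \<le> p"
    using assms
  proof (induction Q rule: finite_induct)
    case empty
    then show ?case using zero_cstar_seminorms by auto
  next
    case (insert q Q)
    then obtain p where p: "p \<in> cstar_seminorms" "\<forall>r\<in>Q. r \<le> p" by auto
    have "(\<lambda>x. max (p x) (q x)) \<in> cstar_seminorms"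
      using p insert.prems cstar_seminorms_max by auto
    moreover have "\<forall>r\<in>insert q Q. r \<le> (\<lambda>x. max (p x) (q x))"
      using p(2) by (auto simp: le_fun_def le_max_iff_disj)
    ultimately show ?case by blast
  qed
  then show ?thesis using that by blast
qed

section \<open>Convergence and Cauchy filters in terms of C*-seminorms\<close>

lemma tendsto_zero_cstar_seminorm:
  assumes "p \<in> cstar_seminorms" "(f \<longlongrightarrow> 0) F"
  shows "((\<lambda>i. p (f i)) \<longlongrightarrow> 0) F"
proof -
  have "(p \<longlongrightarrow> p 0) (nhds 0)" using assms(1) by (simp add: cstar_seminorms_def)
  then have "(p \<longlongrightarrow> 0) (nhds 0)" by (simp add: cseminorm_zero[OF cseminorm_cstar[OF assms(1)]])
  then show ?thesis using assms(2) by (rule filterlim_compose)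
qed

lemma tendsto_cstar_seminorm:
  fixes a :: "'a::topological_star_algebra"
  assumes "p \<in> cstar_seminorms" "(f \<longlongrightarrow> a) F"
  shows "((\<lambda>i. p (f i - a)) \<longlongrightarrow> 0) F"
  using assms(2) by (intro tendsto_zero_cstar_seminorm[OF assms(1)]) (use tendsto_diff[OF assms(2) tendsto_const[of a]] in simp)

lemma eventually_nhds_zero_pro:
  fixes R :: "'a::pro_cstar_algebra \<Rightarrow> bool"
  assumes "eventually R (nhds 0)"
  obtains p \<delta> where "p \<in> cstar_seminorms" "\<delta> > 0" "\<And>x. p x < \<delta> \<Longrightarrow> R x"
proof -
  obtain U where U: "open U" "0 \<in> U" "\<And>x. x \<in> U \<Longrightarrow> R x"
    using assms unfolding eventually_nhds by blast
  then have nhd: "nhd_zero (seminorm_topology cstar_seminorms) U"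
    by (auto simp: nhd_zero_def open_iff_openin_seminorm_topology)
  have "\<exists>Q \<delta>. Q \<subseteq> cstar_seminorms \<and> finite Q \<and> \<delta> > 0 \<and> {y. \<forall>q\<in>Q. q y < \<delta>} \<subseteq> U"
    by (rule iffD1[OF nhd_zero_seminorm_topology nhd]) (rule cseminorm_cstar)
  then obtain Q \<delta> where Q: "Q \<subseteq> cstar_seminorms" "finite Q" "\<delta> > 0" "{y. \<forall>q\<in>Q. q y < \<delta>} \<subseteq> U"
    by (elim exE conjE) (rule that)
  obtain p where p: "p \<in> cstar_seminorms" "\<And>q. q \<in> Q \<Longrightarrow> q \<le> p"
    using cstar_seminorms_directed[OF Q(2,1)] by blast
  have "R x" if "p x < \<delta>" for x
  proof -
    have "\<forall>q\<in>Q. q x < \<delta>" using p(2) that by (meson le_funD order_le_less_trans)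
    then show ?thesis using Q(4) U(3) by blast
  qed
  then show ?thesis using that p(1) Q(3) by blast
qed

lemma pro_cstar_eq_zeroI:
  fixes x :: "'a::pro_cstar_algebra"
  assumes "\<And>p. p \<in> cstar_seminorms \<Longrightarrow> p x = 0"
  shows "x = 0"
proof (rule ccontr)
  assume "x \<noteq> 0"
  then obtain U where "open U" "0 \<in> U" "x \<notin> U" using t1_space[of 0 x] by metis
  then have "eventually (\<lambda>y. y \<noteq> x) (nhds 0)" by (auto simp: eventually_nhds)
  then obtain p \<delta> where p: "p \<in> cstar_seminorms" "\<delta> > 0" "\<And>y. p y < \<delta> \<Longrightarrow> y \<noteq> x"
    using eventually_nhds_zero_pro by blast
  then show False using assms[OF p(1)] p(3)[of x] by simp
qed

text \<open>The uniformity is that of the additive group, so only differences near 0 matter, and a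
  neighbourhood of 0 contains a ball of a single C*-seminorm.\<close>

lemma complete_pro_cstar:
  fixes f :: "'i \<Rightarrow> 'a::pro_cstar_algebra"
  assumes "F \<noteq> bot"
    and cauchy: "\<And>p \<epsilon>. p \<in> cstar_seminorms \<Longrightarrow> \<epsilon> > 0 \<Longrightarrow>
      \<exists>R. eventually R F \<and> (\<forall>i j. R i \<longrightarrow> R j \<longrightarrow> p (f i - f j) < \<epsilon>)"
  obtains a where "(f \<longlongrightarrow> a) F"
proof -
  have "cauchy_filter (filtermap f F)"
    unfolding cauchy_filter_def cauchy_seq_finset_iff_vanishing
  proof (rule filter_leI)
    fix P :: "'a \<times> 'a \<Rightarrow> bool"
    assume "eventually P (filtercomap (\<lambda>(x, y). y - x) (nhds 0))"
    then obtain R where R: "eventually R (nhds 0)" "\<And>x y. R (y - x) \<Longrightarrow> P (x, y)"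
      by (auto simp: eventually_filtercomap)
    obtain p \<delta> where p: "p \<in> cstar_seminorms" "\<delta> > 0" "\<And>x. p x < \<delta> \<Longrightarrow> R x"
      using eventually_nhds_zero_pro[OF R(1)] by blast
    obtain S where S: "eventually S F" "\<And>i j. S i \<Longrightarrow> S j \<Longrightarrow> p (f i - f j) < \<delta>"
      using cauchy[OF p(1,2)] by blast
    have "eventually (\<lambda>x. \<exists>j. S j \<and> f j = x) (filtermap f F)"
      unfolding eventually_filtermap by (rule eventually_mono[OF S(1)]) blast
    then show "eventually P (filtermap f F \<times>\<^sub>F filtermap f F)"
      unfolding eventually_prod_same
      by (intro exI[of _ "\<lambda>x. \<exists>j. S j \<and> f j = x"]) (use R(2) p(3) S(2) in auto)
  qed
  then obtain a where "filtermap f F \<le> nhds a"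
    using cauchy_filter_complete_converges[OF _ complete_UNIV, of "filtermap f F"] assms(1)
    by (auto simp: filtermap_bot_iff)
  then show ?thesis using that by (simp add: filterlim_def)
qed

text \<open>The tail bound matters as much as convergence: \<open>N = 0\<close> bounds the sum in
  every seminorm, \<open>N = 1\<close> isolates the first term.\<close>

lemma summable_pro_cstar:
  fixes a :: "nat \<Rightarrow> 'a::pro_cstar_algebra"
  assumes "\<And>p. p \<in> cstar_seminorms \<Longrightarrow> summable (\<lambda>n. p (a n))"
  obtains s where "\<And>p. p \<in> cstar_seminorms \<Longrightarrow> (\<lambda>N. p ((\<Sum>n<N. a n) - s)) \<longlonglongrightarrow> 0"
    and "\<And>p N. p \<in> cstar_seminorms \<Longrightarrow> p (s - (\<Sum>n<N. a n)) \<le> (\<Sum>n. p (a (n + N)))"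
proof -
  let ?S = "\<lambda>N. \<Sum>n<N. a n"
  have tail: "p (?S m - ?S N) \<le> (\<Sum>n. p (a (n + N)))" if p: "p \<in> cstar_seminorms" and le: "N \<le> m" for p m N
  proof -
    have "?S m - ?S N = sum a {N..<m}"
      using le by (simp add: lessThan_atLeast0 sum_diff_nat_ivl)
    then have "p (?S m - ?S N) \<le> (\<Sum>n=N..<m. p (a n))"
      using cseminorm_sum[OF cseminorm_cstar[OF p]] by metis
    also have "\<dots> = (\<Sum>n<m - N. p (a (n + N)))"
      using sum.shift_bounds_nat_ivl[of "\<lambda>n. p (a n)" 0 N "m - N"] le by (simp add: lessThan_atLeast0)
    also have "\<dots> \<le> (\<Sum>n. p (a (n + N)))"
      using assms[OF p] cseminorm_nonneg[OF cseminorm_cstar[OF p]]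
      by (intro sum_le_suminf) (auto intro: summable_ignore_initial_segment)
    finally show ?thesis .
  qed
  have tail0: "(\<lambda>N. \<Sum>n. p (a (n + N))) \<longlonglongrightarrow> 0" if "p \<in> cstar_seminorms" for p
    by (rule suminf_exist_split2) (use assms[OF that] in auto)
  have cauchy: "\<exists>R. eventually R sequentially \<and> (\<forall>i j. R i \<longrightarrow> R j \<longrightarrow> p (?S i - ?S j) < \<epsilon>)"
    if p: "p \<in> cstar_seminorms" and "\<epsilon> > 0" for p \<epsilon>
  proof -
    obtain N where N: "(\<Sum>n. p (a (n + N))) < \<epsilon> / 2"
      using order_tendstoD(2)[OF tail0[OF p], of "\<epsilon> / 2"] \<open>\<epsilon> > 0\<close>
      by (auto simp: eventually_sequentially)
    have "p (?S i - ?S j) < \<epsilon>" if "N \<le> i" "N \<le> j" for i j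
      using cseminorm_diff[OF cseminorm_cstar[OF p], of "?S i - ?S N" "?S j - ?S N"]
        tail[OF p that(1)] tail[OF p that(2)] N by simp
    then show ?thesis
      by (intro exI[of _ "\<lambda>i. N \<le> i"]) (auto simp: eventually_sequentially)
  qed
  then obtain s where s: "?S \<longlonglongrightarrow> s"
    using complete_pro_cstar[of sequentially ?S, OF sequentially_bot cauchy] by blast
  have lim: "(\<lambda>N. p (?S N - s)) \<longlonglongrightarrow> 0" if "p \<in> cstar_seminorms" for p
    by (rule tendsto_cstar_seminorm[OF that s])
  moreover have "p (s - ?S N) \<le> (\<Sum>n. p (a (n + N)))" if p: "p \<in> cstar_seminorms" for p N
  proof (rule tendsto_upperbound[OF tendsto_cseminorm[OF cseminorm_cstar[OF p]]])
    show "(\<lambda>m. p (?S m - ?S N - (s - ?S N))) \<longlonglongrightarrow> 0" using lim[OF p] by simp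
    show "\<forall>\<^sub>F m in sequentially. p (?S m - ?S N) \<le> (\<Sum>n. p (a (n + N)))"
      using tail[OF p] by (auto simp: eventually_sequentially)
  qed simp
  ultimately show ?thesis using that by blast
qed

section \<open>\<open>A\<close> as an ideal of \<open>M(A)\<close>\<close>

text \<open>The family is read as a net indexed by the seminorms themselves: beyond \<open>p\<close>
  all values agree with \<open>l p\<close> modulo ker p, so the net is Cauchy and its limit
  represents the whole family.\<close>

lemma inverse_limit_pro_cstar:
  fixes l :: "('a::pro_cstar_algebra \<Rightarrow> real) \<Rightarrow> 'a"
  assumes coh: "\<And>p q. p \<in> cstar_seminorms \<Longrightarrow> q \<in> cstar_seminorms \<Longrightarrow> q \<le> p \<Longrightarrow> q (l p - l q) = 0"
  obtains b where "\<And>p. p \<in> cstar_seminorms \<Longrightarrow> p (b - l p) = 0"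
proof -
  define D where "D = (INF p\<in>cstar_seminorms. principal {q \<in> cstar_seminorms. p \<le> (q :: 'a \<Rightarrow> real)})"
  have ev: "eventually P D \<longleftrightarrow> (\<exists>p\<in>cstar_seminorms. \<forall>q\<in>cstar_seminorms. p \<le> q \<longrightarrow> P q)" for P
    unfolding D_def
  proof (subst eventually_INF_base)
    show "cstar_seminorms \<noteq> {}" using zero_cstar_seminorms by (metis empty_iff)
    fix p q :: "'a \<Rightarrow> real" assume pq: "p \<in> cstar_seminorms" "q \<in> cstar_seminorms"
    obtain r where r: "r \<in> cstar_seminorms" "p \<le> r" "q \<le> r"
      by (rule cstar_seminorms_directed[of "{p, q}"]) (use pq in simp_all)
    then show "\<exists>x\<in>cstar_seminorms. principal {q \<in> cstar_seminorms. x \<le> q}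
        \<le> inf (principal {q \<in> cstar_seminorms. p \<le> q}) (principal {r \<in> cstar_seminorms. q \<le> r})"
      by (intro bexI[of _ r]) auto
  qed (auto simp: eventually_principal)
  have "D \<noteq> bot"
  proof
    assume "D = bot"
    then have "eventually (\<lambda>_. False) D" by simp
    then show False unfolding ev by blast
  qed
  moreover have "\<exists>R. eventually R D \<and> (\<forall>i j. R i \<longrightarrow> R j \<longrightarrow> p (l i - l j) < \<epsilon>)"
    if p: "p \<in> cstar_seminorms" and "\<epsilon> > 0" for p \<epsilon>
  proof (intro exI[of _ "\<lambda>i. i \<in> cstar_seminorms \<and> p \<le> i"] conjI allI impI)
    show "\<forall>\<^sub>F i in D. i \<in> cstar_seminorms \<and> p \<le> i" unfolding ev using p by blast
    fix i j assume "i \<in> cstar_seminorms \<and> p \<le> i" "j \<in> cstar_seminorms \<and> p \<le> j"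
    then show "p (l i - l j) < \<epsilon>"
      using cseminorm_diff[OF cseminorm_cstar[OF p], of "l i - l p" "l j - l p"]
        coh[of i p] coh[of j p] p \<open>\<epsilon> > 0\<close> by simp
  qed
  ultimately obtain b where b: "(l \<longlongrightarrow> b) D"
    using complete_pro_cstar[of D l] by blast
  have "p (b - l p) = 0" if p: "p \<in> cstar_seminorms" for p
  proof -
    have "((\<lambda>q. p (l q - l p - (b - l p))) \<longlongrightarrow> 0) D"
      using tendsto_cstar_seminorm[OF p b] by simp
    then have "((\<lambda>q. p (l q - l p)) \<longlongrightarrow> p (b - l p)) D"
      by (rule tendsto_cseminorm[OF cseminorm_cstar[OF p]])
    moreover have "\<forall>\<^sub>F q in D. p (l q - l p) = 0"
      unfolding ev using p coh by blast
    ultimately show ?thesis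
      by (intro tendsto_unique[OF \<open>D \<noteq> bot\<close> _ tendsto_eventually])
  qed
  then show ?thesis using that by blast
qed

lemma component_embed:
  assumes "p \<in> cstar_seminorms"
  shows "component (embed a) p = dc_embed p a"
  using assms by (transfer; simp)

lemma component_embed_coset:
  assumes "p \<in> cstar_seminorms"
  shows "fst (component (embed a) p) (coset p c) = coset p (a * c)"
    "snd (component (embed a) p) (coset p c) = coset p (c * a)"
  by (simp_all add: component_embed[OF assms] dc_defs qsimps[OF cstar_seminormsD[OF assms]])

lemma component_mult_coset:
  assumes "p \<in> cstar_seminorms"
  shows "fst (component (x * y) p) (coset p c) = fst (component x p) (fst (component y p) (coset p c))"
    "snd (component (x * y) p) (coset p c) = snd (component y p) (snd (component x p) (coset p c))"
  by (simp_all add: component_ops[OF assms] dc_defs)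

lemma embed_add: "embed (a + b) = embed a + embed b"
  and embed_mult: "embed (a * b) = embed a * embed b"
  and embed_scaleC: "embed (c *\<^sub>C a) = c *\<^sub>C embed a"
  and embed_zero [simp]: "embed 0 = 0"
  by (rule multiplier_eqI;
      simp add: component_embed component_ops dc_defs qsimps[OF cstar_seminormsD] distrib_left distrib_right
        mult.assoc mult_scaleC_left mult_scaleC_right)+

lemma embed_minus: "embed (- a) = - embed a"
  using embed_scaleC[of "-1" a] by (simp add: scaleC_minus_one)

lemma embed_diff: "embed (a - b) = embed a - embed b"
  using embed_add[of a "- b"] by (simp add: embed_minus)

lemma embed_sum: "embed (sum f I) = (\<Sum>i\<in>I. embed (f i))"
  by (induction I rule: infinite_finite_induct) (simp_all add: embed_add)

text \<open>Centralizers are only assumed linear and bounded. Module compatibility follows from the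
  exchange law because A_p has no annihilators: if \<open>c * (u - v)\<close> vanishes for all
  \<open>c\<close>, choose \<open>c = star (u - v)\<close> and apply the C*-identity.\<close>

lemma double_centralizer_module:
  assumes p: "p \<in> cstar_seminorms"
    and l: "\<And>a. fst (component x p) (coset p a) = coset p (l a)"
    and r: "\<And>a. snd (component x p) (coset p a) = coset p (r a)"
  shows "coset p (a * l b) = coset p (r a * b)"
    "coset p (l (a * b)) = coset p (l a * b)" "coset p (r (a * b)) = coset p (a * r b)"
proof -
  note ps = cstar_seminormsD[OF p]
  note ceq = coset_eq[OF ps]
  have dc: "coset p (a * l b) = coset p (r a * b)" for a b
    using double_centralizersD(3)[OF component_dc[OF p], of "coset p a" "coset p b" x]
    by (simp add: l r qsimps[OF ps])
  show "coset p (a * l b) = coset p (r a * b)" by (rule dc)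
  have cancel_left: "coset p u = coset p v" if "\<And>c. coset p (c * u) = coset p (c * v)" for u v
  proof -
    have "p (star (u - v) * (u - v)) = 0"
      using that[of "star (u - v)"] by (simp add: ceq right_diff_distrib)
    then show ?thesis by (simp add: ceq cstar_seminorm_square[OF p])
  qed
  have cancel_right: "coset p u = coset p v" if "\<And>c. coset p (u * c) = coset p (v * c)" for u v
  proof -
    have "p ((u - v) * star (u - v)) = 0"
      using that[of "star (u - v)"] by (simp add: ceq left_diff_distrib)
    then have "p (star (u - v)) = 0"
      using cstar_seminorm_square[OF p, of "star (u - v)"] by (simp add: star_star)
    then show ?thesis by (simp add: ceq sn_star[OF p])
  qed
  have mult_cong: "coset p (u * c) = coset p (v * c)" "coset p (c * u) = coset p (c * v)"
    if "coset p u = coset p v" for u v c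
    using that coset_cong(3)[OF ps] by metis+
  show "coset p (l (a * b)) = coset p (l a * b)"
  proof (rule cancel_left)
    fix c
    show "coset p (c * l (a * b)) = coset p (c * (l a * b))"
      using dc[of c "a * b"] mult_cong(1)[OF dc[of c a], of b] by (simp add: mult.assoc)
  qed
  show "coset p (r (a * b)) = coset p (a * r b)"
  proof (rule cancel_right)
    fix c
    show "coset p (r (a * b) * c) = coset p (a * r b * c)"
      using dc[of "a * b" c] mult_cong(2)[OF dc[of b c], of a] by (simp add: mult.assoc)
  qed
qed

text \<open>At each level the multiplier sends \<open>coset p a\<close> to the class of some
  \<open>l p a\<close>. Compatibility of the components makes this family coherent, so one element
  of A represents it; the module laws then identify both components of the product.\<close>

lemma multiplier_embed_ideal:
  fixes x :: "'a::pro_cstar_algebra multiplier"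
  shows "\<exists>b. x * embed a = embed b" "\<exists>b. embed a * x = embed b"
proof -
  obtain l r where
    l: "\<And>p a. p \<in> cstar_seminorms \<Longrightarrow> fst (component x p) (coset p a) = coset p (l p a)" and
    r: "\<And>p a. p \<in> cstar_seminorms \<Longrightarrow> snd (component x p) (coset p a) = coset p (r p a)"
    using component_cosetE[of x] by metis
  have mod: "coset p (a * l p b) = coset p (r p a * b)"
    "coset p (l p (a * b)) = coset p (l p a * b)" "coset p (r p (a * b)) = coset p (a * r p b)"
    if "p \<in> cstar_seminorms" for p a b
    using double_centralizer_module[OF that l[OF that] r[OF that]] by auto
  have coh: "coset q (l p a) = coset q (l q a) \<and> coset q (r p a) = coset q (r q a)"
    if p: "p \<in> cstar_seminorms" and q: "q \<in> cstar_seminorms" and le: "q \<le> p" for p q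
  proof -
    have "dc_compatible p q (component x p) (component x q)"
      using component[of x] p q le by blast
    from this[unfolded dc_compatible_def, rule_format, OF coset_quot, of a]
    show ?thesis
      by (simp add: l[OF p] l[OF q] r[OF p] r[OF q]
          quot_map_coset[OF cstar_seminormsD[OF p] cstar_seminormsD[OF q] le])
  qed
  note ceq = coset_eq[OF cstar_seminormsD]
  obtain b where b: "\<And>p. p \<in> cstar_seminorms \<Longrightarrow> p (b - l p a) = 0"
    using inverse_limit_pro_cstar[of "\<lambda>p. l p a"] coh by (metis ceq)
  have "x * embed a = embed b"
  proof (rule multiplier_eqI)
    fix p :: "'a \<Rightarrow> real" and c assume p: "p \<in> cstar_seminorms"
    have cb: "coset p (l p a) = coset p b"
      using b[OF p] ceq[OF p] by metis
    show "fst (component (x * embed a) p) (coset p c) = fst (component (embed b) p) (coset p c)"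
      using coset_cong(3)[OF cstar_seminormsD[OF p] cb refl, of c]
      by (simp add: component_mult_coset[OF p] component_embed_coset[OF p] l[OF p] mod(2)[OF p])
    show "snd (component (x * embed a) p) (coset p c) = snd (component (embed b) p) (coset p c)"
      using coset_cong(3)[OF cstar_seminormsD[OF p] refl cb, of c]
      by (simp add: component_mult_coset[OF p] component_embed_coset[OF p] r[OF p] flip: mod(1)[OF p])
  qed
  then show "\<exists>b. x * embed a = embed b" by blast
  obtain b where b: "\<And>p. p \<in> cstar_seminorms \<Longrightarrow> p (b - r p a) = 0"
    using inverse_limit_pro_cstar[of "\<lambda>p. r p a"] coh by (metis ceq)
  have "embed a * x = embed b"
  proof (rule multiplier_eqI)
    fix p :: "'a \<Rightarrow> real" and c assume p: "p \<in> cstar_seminorms"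
    have cb: "coset p (r p a) = coset p b"
      using b[OF p] ceq[OF p] by metis
    show "fst (component (embed a * x) p) (coset p c) = fst (component (embed b) p) (coset p c)"
      using coset_cong(3)[OF cstar_seminormsD[OF p] cb refl, of c]
      by (simp add: component_mult_coset[OF p] component_embed_coset[OF p] l[OF p] mod(1)[OF p])
    show "snd (component (embed a * x) p) (coset p c) = snd (component (embed b) p) (coset p c)"
      using coset_cong(3)[OF cstar_seminormsD[OF p] refl cb, of c]
      by (simp add: component_mult_coset[OF p] component_embed_coset[OF p] r[OF p] mod(3)[OF p])
  qed
  then show "\<exists>b. embed a * x = embed b" by blast
qed

lemma embed_inject:
  fixes a b :: "'a::pro_cstar_algebra"
  shows "embed a = embed b \<longleftrightarrow> a = b"
proof
  assume eq: "embed a = embed b"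
  have "p (a - b) = 0" if p: "p \<in> cstar_seminorms" for p :: "'a \<Rightarrow> real"
  proof -
    have "coset p (a * star (a - b)) = coset p (b * star (a - b))"
      using component_embed_coset(1)[OF p] eq by metis
    then have "p (star (star (a - b)) * star (a - b)) = 0"
      by (simp add: coset_eq[OF cstar_seminormsD[OF p]] star_star left_diff_distrib)
    then show ?thesis by (simp add: cstar_seminorm_square[OF p] sn_star[OF p])
  qed
  then show "a = b" using pro_cstar_eq_zeroI[of "a - b"] by simp
qed simp

definition lact :: "'a::pro_cstar_algebra multiplier \<Rightarrow> 'a \<Rightarrow> 'a" where
  "lact x a = (SOME b. x * embed a = embed b)"

definition ract :: "'a::pro_cstar_algebra \<Rightarrow> 'a multiplier \<Rightarrow> 'a" where
  "ract a x = (SOME b. embed a * x = embed b)"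

lemma embed_lact: "embed (lact x a) = x * embed a"
  unfolding lact_def using someI_ex[OF multiplier_embed_ideal(1)] by metis

lemma embed_ract: "embed (ract a x) = embed a * x"
  unfolding ract_def using someI_ex[OF multiplier_embed_ideal(2)] by metis

lemma lact_eqI: "embed b = x * embed a \<Longrightarrow> lact x a = b"
  by (metis embed_lact embed_inject)

text \<open>Connects the centralizer with the action on A: both classes agree after right
  multiplication by anything, in particular by the adjoint of their difference.\<close>

lemma component_lact:
  assumes p: "p \<in> cstar_seminorms"
  shows "fst (component x p) (coset p a) = coset p (lact x a)"
proof -
  obtain l r where l: "\<And>a. fst (component x p) (coset p a) = coset p (l a)"
    and r: "\<And>a. snd (component x p) (coset p a) = coset p (r a)"
    using component_cosetE[of x] p by metis
  have "coset p (l a * c) = coset p (lact x a * c)" for c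
    using component_embed_coset(1)[OF p, of "lact x a" c]
    by (simp add: embed_lact component_mult_coset[OF p] component_embed_coset[OF p] l
        double_centralizer_module(2)[OF p l r])
  from this[of "star (l a - lact x a)"]
  have "p (star (star (l a - lact x a)) * star (l a - lact x a)) = 0"
    by (simp add: coset_eq[OF cstar_seminormsD[OF p]] star_star left_diff_distrib)
  then have "p (l a - lact x a) = 0" by (simp add: cstar_seminorm_square[OF p] sn_star[OF p])
  then show ?thesis by (simp add: l coset_eq[OF cstar_seminormsD[OF p]])
qed

lemma lact_algebra:
  "lact (x + y) a = lact x a + lact y a" "lact x (a + b) = lact x a + lact x b"
  "lact (c *\<^sub>C x) a = c *\<^sub>C lact x a" "lact x (c *\<^sub>C a) = c *\<^sub>C lact x a"
  "lact (x * y) a = lact x (lact y a)" "lact 1 a = a" "lact (embed b) a = b * a"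
  by (rule lact_eqI; simp add: embed_add embed_scaleC embed_mult embed_lact distrib_left distrib_right
      mult.assoc mult_scaleC_left mult_scaleC_right)+

section \<open>The seminorms of \<open>M(A)\<close>\<close>

context
  fixes p :: "'a::pro_cstar_algebra \<Rightarrow> real"
  assumes p: "p \<in> cstar_seminorms"
begin

lemma mult_seminorm_eq: "mult_seminorm p x = (SUP a\<in>{a. p a \<le> 1}. p (lact x a))"
proof -
  have ball: "{X \<in> quot p. qnorm p X \<le> 1} = coset p ` {a. p a \<le> 1}"
    by (auto simp: quot_def qsimps[OF cstar_seminormsD[OF p]])
  have "(\<lambda>X. qnorm p (fst (component x p) X)) ` {X \<in> quot p. qnorm p X \<le> 1}
      = (\<lambda>a. p (lact x a)) ` {a. p a \<le> 1}"
    by (simp add: ball image_image component_lact[OF p] qsimps[OF cstar_seminormsD[OF p]])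
  then show ?thesis by (simp add: mult_seminorm_def dc_norm_def)
qed

lemma lact_bounded: "\<exists>K\<ge>0. \<forall>a. p (lact x a) \<le> K * p a"
proof -
  note ps = cstar_seminormsD[OF p]
  obtain l K where l: "\<And>a. fst (component x p) (coset p a) = coset p (l a)"
    "\<And>a. p (l a) \<le> K * p a" "0 \<le> K"
    using bounded_operators_cosetE[OF ps double_centralizersD(1)[OF component_dc[OF p]], of x] by metis
  have "p (lact x a) = p (l a)" for a
    using l(1)[of a] component_lact[OF p, of x a] qnorm_coset[OF ps] by metis
  then show ?thesis using l by auto
qed

lemma mult_seminorm_nonneg: "0 \<le> mult_seminorm p x"
  and lact_le: "p (lact x a) \<le> mult_seminorm p x * p a"
proof -
  note c = cseminorm_cstar[OF p]
  obtain K where K: "K \<ge> 0" "\<And>a. p (lact x a) \<le> K * p a" using lact_bounded by blast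
  have "p (lact x a) \<le> K" if "p a \<le> 1" for a
    using K(2)[of a] mult_left_mono[OF that K(1)] by simp
  then have bdd: "bdd_above ((\<lambda>a. p (lact x a)) ` {a. p a \<le> 1})" by (intro bdd_aboveI2) auto
  have le: "p (lact x a) \<le> mult_seminorm p x" if "p a \<le> 1" for a
    unfolding mult_seminorm_eq using that bdd by (intro cSUP_upper) auto
  show "0 \<le> mult_seminorm p x"
    using le[of 0] cseminorm_zero[OF c] cseminorm_nonneg[OF c, of "lact x 0"] by simp
  show "p (lact x a) \<le> mult_seminorm p x * p a"
  proof (cases "p a = 0")
    case True
    then show ?thesis using K(2)[of a] by simp
  next
    case False
    then have pos: "p a > 0" using cseminorm_nonneg[OF c, of a] by simp
    then have "p (lact x ((1 / p a) *\<^sub>C a)) \<le> mult_seminorm p x"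
      by (intro le) (simp add: cseminorm_scale[OF c] norm_divide)
    then show ?thesis using pos
      by (simp add: lact_algebra cseminorm_scale[OF c] norm_divide field_simps)
  qed
qed

lemma mult_seminorm_leI:
  assumes "\<And>a. p (lact x a) \<le> K * p a" "0 \<le> K"
  shows "mult_seminorm p x \<le> K"
  unfolding mult_seminorm_eq
proof (rule cSUP_least)
  show "{a. p a \<le> 1} \<noteq> {}" using cseminorm_zero[OF cseminorm_cstar[OF p]] by (auto intro: exI[of _ 0])
  show "p (lact x a) \<le> K" if "a \<in> {a. p a \<le> 1}" for a
    using assms(1)[of a] mult_left_mono[of "p a" 1 K] assms(2) that by simp
qed

lemma cseminorm_mult_seminorm: "cseminorm (mult_seminorm p)"
proof -
  note c = cseminorm_cstar[OF p]
  have scale: "mult_seminorm p (c *\<^sub>C x) \<le> cmod c * mult_seminorm p x" for c x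
    using mult_left_mono[OF lact_le[of x]]
    by (intro mult_seminorm_leI) (simp_all add: lact_algebra cseminorm_scale[OF c] mult_seminorm_nonneg mult.assoc)
  show ?thesis
    unfolding cseminorm_def
  proof (intro conjI allI antisym scale)
    fix x y
    have "p (lact (x + y) a) \<le> (mult_seminorm p x + mult_seminorm p y) * p a" for a
      using cseminorm_add[OF c, of "lact x a" "lact y a"] lact_le[of x a] lact_le[of y a]
      by (simp add: lact_algebra distrib_right)
    then show "mult_seminorm p (x + y) \<le> mult_seminorm p x + mult_seminorm p y"
      by (rule mult_seminorm_leI) (simp add: mult_seminorm_nonneg)
  next
    fix c and x :: "'a multiplier"
    show "cmod c * mult_seminorm p x \<le> mult_seminorm p (c *\<^sub>C x)"
    proof (cases "c = 0")
      case False
      then show ?thesis using scale[of "1 / c" "c *\<^sub>C x"]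
        by (simp add: scaleC_scaleC scaleC_one norm_divide field_simps)
    qed (simp add: mult_seminorm_nonneg)
  qed
qed

lemma mult_seminorm_mult: "mult_seminorm p (x * y) \<le> mult_seminorm p x * mult_seminorm p y"
proof (rule mult_seminorm_leI)
  show "p (lact (x * y) a) \<le> mult_seminorm p x * mult_seminorm p y * p a" for a
    using order_trans[OF lact_le[of x "lact y a"] mult_left_mono[OF lact_le[of y a] mult_seminorm_nonneg[of x]]]
    by (simp add: lact_algebra mult.assoc)
qed (simp add: mult_seminorm_nonneg)

lemma mult_seminorm_one: "mult_seminorm p 1 \<le> 1"
  by (rule mult_seminorm_leI) (simp_all add: lact_algebra)

text \<open>The lower bound comes from testing on \<open>star a\<close>, where the C*-identity
  yields \<open>(p a)^2\<close>.\<close>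

lemma mult_seminorm_embed: "mult_seminorm p (embed a) = p a"
proof (rule antisym)
  note c = cseminorm_cstar[OF p]
  show "mult_seminorm p (embed a) \<le> p a"
    by (rule mult_seminorm_leI) (simp_all add: lact_algebra sn_mult[OF cstar_seminormsD[OF p]] cseminorm_nonneg[OF c])
  have "(p a)\<^sup>2 \<le> mult_seminorm p (embed a) * p a"
    using lact_le[of "embed a" "star a"] cstar_seminorm_square[OF p, of "star a"]
    by (simp add: lact_algebra star_star sn_star[OF p])
  then show "p a \<le> mult_seminorm p (embed a)"
    using cseminorm_nonneg[OF c, of a] mult_seminorm_nonneg[of "embed a"]
    by (cases "p a = 0") (simp_all add: power2_eq_square)
qed

text \<open>The norm sees first components only; the second ones are then determined by the exchange
  law, since right multiplication by all elements separates classes.\<close>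

lemma mult_seminorm_zero_component:
  assumes "mult_seminorm p (x - y) = 0"
  shows "component x p = component y p"
proof -
  note ps = cstar_seminormsD[OF p] and c = cseminorm_cstar[OF p]
  have "lact (x - y) a = lact x a - lact y a" for a
    by (rule lact_eqI) (simp add: embed_diff embed_lact left_diff_distrib)
  then have fst: "coset p (lact x a) = coset p (lact y a)" for a
    using lact_le[of "x - y" a] assms cseminorm_nonneg[OF c, of "lact x a - lact y a"]
    by (simp add: coset_eq[OF ps])
  obtain rx where rx: "\<And>a. snd (component x p) (coset p a) = coset p (rx a)"
    using component_cosetE[of x] p by metis
  obtain ry where ry: "\<And>a. snd (component y p) (coset p a) = coset p (ry a)"
    using component_cosetE[of y] p by metis
  note lx = component_lact[OF p, of x] and ly = component_lact[OF p, of y]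
  have snd: "coset p (rx a) = coset p (ry a)" for a
  proof -
    have "coset p (rx a * c) = coset p (ry a * c)" for c
      using double_centralizer_module(1)[OF p lx rx, of a c] double_centralizer_module(1)[OF p ly ry, of a c]
        coset_cong(3)[OF ps refl fst, of a c] by metis
    from this[of "star (rx a - ry a)"]
    have "p (star (star (rx a - ry a)) * star (rx a - ry a)) = 0"
      by (simp add: coset_eq[OF ps] star_star left_diff_distrib)
    then show ?thesis by (simp add: coset_eq[OF ps] cstar_seminorm_square[OF p] sn_star[OF p])
  qed
  show ?thesis
    using double_centralizers_extensional[OF component_dc[OF p]] fst snd
    by (intro double_centralizers_ext[where p = p]) (auto simp: lx ly rx ry)
qed

end

section \<open>Exponentials of self-adjoint elements\<close>

lemma multiplier_eqI_seminorm:
  fixes x y :: "'a::pro_cstar_algebra multiplier"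
  assumes "\<And>p. p \<in> cstar_seminorms \<Longrightarrow> mult_seminorm p (x - y) = 0"
  shows "x = y"
proof -
  have "component x \<in> extensional cstar_seminorms" "component y \<in> extensional cstar_seminorms"
    using component[of x] component[of y] by (auto simp: PiE_def)
  then have "component x = component y"
    using assms mult_seminorm_zero_component by (intro extensionalityI) auto
  then show ?thesis by (simp add: component_inject)
qed

lemma mult_seminorm_power:
  fixes x :: "'a::pro_cstar_algebra multiplier"
  assumes p: "p \<in> cstar_seminorms"
  shows "mult_seminorm p (x ^ n) \<le> mult_seminorm p x ^ n"
proof (induction n)
  case (Suc n)
  have "mult_seminorm p (x * x ^ n) \<le> mult_seminorm p x * mult_seminorm p x ^ n"
    using order_trans[OF mult_seminorm_mult[OF p] mult_left_mono[OF Suc mult_seminorm_nonneg[OF p]]] .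
  then show ?case by simp
qed (simp add: mult_seminorm_one[OF p])

lemma scaleC_power: "(c *\<^sub>C x) ^ n = (c ^ n) *\<^sub>C (x ^ n :: 'a::pro_cstar_algebra multiplier)"
  by (induction n) (simp_all add: scaleC_one mult_scaleC_left mult_scaleC_right scaleC_scaleC mult.commute)

lemma tendsto_mult_seminorm:
  fixes x y :: "'a::pro_cstar_algebra multiplier"
  assumes p: "p \<in> cstar_seminorms"
    and f: "((\<lambda>i. mult_seminorm p (f i - x)) \<longlongrightarrow> 0) F"
    and g: "((\<lambda>i. mult_seminorm p (g i - y)) \<longlongrightarrow> 0) F"
  shows "((\<lambda>i. mult_seminorm p (f i * g i - x * y)) \<longlongrightarrow> 0) F"
proof -
  note c = cseminorm_mult_seminorm[OF p]
  have "((\<lambda>i. mult_seminorm p (f i - x) * mult_seminorm p (g i) + mult_seminorm p x * mult_seminorm p (g i - y)) \<longlongrightarrow>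
      0 * mult_seminorm p y + mult_seminorm p x * 0) F"
    by (intro tendsto_intros f g tendsto_cseminorm[OF c])
  then have lim: "((\<lambda>i. mult_seminorm p (f i - x) * mult_seminorm p (g i) + mult_seminorm p x * mult_seminorm p (g i - y)) \<longlongrightarrow> 0) F"
    by simp
  have bound: "norm (mult_seminorm p (f i * g i - x * y)) \<le>
      mult_seminorm p (f i - x) * mult_seminorm p (g i) + mult_seminorm p x * mult_seminorm p (g i - y)" for i
  proof -
    have "f i * g i - x * y = (f i - x) * g i + x * (g i - y)" by (simp add: algebra_simps)
    then show ?thesis
      using cseminorm_add[OF c, of "(f i - x) * g i" "x * (g i - y)"]
        mult_seminorm_mult[OF p, of "f i - x" "g i"] mult_seminorm_mult[OF p, of x "g i - y"]
        mult_seminorm_nonneg[OF p, of "f i * g i - x * y"] by simp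
  qed
  show ?thesis by (rule Lim_null_comparison[OF always_eventually[OF allI[OF bound]] lim])
qed

lemma tendsto_mult_seminorm_unique:
  fixes x y :: "'a::pro_cstar_algebra multiplier"
  assumes p: "p \<in> cstar_seminorms" and "F \<noteq> bot"
    and f: "((\<lambda>i. mult_seminorm p (f i - x)) \<longlongrightarrow> 0) F"
    and g: "((\<lambda>i. mult_seminorm p (f i - y)) \<longlongrightarrow> 0) F"
  shows "mult_seminorm p (x - y) = 0"
proof -
  note c = cseminorm_mult_seminorm[OF p]
  have "((\<lambda>i. mult_seminorm p (f i - y - (x - y))) \<longlongrightarrow> 0) F" using f by simp
  then have "((\<lambda>i. mult_seminorm p (f i - y)) \<longlongrightarrow> mult_seminorm p (x - y)) F"
    by (rule tendsto_cseminorm[OF c])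
  then show ?thesis using g \<open>F \<noteq> bot\<close> tendsto_unique by metis
qed

text \<open>Only partial sums are formed in M(A); the limit is built inside A, where completeness is
  available, and the unit is added afterwards.\<close>

definition exp_partial :: "complex \<Rightarrow> 'a::pro_cstar_algebra multiplier \<Rightarrow> nat \<Rightarrow> 'a multiplier" where
  "exp_partial c x N = (\<Sum>n<N. (c ^ n /\<^sub>R fact n) *\<^sub>C x ^ n)"

text \<open>Split the product over the square of indices into the triangle \<open>T N\<close> and
  the rest. The triangle collapses to 1 because its antidiagonals are the coefficients of exp 0. The
  rest is majorized by the same expression for the scalar exponential at \<open>r\<close>, which
  tends to \<open>exp r * exp r - exp (r + r) = 0\<close>.\<close>

lemma exp_partial_mult:
  assumes p: "p \<in> cstar_seminorms" and c: "cmod c = 1"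
  shows "(\<lambda>N. mult_seminorm p (exp_partial (- c) x N * exp_partial c x N - 1)) \<longlonglongrightarrow> 0"
proof -
  note sn = cseminorm_mult_seminorm[OF p]
  define r where "r = mult_seminorm p x"
  have r: "0 \<le> r" unfolding r_def by (rule mult_seminorm_nonneg[OF p])
  define S where "S = (\<lambda>(z::complex) n. z ^ n /\<^sub>R fact n)"
  define R where "R = (\<lambda>(z::real) n. z ^ n /\<^sub>R fact n)"
  define f where "f = (\<lambda>i j. (S (- c) i * S c j) *\<^sub>C x ^ (i + j))"
  define g where "g = (\<lambda>i j. R r i * R r j)"
  define T where "T = (\<lambda>N::nat. {(i, j). i + j < N})"
  have fg: "mult_seminorm p (f i j) \<le> g i j" for i j
  proof -
    have "mult_seminorm p (f i j) = cmod (S (- c) i) * cmod (S c j) * mult_seminorm p (x ^ (i + j))"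
      by (simp add: f_def cseminorm_scale[OF sn] norm_mult)
    also have "\<dots> = inverse (fact i) * inverse (fact j) * mult_seminorm p (x ^ (i + j))"
      by (simp add: S_def norm_mult norm_power c norm_inverse)
    also have "\<dots> \<le> inverse (fact i) * inverse (fact j) * r ^ (i + j)"
      using mult_seminorm_power[OF p, of x "i + j"] by (intro mult_left_mono) (auto simp: r_def)
    finally show ?thesis by (simp add: g_def R_def power_add mult_ac)
  qed
  have TN: "T N \<subseteq> {..<N} \<times> {..<N}" for N by (auto simp: T_def)
  have prod: "exp_partial (- c) x N * exp_partial c x N = (\<Sum>(i, j)\<in>{..<N} \<times> {..<N}. f i j)" for N
    unfolding exp_partial_def sum_product sum.cartesian_product
    by (intro sum.cong)
      (auto simp: f_def S_def mult_scaleC_left mult_scaleC_right scaleC_scaleC power_add mult.commute)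
  have triangle: "(\<Sum>(i, j)\<in>T N. f i j) = 1" if "N > 0" for N
  proof -
    have "(\<Sum>(i, j)\<in>T N. f i j) = (\<Sum>k<N. \<Sum>i\<le>k. f i (k - i))"
      unfolding T_def by (rule sum.triangle_reindex)
    also have "\<dots> = (\<Sum>k<N. S (- c + c) k *\<^sub>C x ^ k)"
    proof (rule sum.cong[OF refl])
      fix k
      have "(\<Sum>i\<le>k. f i (k - i)) = (\<Sum>i\<le>k. S (- c) i * S c (k - i)) *\<^sub>C x ^ k"
        by (simp add: f_def scaleC_sum_left)
      also have "(\<Sum>i\<le>k. S (- c) i * S c (k - i)) = S (- c + c) k"
        unfolding S_def by (rule exp_series_add_commuting[symmetric]) simp
      finally show "(\<Sum>i\<le>k. f i (k - i)) = S (- c + c) k *\<^sub>C x ^ k" .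
    qed
    also have "\<dots> = (\<Sum>k\<in>{0}. S (- c + c) k *\<^sub>C x ^ k)"
      using that by (intro sum.mono_neutral_right) (auto simp: S_def power_0_left)
    finally show ?thesis by (simp add: S_def scaleC_one)
  qed
  have triangle_r: "(\<Sum>(i, j)\<in>T N. g i j) = (\<Sum>k<N. R (r + r) k)" for N
  proof -
    have "(\<Sum>(i, j)\<in>T N. g i j) = (\<Sum>k<N. \<Sum>i\<le>k. g i (k - i))"
      unfolding T_def by (rule sum.triangle_reindex)
    also have "\<dots> = (\<Sum>k<N. R (r + r) k)"
      unfolding g_def R_def by (intro sum.cong refl exp_series_add_commuting[symmetric])
    finally show ?thesis .
  qed
  have bound: "norm (mult_seminorm p (exp_partial (- c) x N * exp_partial c x N - 1))
      \<le> (\<Sum>n<N. R r n) * (\<Sum>n<N. R r n) - (\<Sum>n<N. R (r + r) n)" if "N > 0" for N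
  proof -
    let ?D = "{..<N} \<times> {..<N} - T N"
    have fin: "finite ({..<N} \<times> {..<N})" by simp
    have "exp_partial (- c) x N * exp_partial c x N - 1 = (\<Sum>(i, j)\<in>?D. f i j)"
      unfolding prod triangle[OF that, symmetric] by (simp add: sum_diff[OF fin TN])
    then have "mult_seminorm p (exp_partial (- c) x N * exp_partial c x N - 1)
        \<le> (\<Sum>z\<in>?D. mult_seminorm p (case z of (i, j) \<Rightarrow> f i j))"
      using cseminorm_sum[OF sn] by metis
    also have "\<dots> \<le> (\<Sum>(i, j)\<in>?D. g i j)"
      using fg by (intro sum_mono) auto
    also have "\<dots> = (\<Sum>(i, j)\<in>{..<N} \<times> {..<N}. g i j) - (\<Sum>(i, j)\<in>T N. g i j)"
      by (simp add: sum_diff[OF fin TN])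
    also have "\<dots> = (\<Sum>n<N. R r n) * (\<Sum>n<N. R r n) - (\<Sum>n<N. R (r + r) n)"
      unfolding triangle_r unfolding g_def sum_product sum.cartesian_product ..
    finally show ?thesis using mult_seminorm_nonneg[OF p] by simp
  qed
  have "(\<lambda>N. \<Sum>n<N. R z n) \<longlonglongrightarrow> exp z" for z
    unfolding R_def using exp_converges[of z] by (simp add: sums_def)
  then have "(\<lambda>N. (\<Sum>n<N. R r n) * (\<Sum>n<N. R r n) - (\<Sum>n<N. R (r + r) n)) \<longlonglongrightarrow> exp r * exp r - exp (r + r)"
    by (intro tendsto_intros)
  then have lim: "(\<lambda>N. (\<Sum>n<N. R r n) * (\<Sum>n<N. R r n) - (\<Sum>n<N. R (r + r) n)) \<longlonglongrightarrow> 0"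
    by (simp only: exp_add diff_self)
  show ?thesis
    by (rule Lim_null_comparison[OF _ lim]) (use bound in \<open>auto simp: eventually_sequentially intro!: exI[of _ 1]\<close>)
qed

text \<open>The hypothesis makes \<open>b = a + u * a\<close> satisfy
  \<open>star b * b = star a * a\<close>, and the C*-identity reads off
  \<open>p b = p a\<close>.\<close>

lemma mult_seminorm_isometry:
  fixes u :: "'a::pro_cstar_algebra"
  assumes p: "p \<in> cstar_seminorms" and u: "(1 + embed (star u)) * (1 + embed u) = 1"
  shows "mult_seminorm p (1 + embed u) \<le> 1"
proof (rule mult_seminorm_leI[OF p])
  fix a
  let ?b = "a + u * a"
  have "embed (star ?b * ?b) = embed (star a) * ((1 + embed (star u)) * (1 + embed u)) * embed a"
    by (simp add: star_add star_mult embed_add embed_mult distrib_left distrib_right mult.assoc add_ac)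
  then have "star ?b * ?b = star a * a"
    by (simp add: u flip: embed_mult embed_inject)
  then have "(p ?b)\<^sup>2 = (p a)\<^sup>2"
    by (metis cstar_seminorm_square[OF p])
  then have "p ?b = p a"
    using cseminorm_nonneg[OF cseminorm_cstar[OF p]] by (simp add: power2_eq_iff_nonneg)
  then show "p (lact (1 + embed u) a) \<le> 1 * p a" by (simp add: lact_algebra)
qed simp

text \<open>Here \<open>u = exp (i h) - 1\<close>, which makes sense although \<open>A\<close> need not be unital.\<close>

lemma exp_selfadjoint:
  fixes h :: "'a::pro_cstar_algebra"
  assumes h: "star h = h"
  obtains u where
    "\<And>p. p \<in> cstar_seminorms \<Longrightarrow> (\<lambda>N. mult_seminorm p (exp_partial \<i> (embed h) N - (1 + embed u))) \<longlonglongrightarrow> 0"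
    "\<And>p. p \<in> cstar_seminorms \<Longrightarrow> mult_seminorm p (1 + embed u) \<le> 1"
    "\<And>p. p \<in> cstar_seminorms \<Longrightarrow> mult_seminorm p (1 + embed (star u)) \<le> 1"
    "\<And>p. p \<in> cstar_seminorms \<Longrightarrow> p h \<le> 1 / 4 \<Longrightarrow> p (u - \<i> *\<^sub>C h) \<le> (p h)\<^sup>2"
proof -
  \<comment> \<open>\<open>pw n\<close> is the power \<open>h ^ (n + 1)\<close>, formed in A, which
    need not have a unit.\<close>
  define pw where "pw n = lact (embed h ^ n) h" for n
  have pw: "embed (pw n) = embed h ^ Suc n" for n
    unfolding pw_def embed_lact by (simp only: power_Suc2)
  have pw_Suc: "pw (Suc n) = h * pw n" "pw (Suc n) = pw n * h" for n
    by (simp only: embed_inject[symmetric] pw embed_mult power_Suc[of _ "Suc n"])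
      (simp only: embed_inject[symmetric] pw embed_mult power_Suc2[of _ "Suc n"])
  have pw_star: "star (pw n) = pw n" for n
  proof (induction n)
    case 0
    then show ?case by (simp add: pw_def lact_algebra h)
  next
    case (Suc n)
    then show ?case by (metis h pw_Suc star_mult)
  qed
  have p_pw: "p (pw n) \<le> p h ^ Suc n" if "p \<in> cstar_seminorms" for p n
    using mult_seminorm_power[OF that, of "embed h" "Suc n"]
    unfolding pw[symmetric] mult_seminorm_embed[OF that] .
  define a where "a n = (\<i> ^ Suc n /\<^sub>R fact (Suc n)) *\<^sub>C pw n" for n
  have p_a: "p (a n) \<le> p h ^ Suc n /\<^sub>R fact (Suc n)" if p: "p \<in> cstar_seminorms" for p n
    using mult_left_mono[OF p_pw[OF p, of n], of "inverse (fact (Suc n))"]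
    by (simp add: a_def cseminorm_scale[OF cseminorm_cstar[OF p]] norm_mult norm_power norm_inverse
        del: fact_Suc power_Suc)
  have summ: "summable (\<lambda>n. p (a n))" if p: "p \<in> cstar_seminorms" for p
  proof (rule summable_comparison_test')
    show "summable (\<lambda>n. p h ^ Suc n /\<^sub>R fact (Suc n))"
      using summable_exp_generic[of "p h"] by (subst summable_Suc_iff)
    show "norm (p (a n)) \<le> p h ^ Suc n /\<^sub>R fact (Suc n)" if "0 \<le> n" for n
      using p_a[OF p] cseminorm_nonneg[OF cseminorm_cstar[OF p], of "a n"] by simp
  qed
  obtain u where u: "\<And>p. p \<in> cstar_seminorms \<Longrightarrow> (\<lambda>N. p ((\<Sum>n<N. a n) - u)) \<longlonglongrightarrow> 0"
    and u_tail: "\<And>p N. p \<in> cstar_seminorms \<Longrightarrow> p (u - (\<Sum>n<N. a n)) \<le> (\<Sum>n. p (a (n + N)))"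
    using summable_pro_cstar[of a] summ by metis
  have star_sum: "star (sum f I) = (\<Sum>i\<in>I. star (f i))" for f :: "nat \<Rightarrow> 'a" and I
  proof (induction I rule: infinite_finite_induct)
    case (infinite A)
    have "star (0 *\<^sub>C (0::'a)) = 0" unfolding star_scaleC by simp
    then show ?case using infinite by simp
  next
    case empty
    have "star (0 *\<^sub>C (0::'a)) = 0" unfolding star_scaleC by simp
    then show ?case by simp
  qed (simp add: star_add)
  \<comment> \<open>Cutting at \<open>Suc N\<close> splits off the term of index 0 as the unit; the
    remaining \<open>N\<close> terms lie in A.\<close>
  have E: "exp_partial \<i> (embed h) (Suc N) = 1 + embed (\<Sum>n<N. a n)"
    "exp_partial (- \<i>) (embed h) (Suc N) = 1 + embed (star (\<Sum>n<N. a n))" for N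
    unfolding exp_partial_def sum.lessThan_Suc_shift star_sum embed_sum a_def embed_scaleC star_scaleC pw_star
    by (simp_all add: scaleC_one pw del: power_Suc fact_Suc)
  have star_diff: "star (x - y) = star x - star y" for x y :: 'a
    using star_add[of "x - y" y] by (simp add: eq_diff_eq)
  have lim1: "(\<lambda>N. mult_seminorm p (exp_partial \<i> (embed h) N - (1 + embed u))) \<longlonglongrightarrow> 0"
    and lim2: "(\<lambda>N. mult_seminorm p (exp_partial (- \<i>) (embed h) N - (1 + embed (star u)))) \<longlonglongrightarrow> 0"
    if p: "p \<in> cstar_seminorms" for p
    by (rule LIMSEQ_imp_Suc; use u[OF p] in \<open>simp add: E mult_seminorm_embed[OF p] sn_star[OF p]
      flip: embed_diff star_diff\<close>)+
  \<comment> \<open>Products of partial sums tend both to the product of the limits and to 1. Both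
    orders are needed: one bounds \<open>1 + embed u\<close>, the other its adjoint.\<close>
  have unit1: "(1 + embed (star u)) * (1 + embed u) = 1"
    using tendsto_mult_seminorm_unique[OF _ sequentially_bot tendsto_mult_seminorm[OF _ lim2 lim1] exp_partial_mult]
    by (intro multiplier_eqI_seminorm) auto
  have unit2: "(1 + embed u) * (1 + embed (star u)) = 1"
    using tendsto_mult_seminorm_unique[OF _ sequentially_bot tendsto_mult_seminorm[OF _ lim1 lim2]
        exp_partial_mult[where c = "- \<i>", simplified]]
    by (intro multiplier_eqI_seminorm) auto
  have near: "p (u - \<i> *\<^sub>C h) \<le> (p h)\<^sup>2" if p: "p \<in> cstar_seminorms" and small: "p h \<le> 1 / 4" for p
  proof -
    have nn: "0 \<le> p h" by (rule cseminorm_nonneg[OF cseminorm_cstar[OF p]])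
    have "a 0 = \<i> *\<^sub>C h" by (simp add: a_def pw_def lact_algebra)
    then have "p (u - \<i> *\<^sub>C h) \<le> (\<Sum>n. p (a (n + 1)))"
      using u_tail[OF p, of 1] by simp
    \<comment> \<open>Beyond the linear term, \<open>fact (n + 2)\<close> is at least 2 and
      \<open>p h\<close> at most 1/4; the geometric series leaves the factor 2/3.\<close>
    also have "\<dots> \<le> (\<Sum>n. (p h)\<^sup>2 * (1 / 2) * (1 / 4) ^ n)"
    proof (rule suminf_le)
      fix n
      have "p (a (n + 1)) \<le> p h ^ (n + 2) / fact (n + 2)"
        using p_a[OF p, of "n + 1"] by (simp add: divide_inverse mult.commute)
      also have "\<dots> \<le> p h ^ (n + 2) / 2"
        using nn fact_mono[of 2 "n + 2", where 'a = real] by (intro divide_left_mono) auto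
      also have "\<dots> \<le> (p h)\<^sup>2 * (1 / 2) * (1 / 4) ^ n"
        using mult_left_mono[OF power_mono[OF small nn, of n], of "(p h)\<^sup>2 / 2"]
        by (simp add: power2_eq_square mult_ac)
      finally show "p (a (n + 1)) \<le> (p h)\<^sup>2 * (1 / 2) * (1 / 4) ^ n" .
      show "summable (\<lambda>n. p (a (n + 1)))"
        using summable_ignore_initial_segment[OF summ[OF p]] .
      show "summable (\<lambda>n. (p h)\<^sup>2 * (1 / 2) * (1 / 4) ^ n)"
        by (intro summable_mult summable_geometric) simp
    qed
    also have "\<dots> = (p h)\<^sup>2 * (1 / 2) * (1 / (1 - 1 / 4))"
      by (subst suminf_mult) (simp_all add: suminf_geometric summable_geometric)
    also have "\<dots> \<le> (p h)\<^sup>2" by simp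
    finally show ?thesis .
  qed
  show ?thesis
    using that[OF lim1 mult_seminorm_isometry[OF _ unit1] _ near]
      mult_seminorm_isometry[of _ "star u"] unit2 by (simp add: star_star)
qed


section \<open>Bounded lifts along \<open>A \<rightarrow> A\<^sub>p\<close>\<close>

text \<open>For self-adjoint \<open>h\<close> the element \<open>t sin (h / t)\<close> has all seminorms at most \<open>t\<close>, and is close to
  \<open>h\<close> with respect to \<open>p\<close> if \<open>p h\<close> is small compared to \<open>t\<close>.\<close>

lemma bounded_approximation_selfadjoint:
  fixes h :: "'a::pro_cstar_algebra"
  assumes p: "p \<in> cstar_seminorms" and h: "star h = h"
  obtains s where "\<And>q. q \<in> cstar_seminorms \<Longrightarrow> q s \<le> 8 * p h" "p (h - s) \<le> p h / 8"
proof (cases "p h = 0")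
  case True
  show ?thesis
    by (rule that[of 0]) (simp_all add: True cseminorm_zero[OF cseminorm_cstar])
next
  case False
  \<comment> \<open>With \<open>t = 8 * p h\<close> the rescaled \<open>k\<close> has
    \<open>p k = 1 / 8\<close>, inside the range of the quadratic estimate, and the final error
    \<open>t * (p k)^2\<close> equals \<open>p h / 8\<close>.\<close>
  define t where "t = 8 * p h"
  have t: "t > 0" using False cseminorm_nonneg[OF cseminorm_cstar[OF p], of h] by (simp add: t_def)
  define k where "k = complex_of_real (1 / t) *\<^sub>C h"
  have k: "star k = k" by (simp add: k_def star_scaleC h)
  have pk: "p k = 1 / 8"
    using t False by (simp add: k_def t_def cseminorm_scale[OF cseminorm_cstar[OF p]] norm_divide)
  obtain u where u: "\<And>q. q \<in> cstar_seminorms \<Longrightarrow> mult_seminorm q (1 + embed u) \<le> 1"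
    "\<And>q. q \<in> cstar_seminorms \<Longrightarrow> mult_seminorm q (1 + embed (star u)) \<le> 1"
    and "\<And>q. q \<in> cstar_seminorms \<Longrightarrow> q k \<le> 1 / 4 \<Longrightarrow> q (u - \<i> *\<^sub>C k) \<le> (q k)\<^sup>2"
    using exp_selfadjoint[OF k] by metis
  then have near: "p (u - \<i> *\<^sub>C k) \<le> (p k)\<^sup>2" using p pk by simp
  \<comment> \<open>\<open>u - star u\<close> is exp (i k) - exp (- i k), and the scalar is t / (2
    i).\<close>
  define s where "s = (complex_of_real t * (- \<i> / 2)) *\<^sub>C (u - star u)"
  show ?thesis
  proof (rule that[of s])
    fix q :: "'a \<Rightarrow> real" assume q: "q \<in> cstar_seminorms"
    have "embed (u - star u) = (1 + embed u) - (1 + embed (star u))" by (simp add: embed_diff)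
    then have "q (u - star u) \<le> 2"
      using cseminorm_diff[OF cseminorm_mult_seminorm[OF q], of "1 + embed u" "1 + embed (star u)"]
        u(1)[OF q] u(2)[OF q] mult_seminorm_embed[OF q, of "u - star u"] by simp
    then show "q s \<le> 8 * p h"
      using t by (simp add: s_def cseminorm_scale[OF cseminorm_cstar[OF q]] norm_mult norm_divide
          t_def[symmetric])
  next
    have star_diff: "star (u - \<i> *\<^sub>C k) = star u + \<i> *\<^sub>C k"
      using star_add[of "u - \<i> *\<^sub>C k" "\<i> *\<^sub>C k"]
      by (simp add: star_scaleC k scaleC_minus_left eq_diff_eq)
    have "h = complex_of_real t *\<^sub>C k"
      using t by (simp add: k_def scaleC_scaleC scaleC_one)
    then have "h - s = (complex_of_real t * (\<i> / 2)) *\<^sub>C ((u - \<i> *\<^sub>C k) - star (u - \<i> *\<^sub>C k))"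
      unfolding star_diff s_def
      by (simp add: scaleC_diff_right scaleC_add_right scaleC_scaleC scaleC_minus_left algebra_simps
          flip: scaleC_add_left)
    then have "p (h - s) = t / 2 * p ((u - \<i> *\<^sub>C k) - star (u - \<i> *\<^sub>C k))"
      using t by (simp add: cseminorm_scale[OF cseminorm_cstar[OF p]] norm_mult norm_divide)
    also have "\<dots> \<le> t / 2 * (2 * (p k)\<^sup>2)"
      using cseminorm_diff[OF cseminorm_cstar[OF p], of "u - \<i> *\<^sub>C k" "star (u - \<i> *\<^sub>C k)"]
        near t by (intro mult_left_mono) (simp_all add: sn_star[OF p])
    finally show "p (h - s) \<le> p h / 8" by (simp add: pk t_def power2_eq_square)
  qed
qed

text \<open>Real and imaginary parts are treated separately: the bounds add up to 16, and the errors
  1/8 + 1/8 stay below the factor 1/2 wanted for an iteration.\<close>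

lemma bounded_approximation:
  fixes a :: "'a::pro_cstar_algebra"
  assumes p: "p \<in> cstar_seminorms"
  shows "\<exists>b. (\<forall>q\<in>cstar_seminorms. q b \<le> 16 * p a) \<and> p (a - b) \<le> p a / 2"
proof -
  note c = cseminorm_cstar
  define h where "h = (1 / 2) *\<^sub>C (a + star a)"
  define k where "k = (- \<i> / 2) *\<^sub>C (a + - star a)"
  have star_minus: "star (- x) = - star x" for x :: 'a
    using star_scaleC[of "-1" x] by (simp add: scaleC_minus_one)
  have "star h = h" by (simp add: h_def star_scaleC star_add star_star add.commute)
  moreover have "star k = k"
    using star_scaleC[of "- \<i> / 2" "a + - star a"]
    by (simp only: k_def star_add star_star star_minus) (simp add: scaleC_minus_left scaleC_diff_right)
  moreover have ph: "p h \<le> p a" and pk: "p k \<le> p a"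
    using cseminorm_add[OF c[OF p], of a "star a"] cseminorm_add[OF c[OF p], of a "- star a"]
    by (simp_all add: h_def k_def cseminorm_scale[OF c[OF p]] cseminorm_minus[OF c[OF p]] norm_divide sn_star[OF p])
  ultimately obtain s s' where s: "\<And>q. q \<in> cstar_seminorms \<Longrightarrow> q s \<le> 8 * p h" "p (h - s) \<le> p h / 8"
    and s': "\<And>q. q \<in> cstar_seminorms \<Longrightarrow> q s' \<le> 8 * p k" "p (k - s') \<le> p k / 8"
    using bounded_approximation_selfadjoint[OF p] by metis
  show ?thesis
  proof (intro exI[of _ "s + \<i> *\<^sub>C s'"] conjI ballI)
    fix q :: "'a \<Rightarrow> real" assume q: "q \<in> cstar_seminorms"
    show "q (s + \<i> *\<^sub>C s') \<le> 16 * p a"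
      using cseminorm_add[OF c[OF q], of s "\<i> *\<^sub>C s'"] s(1)[OF q] s'(1)[OF q] ph pk
      by (simp add: cseminorm_scale[OF c[OF q]])
  next
    have "\<i> *\<^sub>C k = (1 / 2) *\<^sub>C (a + - star a)"
      by (simp add: k_def scaleC_scaleC)
    then have "h + \<i> *\<^sub>C k = (1 / 2) *\<^sub>C ((a + star a) + (a + - star a))"
      by (simp only: h_def scaleC_add_right)
    also have "\<dots> = (1 / 2) *\<^sub>C a + (1 / 2) *\<^sub>C a"
      by (simp flip: scaleC_add_right)
    also have "\<dots> = a"
      using scaleC_add_left[of "1 / 2" "1 / 2" a] by (simp add: scaleC_one)
    finally have "a = h + \<i> *\<^sub>C k" by simp
    then have eq: "a - (s + \<i> *\<^sub>C s') = (h - s) + \<i> *\<^sub>C (k - s')"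
      by (simp add: scaleC_diff_right)
    show "p (a - (s + \<i> *\<^sub>C s')) \<le> p a / 2"
      unfolding eq using cseminorm_add[OF c[OF p], of "h - s" "\<i> *\<^sub>C (k - s')"] s(2) s'(2) ph pk
        cseminorm_nonneg[OF c[OF p], of a]
      by (simp add: cseminorm_scale[OF c[OF p]])
  qed
qed

text \<open>Approximate, then approximate the remainder, and so on. The remainders halve in p, so
  the corrections are at most \<open>16 * p a * (1 / 2) ^ n\<close> in every seminorm, and their sum
  converges in A with the bound 32.\<close>

lemma bounded_lift:
  fixes a :: "'a::pro_cstar_algebra"
  assumes p: "p \<in> cstar_seminorms"
  obtains b where "p (a - b) = 0" "\<And>q. q \<in> cstar_seminorms \<Longrightarrow> q b \<le> 32 * p a"
proof -
  note c = cseminorm_cstar[OF p]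
  define F where "F x = (SOME b. (\<forall>q\<in>cstar_seminorms. q b \<le> 16 * p x) \<and> p (x - b) \<le> p x / 2)" for x
  have F: "q \<in> cstar_seminorms \<Longrightarrow> q (F x) \<le> 16 * p x" "p (x - F x) \<le> p x / 2" for q x
    using someI_ex[OF bounded_approximation[OF p, of x]] unfolding F_def by auto
  define r where "r = rec_nat a (\<lambda>_ x. x - F x)"
  have r_Suc: "r (Suc n) = r n - F (r n)" and r0: "r 0 = a" for n by (simp_all add: r_def)
  have pr: "p (r n) \<le> p a * (1 / 2) ^ n" for n
  proof (induction n)
    case (Suc n)
    then show ?case using F(2)[of "r n"] by (simp add: r_Suc)
  qed (simp add: r0)
  have geom: "summable (\<lambda>n. 16 * p a * (1 / 2) ^ n)"
    by (intro summable_mult summable_geometric) simp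
  have qF: "q (F (r n)) \<le> 16 * p a * (1 / 2) ^ n" if "q \<in> cstar_seminorms" for q n
    using F(1)[OF that, of "r n"] pr[of n] by simp
  have summ: "summable (\<lambda>n. q (F (r n)))" if q: "q \<in> cstar_seminorms" for q
    by (rule summable_comparison_test'[OF geom])
      (use qF[OF q] cseminorm_nonneg[OF cseminorm_cstar[OF q]] in simp)
  obtain b where b: "\<And>q. q \<in> cstar_seminorms \<Longrightarrow> (\<lambda>N. q ((\<Sum>n<N. F (r n)) - b)) \<longlonglongrightarrow> 0"
    and tail: "\<And>q N. q \<in> cstar_seminorms \<Longrightarrow> q (b - (\<Sum>n<N. F (r n))) \<le> (\<Sum>n. q (F (r (n + N))))"
    using summable_pro_cstar[of "\<lambda>n. F (r n)"] summ by metis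
  have "q b \<le> 32 * p a" if q: "q \<in> cstar_seminorms" for q
  proof -
    have "q b \<le> (\<Sum>n. q (F (r n)))" using tail[OF q, of 0] by simp
    also have "\<dots> \<le> (\<Sum>n. 16 * p a * (1 / 2) ^ n)"
      by (intro suminf_le qF q summ geom)
    also have "\<dots> = 32 * p a"
      by (subst suminf_mult) (simp_all add: suminf_geometric summable_geometric)
    finally show ?thesis .
  qed
  moreover have "p (a - b) = 0"
  proof -
    have sum_F: "(\<Sum>n<N. F (r n)) = a - r N" for N
      by (induction N) (simp_all add: r0 r_Suc)
    have "(\<lambda>N. p ((\<Sum>n<N. F (r n)) - b) + p a * (1 / 2) ^ N) \<longlonglongrightarrow> 0 + p a * 0"
      by (intro tendsto_intros b[OF p] LIMSEQ_power_zero) simp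
    moreover have "p (a - b) \<le> p ((\<Sum>n<N. F (r n)) - b) + p a * (1 / 2) ^ N" for N
      using cseminorm_add[OF c, of "a - r N - b" "r N"] pr[of N] by (simp add: sum_F)
    ultimately have "p (a - b) \<le> 0"
      by (intro tendsto_lowerbound[where f = "\<lambda>N. p ((\<Sum>n<N. F (r n)) - b) + p a * (1 / 2) ^ N"]) auto
    then show ?thesis using cseminorm_nonneg[OF c, of "a - b"] by simp
  qed
  ultimately show ?thesis using that by blast
qed

section \<open>Approximate units\<close>

lemma eventually_net_filter:
  assumes dir: "\<forall>i j::'l::preorder. \<exists>k. i \<le> k \<and> j \<le> k"
  shows "eventually P (net_filter :: 'l filter) \<longleftrightarrow> (\<exists>i. \<forall>j\<ge>i. P j)"
  unfolding net_filter_def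
proof (subst eventually_INF_base)
  fix i j :: 'l
  obtain k where "i \<le> k" "j \<le> k" using dir by blast
  then show "\<exists>x\<in>UNIV. principal {x..} \<le> inf (principal {i..}) (principal {j..})"
    by (intro bexI[of _ k]) (auto intro: order_trans)
qed (auto simp: eventually_principal)

context
  fixes e :: "'l::preorder \<Rightarrow> 'a::pro_cstar_algebra"
  assumes e: "approximate_unit e"
begin

lemma net_filter_nonbot: "(net_filter :: 'l filter) \<noteq> bot"
proof
  assume "(net_filter :: 'l filter) = bot"
  then have "eventually (\<lambda>_. False) (net_filter :: 'l filter)" by simp
  moreover have "\<forall>i j::'l. \<exists>k. i \<le> k \<and> j \<le> k" using e by (simp add: approximate_unit_def)
  ultimately show False by (auto simp: eventually_net_filter)
qed

lemma approximate_unit_le_one: "p \<in> cstar_seminorms \<Longrightarrow> p (e i) \<le> 1"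
  using e by (simp add: approximate_unit_def)

lemma approximate_unit_selfadjoint: "star (e i) = e i"
proof -
  have "positive (e i)" using e by (simp add: approximate_unit_def)
  then show ?thesis by (auto simp: positive_def star_mult star_star)
qed

lemma approximate_unit_tendsto:
  assumes "p \<in> cstar_seminorms"
  shows "((\<lambda>i. p (e i * a - a)) \<longlongrightarrow> 0) net_filter" "((\<lambda>i. p (a * e i - a)) \<longlongrightarrow> 0) net_filter"
  using e assms by (auto simp: approximate_unit_def intro: tendsto_cstar_seminorm)

text \<open>Testing on the approximate unit suffices because \<open>lact x a\<close> is the limit of
  \<open>lact x (e i) * a\<close>.\<close>

lemma mult_seminorm_le_unit:
  assumes p: "p \<in> cstar_seminorms" and le: "\<And>i. p (lact x (e i)) \<le> K"
  shows "mult_seminorm p x \<le> K"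
proof (rule mult_seminorm_leI[OF p])
  note c = cseminorm_cstar[OF p]
  show "0 \<le> K" using le cseminorm_nonneg[OF c] order_trans by blast
  fix a
  have diff: "lact x u - lact x v = lact x (u - v)" for u v
    using lact_algebra(2)[of x "u - v" v] by simp
  have "((\<lambda>i. mult_seminorm p x * p (e i * a - a)) \<longlongrightarrow> mult_seminorm p x * 0) net_filter"
    by (intro tendsto_intros approximate_unit_tendsto p)
  then have lim: "((\<lambda>i. mult_seminorm p x * p (e i * a - a)) \<longlongrightarrow> 0) net_filter" by simp
  have "((\<lambda>i. p (lact x (e i * a) - lact x a)) \<longlongrightarrow> 0) net_filter"
    by (rule Lim_null_comparison[OF _ lim])
      (simp add: diff lact_le[OF p] cseminorm_nonneg[OF c] always_eventually)
  then have "((\<lambda>i. p (lact x (e i * a))) \<longlongrightarrow> p (lact x a)) net_filter"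
    by (rule tendsto_cseminorm[OF c])
  moreover
  have "p (lact x (e i * a)) \<le> K * p a" for i
  proof -
    have "lact x (e i * a) = lact x (e i) * a"
      by (rule lact_eqI) (simp add: embed_mult embed_lact mult.assoc)
    then have "p (lact x (e i * a)) \<le> p (lact x (e i)) * p a"
      using sn_mult[OF cstar_seminormsD[OF p]] by simp
    also have "\<dots> \<le> K * p a" using le cseminorm_nonneg[OF c] by (intro mult_right_mono)
    finally show ?thesis .
  qed
  then have "\<forall>\<^sub>F i in net_filter. p (lact x (e i * a)) \<le> K * p a" by simp
  ultimately show "p (lact x a) \<le> K * p a"
    by (rule tendsto_upperbound[OF _ _ net_filter_nonbot])
qed

text \<open>The defining suprema do not compare directly, as the unit ball of \<open>q\<close> is
  the larger one; the approximate unit lies in both balls.\<close>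

lemma mult_seminorm_mono:
  fixes p :: "'a \<Rightarrow> real"
  assumes p: "p \<in> cstar_seminorms" and q: "q \<in> cstar_seminorms" and le: "q \<le> p"
  shows "mult_seminorm q x \<le> mult_seminorm p x"
proof (rule mult_seminorm_le_unit[OF q])
  fix i
  have "q (lact x (e i)) \<le> p (lact x (e i))" using le by (simp add: le_fun_def)
  also have "\<dots> \<le> mult_seminorm p x * p (e i)" by (rule lact_le[OF p])
  also have "\<dots> \<le> mult_seminorm p x * 1"
    using approximate_unit_le_one[OF p] mult_seminorm_nonneg[OF p] by (intro mult_left_mono)
  finally show "q (lact x (e i)) \<le> mult_seminorm p x" by simp
qed

end

section \<open>Approximate units whose complements are contractions\<close>

lemma exp_pi_estimate:
  fixes y w :: "'a::pro_cstar_algebra multiplier"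
  assumes p: "p \<in> cstar_seminorms"
    and z: "\<And>n. mult_seminorm p (z n - y) \<le> real n * d"
    and lim: "(\<lambda>N. mult_seminorm p ((\<Sum>n<N. ((\<i> * pi) ^ n /\<^sub>R fact n) *\<^sub>C z n) - w)) \<longlonglongrightarrow> 0"
  shows "mult_seminorm p (w + y) \<le> exp (2 * pi) * d"
proof -
  note c = cseminorm_mult_seminorm[OF p]
  define S where "S n = (\<i> * pi) ^ n /\<^sub>R fact n" for n
  have d: "0 \<le> d" using z[of 1] mult_seminorm_nonneg[OF p, of "z 1 - y"] by simp
  have S_norm: "cmod (S n) = pi ^ n /\<^sub>R fact n" for n
    by (simp add: S_def norm_mult norm_power norm_inverse)
  have "S sums exp (\<i> * pi)" unfolding S_def by (rule exp_converges)
  then have "(\<lambda>N. \<Sum>n<N. S n) \<longlonglongrightarrow> -1"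
    using exp_pi_i' by (simp add: sums_def mult.commute)
  then have S_lim: "(\<lambda>N. cmod ((\<Sum>n<N. S n) + 1)) \<longlonglongrightarrow> cmod (-1 + 1)"
    by (intro tendsto_intros)
  \<comment> \<open>In applications \<open>z n\<close> is e^n y or y e^n. Replacing each
    \<open>z n\<close> by \<open>y\<close> turns the series into exp (i \<pi>) y = - y, which the
    added \<open>y\<close> cancels.\<close>
  have bound: "mult_seminorm p ((\<Sum>n<N. S n *\<^sub>C z n) + y)
      \<le> exp (2 * pi) * d + cmod ((\<Sum>n<N. S n) + 1) * mult_seminorm p y" for N
  proof -
    have "(\<Sum>n<N. S n *\<^sub>C z n) + y = (\<Sum>n<N. S n *\<^sub>C (z n - y)) + ((\<Sum>n<N. S n) + 1) *\<^sub>C y"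
      by (simp add: scaleC_diff_right sum_subtractf scaleC_add_left scaleC_sum_left scaleC_one)
    then have "mult_seminorm p ((\<Sum>n<N. S n *\<^sub>C z n) + y)
        \<le> mult_seminorm p (\<Sum>n<N. S n *\<^sub>C (z n - y)) + cmod ((\<Sum>n<N. S n) + 1) * mult_seminorm p y"
      using cseminorm_add[OF c, of "\<Sum>n<N. S n *\<^sub>C (z n - y)" "((\<Sum>n<N. S n) + 1) *\<^sub>C y"]
      by (simp add: cseminorm_scale[OF c])
    moreover have "mult_seminorm p (\<Sum>n<N. S n *\<^sub>C (z n - y)) \<le> exp (2 * pi) * d"
    proof -
      have "mult_seminorm p (\<Sum>n<N. S n *\<^sub>C (z n - y)) \<le> (\<Sum>n<N. mult_seminorm p (S n *\<^sub>C (z n - y)))"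
        by (rule cseminorm_sum[OF c])
      also have "\<dots> \<le> (\<Sum>n<N. ((2 * pi) ^ n /\<^sub>R fact n) * d)"
      proof (rule sum_mono)
        fix n
        \<comment> \<open>The crude bound n \<le> 2^n absorbs the factor n into the exponential
          series and produces the constant \<open>exp (2 * pi)\<close>.\<close>
        have "real n * d \<le> 2 ^ n * d"
          using d of_nat_less_two_power[of n, where 'a = real] by (intro mult_right_mono) auto
        then have "mult_seminorm p (z n - y) \<le> 2 ^ n * d" using z[of n] by simp
        then have "mult_seminorm p (S n *\<^sub>C (z n - y)) \<le> (pi ^ n /\<^sub>R fact n) * (2 ^ n * d)"
          by (simp only: cseminorm_scale[OF c] S_norm) (intro mult_left_mono; simp)
        then show "mult_seminorm p (S n *\<^sub>C (z n - y)) \<le> ((2 * pi) ^ n /\<^sub>R fact n) * d"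
          by (simp add: power_mult_distrib mult_ac)
      qed
      also have "\<dots> = (\<Sum>n<N. (2 * pi) ^ n /\<^sub>R fact n) * d" by (simp add: sum_distrib_right)
      also have "(\<Sum>n<N. (2 * pi) ^ n /\<^sub>R fact n) \<le> exp (2 * pi)"
        unfolding exp_def by (intro sum_le_suminf summable_exp_generic) auto
      finally show ?thesis using d by (simp add: mult_right_mono)
    qed
    ultimately show ?thesis by simp
  qed
  have "(\<lambda>N. mult_seminorm p ((\<Sum>n<N. S n *\<^sub>C z n) + y - (w + y))) \<longlonglongrightarrow> 0"
    using lim by (simp add: S_def)
  then have "(\<lambda>N. mult_seminorm p ((\<Sum>n<N. S n *\<^sub>C z n) + y)) \<longlonglongrightarrow> mult_seminorm p (w + y)"
    by (rule tendsto_cseminorm[OF c])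
  moreover have "(\<lambda>N. exp (2 * pi) * d + cmod ((\<Sum>n<N. S n) + 1) * mult_seminorm p y)
      \<longlonglongrightarrow> exp (2 * pi) * d + cmod (-1 + 1) * mult_seminorm p y"
    by (intro tendsto_intros S_lim)
  ultimately have "mult_seminorm p (w + y) \<le> exp (2 * pi) * d + cmod (-1 + 1) * mult_seminorm p y"
    by (rule LIMSEQ_le) (use bound in blast)
  then show ?thesis by simp
qed

text \<open>The element \<open>g = (1 - exp (i \<pi> e)) / 2\<close> behaves like \<open>e\<close> as an approximate unit, but in addition
  \<open>1 - g\<close> is visibly a contraction, because the exponential is unitary.\<close>

lemma contractive_unit_of_selfadjoint:
  fixes e :: "'a::pro_cstar_algebra"
  assumes e: "star e = e" "\<And>q. q \<in> cstar_seminorms \<Longrightarrow> q e \<le> 1"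
  obtains g where "\<And>q. q \<in> cstar_seminorms \<Longrightarrow> q g \<le> 1"
    "\<And>q. q \<in> cstar_seminorms \<Longrightarrow> mult_seminorm q (1 - embed g) \<le> 1"
    "\<And>q y. q \<in> cstar_seminorms \<Longrightarrow> q (y - g * y) \<le> exp (2 * pi) * q (e * y - y)"
    "\<And>q y. q \<in> cstar_seminorms \<Longrightarrow> q (y - y * g) \<le> exp (2 * pi) * q (y * e - y)"
proof -
  define x where "x = embed e"
  have h: "star (complex_of_real pi *\<^sub>C e) = complex_of_real pi *\<^sub>C e" by (simp add: star_scaleC e)
  obtain u where
    lim: "\<And>q. q \<in> cstar_seminorms \<Longrightarrow>
      (\<lambda>N. mult_seminorm q (exp_partial \<i> (embed (complex_of_real pi *\<^sub>C e)) N - (1 + embed u))) \<longlonglongrightarrow> 0"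
    and u: "\<And>q. q \<in> cstar_seminorms \<Longrightarrow> mult_seminorm q (1 + embed u) \<le> 1"
    using exp_selfadjoint[OF h] by metis
  have E: "exp_partial \<i> (embed (complex_of_real pi *\<^sub>C e)) N = (\<Sum>n<N. ((\<i> * pi) ^ n /\<^sub>R fact n) *\<^sub>C x ^ n)" for N
    unfolding exp_partial_def embed_scaleC scaleC_power scaleC_scaleC x_def
    by (simp add: power_mult_distrib)
  define g where "g = (- 1 / 2) *\<^sub>C u"
  have u_g: "embed u = (- 2) *\<^sub>C embed g"
    by (simp add: g_def embed_scaleC scaleC_scaleC scaleC_one)
  have g1: "embed g = (1 / 2) *\<^sub>C (1 - (1 + embed u))"
    by (simp add: u_g scaleC_scaleC scaleC_one flip: scaleC_minus_left)
  have half: "(1 / 2) *\<^sub>C 1 + (1 / 2) *\<^sub>C 1 = (1 :: 'a multiplier)"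
    using scaleC_add_left[of "1 / 2" "1 / 2" "1 :: 'a multiplier"] by (simp add: scaleC_one)
  have g2: "1 - embed g = (1 / 2) *\<^sub>C (1 + (1 + embed u))"
    using half by (simp add: g1 scaleC_add_right scaleC_diff_right scaleC_minus_right algebra_simps)
  show ?thesis
  proof (rule that[of g])
    fix q :: "'a \<Rightarrow> real" assume q: "q \<in> cstar_seminorms"
    note c = cseminorm_mult_seminorm[OF q]
    have "mult_seminorm q (embed g) \<le> 1"
      unfolding g1 using cseminorm_diff[OF c, of 1 "1 + embed u"] u[OF q] mult_seminorm_one[OF q]
      by (simp add: cseminorm_scale[OF c] norm_divide)
    then show "q g \<le> 1" by (simp add: mult_seminorm_embed[OF q])
    show "mult_seminorm q (1 - embed g) \<le> 1"
      unfolding g2 using cseminorm_add[OF c, of 1 "1 + embed u"] u[OF q] mult_seminorm_one[OF q]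
      by (simp add: cseminorm_scale[OF c] norm_divide)
    have x1: "mult_seminorm q x \<le> 1" by (simp add: x_def mult_seminorm_embed[OF q] e(2)[OF q])
    have const: "(\<lambda>N. mult_seminorm q (y - y)) \<longlonglongrightarrow> 0" for y
      by (simp add: cseminorm_zero[OF c])
    fix y :: 'a
    let ?y = "embed y"
    have two: "?y + ?y = 2 *\<^sub>C ?y"
      using scaleC_add_left[of 1 1 ?y] by (simp add: scaleC_one)
    show "q (y - g * y) \<le> exp (2 * pi) * q (e * y - y)"
    proof -
      \<comment> \<open>Each further factor \<open>x\<close> costs at most
        \<open>q (e * y - y)\<close>, since \<open>x\<close> is a contraction.\<close>
      have "mult_seminorm q (x ^ n * ?y - ?y) \<le> real n * q (e * y - y)" for n
      proof (induction n)
        case (Suc n)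
        have "x ^ Suc n * ?y - ?y = x * (x ^ n * ?y - ?y) + embed (e * y - y)"
          by (simp add: x_def embed_mult embed_diff algebra_simps)
        then have "mult_seminorm q (x ^ Suc n * ?y - ?y)
            \<le> mult_seminorm q x * mult_seminorm q (x ^ n * ?y - ?y) + q (e * y - y)"
          using cseminorm_add[OF c, of "x * (x ^ n * ?y - ?y)" "embed (e * y - y)"]
            mult_seminorm_mult[OF q, of x "x ^ n * ?y - ?y"] by (simp add: mult_seminorm_embed[OF q])
        also have "mult_seminorm q x * mult_seminorm q (x ^ n * ?y - ?y) \<le> 1 * (real n * q (e * y - y))"
          using x1 Suc by (intro mult_mono) (auto simp: mult_seminorm_nonneg[OF q])
        finally show ?case by (simp add: algebra_simps)
      qed (simp add: cseminorm_zero[OF c])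
      moreover have "(\<lambda>N. mult_seminorm q ((\<Sum>n<N. ((\<i> * pi) ^ n /\<^sub>R fact n) *\<^sub>C (x ^ n * ?y)) - (1 + embed u) * ?y))
          \<longlonglongrightarrow> 0"
        using tendsto_mult_seminorm[OF q lim[OF q] const[of ?y]]
        by (simp add: E sum_distrib_right mult_scaleC_left)
      ultimately have "mult_seminorm q ((1 + embed u) * ?y + ?y) \<le> exp (2 * pi) * q (e * y - y)"
        by (rule exp_pi_estimate[OF q])
      moreover have "(1 + embed u) * ?y + ?y = 2 *\<^sub>C embed (y - g * y)"
        using two by (simp add: u_g embed_diff embed_mult distrib_right scaleC_diff_right mult_scaleC_left
            scaleC_minus_left algebra_simps)
      ultimately show ?thesis
        using cseminorm_nonneg[OF cseminorm_cstar[OF q], of "y - g * y"]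
        by (simp add: cseminorm_scale[OF c] mult_seminorm_embed[OF q])
    qed
    show "q (y - y * g) \<le> exp (2 * pi) * q (y * e - y)"
    proof -
      have "mult_seminorm q (?y * x ^ n - ?y) \<le> real n * q (y * e - y)" for n
      proof (induction n)
        case (Suc n)
        have "?y * x ^ Suc n - ?y = (?y * x ^ n - ?y) * x + embed (y * e - y)"
          unfolding power_Suc2 by (simp add: x_def embed_mult embed_diff algebra_simps)
        then have "mult_seminorm q (?y * x ^ Suc n - ?y)
            \<le> mult_seminorm q (?y * x ^ n - ?y) * mult_seminorm q x + q (y * e - y)"
          using cseminorm_add[OF c, of "(?y * x ^ n - ?y) * x" "embed (y * e - y)"]
            mult_seminorm_mult[OF q, of "?y * x ^ n - ?y" x] by (simp add: mult_seminorm_embed[OF q])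
        also have "mult_seminorm q (?y * x ^ n - ?y) * mult_seminorm q x \<le> (real n * q (y * e - y)) * 1"
          using x1 Suc by (intro mult_mono) (auto simp: mult_seminorm_nonneg[OF q]
              cseminorm_nonneg[OF cseminorm_cstar[OF q]])
        finally show ?case by (simp add: algebra_simps)
      qed (simp add: cseminorm_zero[OF c])
      moreover have "(\<lambda>N. mult_seminorm q ((\<Sum>n<N. ((\<i> * pi) ^ n /\<^sub>R fact n) *\<^sub>C (?y * x ^ n)) - ?y * (1 + embed u)))
          \<longlonglongrightarrow> 0"
        using tendsto_mult_seminorm[OF q const[of ?y] lim[OF q]]
        by (simp add: E sum_distrib_left mult_scaleC_right)
      ultimately have "mult_seminorm q (?y * (1 + embed u) + ?y) \<le> exp (2 * pi) * q (y * e - y)"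
        by (rule exp_pi_estimate[OF q])
      moreover have "?y * (1 + embed u) + ?y = 2 *\<^sub>C embed (y - y * g)"
        using two by (simp add: u_g embed_diff embed_mult distrib_left scaleC_diff_right mult_scaleC_right
            scaleC_minus_left algebra_simps)
      ultimately show ?thesis
        using cseminorm_nonneg[OF cseminorm_cstar[OF q], of "y - y * g"]
        by (simp add: cseminorm_scale[OF c] mult_seminorm_embed[OF q])
    qed
  qed
qed

text \<open>Closeness is asked in one seminorm for finitely many elements, but the contraction
  bounds hold in all seminorms, because the Neumann series has to converge in A.\<close>

lemma contractive_unit:
  fixes e :: "'l::preorder \<Rightarrow> 'a::pro_cstar_algebra" and p :: "'a \<Rightarrow> real"
  assumes e: "approximate_unit e" and p: "p \<in> cstar_seminorms" and F: "finite F" and \<epsilon>: "\<epsilon> > 0"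
  shows "\<exists>g. (\<forall>q\<in>cstar_seminorms. q g \<le> 1 \<and> mult_seminorm q (1 - embed g) \<le> 1) \<and>
    (\<forall>a\<in>F. p (a - g * a) \<le> \<epsilon> \<and> p (a - a * g) \<le> \<epsilon>)"
proof -
  define \<delta> where "\<delta> = \<epsilon> / exp (2 * pi)"
  have "\<delta> > 0" using \<epsilon> by (simp add: \<delta>_def)
  then have "eventually (\<lambda>i. p (e i * a - a) < \<delta> \<and> p (a * e i - a) < \<delta>) net_filter" for a
    using approximate_unit_tendsto[OF e p, of a]
    by (intro eventually_conj order_tendstoD(2)[where a = \<delta>]) auto
  then have "eventually (\<lambda>i. \<forall>a\<in>F. p (e i * a - a) < \<delta> \<and> p (a * e i - a) < \<delta>) net_filter"
    using F by (simp add: eventually_ball_finite)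
  then obtain i where i: "\<And>a. a \<in> F \<Longrightarrow> p (e i * a - a) < \<delta> \<and> p (a * e i - a) < \<delta>"
    using eventually_happens'[OF net_filter_nonbot[OF e]] by blast
  obtain g where "\<And>q. q \<in> cstar_seminorms \<Longrightarrow> q g \<le> 1"
    "\<And>q. q \<in> cstar_seminorms \<Longrightarrow> mult_seminorm q (1 - embed g) \<le> 1"
    and g: "\<And>y. p (y - g * y) \<le> exp (2 * pi) * p (e i * y - y)"
    "\<And>y. p (y - y * g) \<le> exp (2 * pi) * p (y * e i - y)"
    using contractive_unit_of_selfadjoint[of "e i"] approximate_unit_selfadjoint[OF e, of i]
      approximate_unit_le_one[OF e] p by metis
  moreover have "p (a - g * a) \<le> \<epsilon> \<and> p (a - a * g) \<le> \<epsilon>" if "a \<in> F" for a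
  proof -
    have "exp (2 * pi) * p (e i * a - a) \<le> exp (2 * pi) * \<delta>" "exp (2 * pi) * p (a * e i - a) \<le> exp (2 * pi) * \<delta>"
      using i[OF that] by (auto intro!: mult_left_mono)
    then show ?thesis using g[of a] by (simp add: \<delta>_def)
  qed
  ultimately show ?thesis by blast
qed


section \<open>Factorization of null sequences\<close>

text \<open>The solution is the series of iterates of \<open>T\<close>. The map is merely additive
  so that left and right multiplication are both instances; the common ratio \<open>\<rho>\<close>
  gives convergence in every seminorm.\<close>

lemma neumann_solvable:
  fixes T :: "'a::pro_cstar_algebra \<Rightarrow> 'a"
  assumes add: "\<And>a b. T (a + b) = T a + T b" and \<rho>: "0 \<le> \<rho>" "\<rho> < 1"
    and bound: "\<And>q a. q \<in> cstar_seminorms \<Longrightarrow> q (T a) \<le> \<rho> * q a"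
  shows "\<exists>y. y - T y = z"
proof -
  have pow: "q ((T ^^ n) z) \<le> q z * \<rho> ^ n" if q: "q \<in> cstar_seminorms" for q n
  proof (induction n)
    case (Suc n)
    have "q (T ((T ^^ n) z)) \<le> \<rho> * (q z * \<rho> ^ n)"
      using order_trans[OF bound[OF q] mult_left_mono[OF Suc \<rho>(1)]] .
    then show ?case by (simp add: mult_ac)
  qed simp
  have summ: "summable (\<lambda>n. q ((T ^^ n) z))" if q: "q \<in> cstar_seminorms" for q
  proof (rule summable_comparison_test')
    show "summable (\<lambda>n. q z * \<rho> ^ n)" using \<rho> by (intro summable_mult summable_geometric) simp
    show "norm (q ((T ^^ n) z)) \<le> q z * \<rho> ^ n" if "0 \<le> n" for n
      using pow[OF q] cseminorm_nonneg[OF cseminorm_cstar[OF q]] by simp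
  qed
  obtain y where y: "\<And>q. q \<in> cstar_seminorms \<Longrightarrow> (\<lambda>N. q ((\<Sum>n<N. (T ^^ n) z) - y)) \<longlonglongrightarrow> 0"
    using summable_pro_cstar[of "\<lambda>n. (T ^^ n) z"] summ by metis
  have T0: "T 0 = 0" using add[of 0 0] by simp
  have T_diff: "T (a - b) = T a - T b" for a b using add[of "a - b" b] by (simp add: eq_diff_eq)
  have sum_T: "(\<Sum>n<N. (T ^^ n) z) - T (\<Sum>n<N. (T ^^ n) z) = z - (T ^^ N) z" for N
  proof -
    have "T (\<Sum>n<N. (T ^^ n) z) = (\<Sum>n<N. (T ^^ Suc n) z)"
      by (induction N) (simp_all add: T0 add)
    then show ?thesis
      using sum_lessThan_telescope'[of "\<lambda>n. (T ^^ n) z" N] by (simp only: sum_subtractf) simp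
  qed
  have "y - T y - z = 0"
  proof (rule pro_cstar_eq_zeroI)
    fix q :: "'a \<Rightarrow> real" assume q: "q \<in> cstar_seminorms"
    note c = cseminorm_cstar[OF q]
    let ?S = "\<lambda>N. \<Sum>n<N. (T ^^ n) z"
    have "q (y - T y - z) \<le> q (?S N - y) + \<rho> * q (?S N - y) + q z * \<rho> ^ N" for N
    proof -
      have eq: "y - T y - z = T (?S N - y) - (?S N - y) - (T ^^ N) z"
        using sum_T[of N] by (simp add: T_diff algebra_simps)
      show ?thesis
        unfolding eq using cseminorm_diff[OF c, of "T (?S N - y) - (?S N - y)" "(T ^^ N) z"]
          cseminorm_diff[OF c, of "T (?S N - y)" "?S N - y"] bound[OF q, of "?S N - y"] pow[OF q, of N]
        by linarith
    qed
    moreover have "(\<lambda>N. q (?S N - y) + \<rho> * q (?S N - y) + q z * \<rho> ^ N) \<longlonglongrightarrow> 0 + \<rho> * 0 + q z * 0"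
      using \<rho> by (intro tendsto_intros y[OF q] LIMSEQ_power_zero) simp
    ultimately have "q (y - T y - z) \<le> 0 + \<rho> * 0 + q z * 0"
      by (intro LIMSEQ_le_const[rotated]) auto
    then show "q (y - T y - z) = 0" using cseminorm_nonneg[OF c, of "y - T y - z"] by simp
  qed
  then show ?thesis by (intro exI[of _ y]) simp
qed

text \<open>\<open>T J\<close> and \<open>G J\<close> stand for one-sided multiplication by t_J and
  g_J. The increment d of the solution from J to J + 1 satisfies T_(J+1) d = 2^-(J+1) (y - G_J y).
  Since T_(J+1) shrinks p at most by the factor 2^-(J+1) and G_J nearly fixes y, the increment is at
  most 2^-(J+1), and the increments sum to at most 1.\<close>

lemma cohen_bounded:
  fixes p :: "'a::pro_cstar_algebra \<Rightarrow> real"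
  assumes p: "p \<in> cstar_seminorms"
    and add: "\<And>J a b. T J (a + b) = T J a + T J b"
    and T0: "\<And>J a. p (a - T J a) \<le> (1 - (1 / 2) ^ J) * p a"
    and T_Suc: "\<And>J a. T (Suc J) a = T J a - complex_of_real ((1 / 2) ^ Suc J) *\<^sub>C (a - G J a)"
    and y: "\<And>J j. T J (y J j) = z j"
    and G: "\<And>J j. j \<le> J \<Longrightarrow> p (y J j - G J (y J j)) \<le> (1 / 2) ^ Suc J"
    and z: "\<And>n. p (z n) \<le> (1 / 2) ^ n"
    and "j \<le> J"
  shows "p (y J j) \<le> 2"
proof -
  note c = cseminorm_cstar[OF p]
  have below: "(1 / 2) ^ J * p a \<le> p (T J a)" for J a
    using cseminorm_triangle_sub[OF c, of a "T J a"] T0[of a J] by (simp add: algebra_simps)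
  have T_diff: "T J (a - b) = T J a - T J b" for J a b
    using add[of J "a - b" b] by (simp add: eq_diff_eq)
  have "p (y J j) \<le> 2 - (1 / 2) ^ J"
    using \<open>j \<le> J\<close>
  proof (induction J rule: dec_induct)
    \<comment> \<open>At the start the lower bound 2^-j of \<open>T j\<close> is compensated by the
      decay of \<open>z j\<close>; this is where a null sequence is needed.\<close>
    case base
    have "(1 / 2) ^ j * p (y j j) \<le> (1 / 2) ^ j * 1"
      using below[of j "y j j"] z[of j] unfolding y by linarith
    then have "p (y j j) \<le> 1"
      by (simp only: mult_le_cancel_left_pos zero_less_power zero_less_divide_1_iff zero_less_numeral)
    moreover have "(1 / 2 :: real) ^ j \<le> 1" by (rule power_le_one) auto
    ultimately show ?case by linarith
  next
    case (step J)
    let ?d = "y (Suc J) j - y J j"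
    have "T (Suc J) ?d = complex_of_real ((1 / 2) ^ Suc J) *\<^sub>C (y J j - G J (y J j))"
      by (simp only: T_diff y T_Suc[of J "y J j"]) simp
    then have "p (T (Suc J) ?d) = (1 / 2) ^ Suc J * p (y J j - G J (y J j))"
      by (simp only: cseminorm_scale_real[OF c] zero_le_power zero_le_divide_1_iff zero_le_numeral)
    also have "\<dots> \<le> (1 / 2) ^ Suc J * (1 / 2) ^ Suc J"
      using step by (intro mult_left_mono G) auto
    finally have "(1 / 2) ^ Suc J * p ?d \<le> (1 / 2) ^ Suc J * (1 / 2) ^ Suc J"
      using below[of "Suc J" ?d] by linarith
    then have "p ?d \<le> (1 / 2) ^ Suc J" by (simp only: mult_le_cancel_left_pos zero_less_power
          zero_less_divide_1_iff zero_less_numeral)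
    then show ?case
      using step.IH cseminorm_triangle_sub[OF c, of "y (Suc J) j" "y J j"] by simp
  qed
  then show ?thesis using zero_le_power[of "1 / 2 :: real" J] by linarith
qed

text \<open>
  Cohen factorization: \<open>a\<close> is the limit of the invertible elements
  \<open>t\<^sub>J = 2\<^sup>-\<^sup>J + \<Sum>\<^sub>j\<^sub><\<^sub>J 2\<^sup>-\<^sup>j\<^sup>-\<^sup>1 g\<^sub>j\<close>, and the \<open>g\<^sub>j\<close> are chosen so that the elements \<open>t\<^sub>J\<^sup>-\<^sup>1 z\<^sub>n\<close> with
  \<open>n \<le> J\<close> stay bounded. Invertibility is clear because \<open>1 - t\<^sub>J\<close> is a combination of the
  contractions \<open>1 - g\<^sub>j\<close> of total weight \<open>1 - 2\<^sup>-\<^sup>J\<close>.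
\<close>

lemma null_sequence_factorization:
  fixes e :: "'l::preorder \<Rightarrow> 'a::pro_cstar_algebra" and p :: "'a \<Rightarrow> real"
  assumes e: "approximate_unit e" and p: "p \<in> cstar_seminorms" and z: "\<And>n. p (z n) \<le> (1 / 2) ^ n"
  obtains a where "\<And>x n. mult_seminorm p (x * embed (z n)) \<le> 2 * mult_seminorm p (x * embed a)"
    "\<And>x n. mult_seminorm p (embed (z n) * x) \<le> 2 * mult_seminorm p (embed a * x)"
proof -
  note c = cseminorm_mult_seminorm[OF p]
  \<comment> \<open>\<open>sl t n\<close> and \<open>sr t n\<close> play the roles of t^-1 z_n and
    z_n t^-1. As choices depending on \<open>t\<close> alone they allow the sequence
    \<open>t\<close> to be defined by recursion before solvability is shown.\<close>
  define sl where "sl t n = (SOME y. t * embed y = embed (z n))" for t :: "'a multiplier" and n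
  define sr where "sr t n = (SOME y. embed y * t = embed (z n))" for t :: "'a multiplier" and n
  define G where "G J t = (SOME g. (\<forall>q\<in>cstar_seminorms. q g \<le> 1 \<and> mult_seminorm q (1 - embed g) \<le> 1) \<and>
    (\<forall>a\<in>sl t ` {..J} \<union> sr t ` {..J}. p (a - g * a) \<le> (1 / 2) ^ Suc J \<and> p (a - a * g) \<le> (1 / 2) ^ Suc J))"
    for J and t :: "'a multiplier"
  define t where "t = rec_nat 1 (\<lambda>J t. t - complex_of_real ((1 / 2) ^ Suc J) *\<^sub>C (1 - embed (G J t)))"
  define g where "g J = G J (t J)" for J
  have t_Suc: "t (Suc J) = t J - complex_of_real ((1 / 2) ^ Suc J) *\<^sub>C (1 - embed (g J))" and t_0: "t 0 = 1" for J
    by (simp_all add: t_def g_def)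
  have G: "(\<forall>q\<in>cstar_seminorms. q (g J) \<le> 1 \<and> mult_seminorm q (1 - embed (g J)) \<le> 1) \<and>
    (\<forall>a\<in>sl (t J) ` {..J} \<union> sr (t J) ` {..J}. p (a - g J * a) \<le> (1 / 2) ^ Suc J \<and> p (a - a * g J) \<le> (1 / 2) ^ Suc J)"
    for J
    unfolding g_def G_def by (rule someI_ex, rule contractive_unit[OF e p]) auto
  have g1: "q (g J) \<le> 1" and g2: "mult_seminorm q (1 - embed (g J)) \<le> 1" if "q \<in> cstar_seminorms"
    for q :: "'a \<Rightarrow> real" and J
    using G[of J] that by auto
  have near_one: "mult_seminorm q (1 - t J) \<le> 1 - (1 / 2) ^ J" if q: "q \<in> cstar_seminorms"
    for q :: "'a \<Rightarrow> real" and J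
  proof (induction J)
    case 0
    then show ?case by (simp add: t_0 cseminorm_zero[OF cseminorm_mult_seminorm[OF q]])
  next
    case (Suc J)
    have eq: "1 - t (Suc J) = (1 - t J) + complex_of_real ((1 / 2) ^ Suc J) *\<^sub>C (1 - embed (g J))"
      by (simp add: t_Suc)
    have "mult_seminorm q (1 - t (Suc J))
        \<le> mult_seminorm q (1 - t J) + (1 / 2) ^ Suc J * mult_seminorm q (1 - embed (g J))"
      unfolding eq using cseminorm_add[OF cseminorm_mult_seminorm[OF q], of "1 - t J"
          "complex_of_real ((1 / 2) ^ Suc J) *\<^sub>C (1 - embed (g J))"]
      by (simp add: cseminorm_scale[OF cseminorm_mult_seminorm[OF q]] norm_mult norm_power norm_divide)
    also have "\<dots> \<le> (1 - (1 / 2) ^ J) + (1 / 2) ^ Suc J * 1"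
      using Suc g2[OF q, of J] by (intro add_mono mult_left_mono) auto
    finally show ?case by simp
  qed
  have ract_bound: "q (ract a x) \<le> mult_seminorm q x * q a" if q: "q \<in> cstar_seminorms"
    for q :: "'a \<Rightarrow> real" and a x
  proof -
    have "q (ract a x) = mult_seminorm q (embed a * x)"
      using mult_seminorm_embed[OF q, of "ract a x"] by (simp only: embed_ract)
    then show ?thesis
      using mult_seminorm_mult[OF q, of "embed a" x] by (simp add: mult_seminorm_embed[OF q] mult.commute)
  qed
  have lact_diff: "a - lact x a = lact (1 - x) a" and ract_diff: "a - ract a x = ract a (1 - x)"
    for a :: 'a and x
    by (simp_all add: embed_diff embed_lact embed_ract left_diff_distrib right_diff_distrib flip: embed_inject)
  have ract_add: "ract (a + b) x = ract a x + ract b x" for a b :: 'a and x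
    by (simp add: embed_add embed_ract distrib_right flip: embed_inject)
  have \<rho>: "0 \<le> 1 - (1 / 2 :: real) ^ J" "1 - (1 / 2 :: real) ^ J < 1" for J
    by (simp_all add: power_le_one)
  have lact_T: "q (lact (1 - t J) a) \<le> (1 - (1 / 2) ^ J) * q a"
    and ract_T: "q (ract a (1 - t J)) \<le> (1 - (1 / 2) ^ J) * q a" if q: "q \<in> cstar_seminorms"
    for q :: "'a \<Rightarrow> real" and J a
    using lact_le[OF q, of "1 - t J" a] ract_bound[OF q, of a "1 - t J"]
      mult_right_mono[OF near_one[OF q, of J] cseminorm_nonneg[OF cseminorm_cstar[OF q], of a]]
    by linarith+
  have yl: "t J * embed (sl (t J) n) = embed (z n)" for J n
  proof -
    obtain y where "y - lact (1 - t J) y = z n"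
      using neumann_solvable[where T = "lact (1 - t J)", OF lact_algebra(2) \<rho> lact_T] by blast
    then have "lact (t J) y = z n" by (simp flip: lact_diff)
    then have "t J * embed y = embed (z n)" by (metis embed_lact)
    then show ?thesis unfolding sl_def by (rule someI)
  qed
  have yr: "embed (sr (t J) n) * t J = embed (z n)" for J n
  proof -
    obtain y where "y - ract y (1 - t J) = z n"
      using neumann_solvable[where T = "\<lambda>a. ract a (1 - t J)", OF ract_add \<rho> ract_T] by blast
    then have "ract y (t J) = z n" by (simp flip: ract_diff)
    then have "embed y * t J = embed (z n)" by (metis embed_ract)
    then show ?thesis unfolding sr_def by (rule someI)
  qed
  have bound_l: "p (sl (t J) n) \<le> 2" if "n \<le> J" for J n
  proof (rule cohen_bounded[where T = "\<lambda>J. lact (t J)" and G = "\<lambda>J a. g J * a" and y = "\<lambda>J. sl (t J)",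
        OF p lact_algebra(2) _ _ _ _ z that])
    show "p (a - lact (t J) a) \<le> (1 - (1 / 2) ^ J) * p a" for J a
      unfolding lact_diff by (rule lact_T[OF p])
    show "lact (t (Suc J)) a = lact (t J) a - complex_of_real ((1 / 2) ^ Suc J) *\<^sub>C (a - g J * a)" for J a
      by (rule lact_eqI) (simp add: t_Suc embed_diff embed_lact embed_scaleC embed_mult left_diff_distrib
          mult_scaleC_left)
    show "lact (t J) (sl (t J) j) = z j" for J j by (rule lact_eqI) (simp add: yl)
    show "p (sl (t J) j - g J * sl (t J) j) \<le> (1 / 2) ^ Suc J" if "j \<le> J" for J j
      using G[of J] that by blast
  qed
  have bound_r: "p (sr (t J) n) \<le> 2" if "n \<le> J" for J n
  proof (rule cohen_bounded[where T = "\<lambda>J a. ract a (t J)" and G = "\<lambda>J a. a * g J" and y = "\<lambda>J. sr (t J)",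
        OF p ract_add _ _ _ _ z that])
    show "p (a - ract a (t J)) \<le> (1 - (1 / 2) ^ J) * p a" for J a
      unfolding ract_diff by (rule ract_T[OF p])
    show "ract a (t (Suc J)) = ract a (t J) - complex_of_real ((1 / 2) ^ Suc J) *\<^sub>C (a - a * g J)" for J a
      by (simp add: t_Suc embed_diff embed_ract embed_scaleC embed_mult right_diff_distrib
          mult_scaleC_right flip: embed_inject)
    show "ract (sr (t J) j) (t J) = z j" for J j by (simp add: embed_ract yr flip: embed_inject)
    show "p (sr (t J) j - sr (t J) j * g J) \<le> (1 / 2) ^ Suc J" if "j \<le> J" for J j
      using G[of J] that by blast
  qed
  \<comment> \<open>\<open>t N\<close> is the partial sum of \<open>b\<close> plus 2^-N times the
    unit, so its limit lies in A.\<close>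
  define b where "b J = complex_of_real ((1 / 2) ^ Suc J) *\<^sub>C g J" for J
  have "summable (\<lambda>J. q (b J))" if q: "q \<in> cstar_seminorms" for q
  proof (rule summable_comparison_test')
    show "summable (\<lambda>J. (1 / 2 :: real) ^ J)" by (intro summable_geometric) simp
    fix J
    have "q (b J) = (1 / 2) ^ Suc J * q (g J)"
      by (simp add: b_def cseminorm_scale[OF cseminorm_cstar[OF q]] norm_mult norm_power norm_divide)
    also have "\<dots> \<le> (1 / 2) ^ Suc J * 1" by (intro mult_left_mono g1 q) simp
    also have "\<dots> \<le> (1 / 2) ^ J" by simp
    finally show "norm (q (b J)) \<le> (1 / 2) ^ J"
      using cseminorm_nonneg[OF cseminorm_cstar[OF q]] by simp
  qed
  then obtain a where a: "\<And>q. q \<in> cstar_seminorms \<Longrightarrow> (\<lambda>N. q ((\<Sum>J<N. b J) - a)) \<longlonglongrightarrow> 0"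
    using summable_pro_cstar[of b] by metis
  have t_eq: "t N = complex_of_real ((1 / 2) ^ N) *\<^sub>C 1 + embed (\<Sum>J<N. b J)" for N
  proof (induction N)
    case 0
    then show ?case by (simp add: t_0 scaleC_one)
  next
    case (Suc N)
    have "complex_of_real ((1 / 2) ^ N) = complex_of_real ((1 / 2) ^ Suc N) + complex_of_real ((1 / 2) ^ Suc N)"
      by simp
    then have "complex_of_real ((1 / 2) ^ N) *\<^sub>C (1 :: 'a multiplier)
        = complex_of_real ((1 / 2) ^ Suc N) *\<^sub>C 1 + complex_of_real ((1 / 2) ^ Suc N) *\<^sub>C 1"
      by (metis scaleC_add_left)
    then show ?case
      by (simp only: t_Suc Suc sum.lessThan_Suc embed_add b_def[of N] embed_scaleC scaleC_diff_right) simp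
  qed
  have "(\<lambda>N. mult_seminorm p (t N - embed a)) \<longlonglongrightarrow> 0"
  proof (rule Lim_null_comparison)
    have "(\<lambda>N. (1 / 2) ^ N * mult_seminorm p 1 + p ((\<Sum>J<N. b J) - a)) \<longlonglongrightarrow> 0 * mult_seminorm p 1 + 0"
      by (intro tendsto_intros a[OF p] LIMSEQ_power_zero) simp
    then show "(\<lambda>N. (1 / 2) ^ N * mult_seminorm p 1 + p ((\<Sum>J<N. b J) - a)) \<longlonglongrightarrow> 0" by simp
    have "norm (mult_seminorm p (t N - embed a)) \<le> (1 / 2) ^ N * mult_seminorm p 1 + p ((\<Sum>J<N. b J) - a)" for N
    proof -
      have "t N - embed a = complex_of_real ((1 / 2) ^ N) *\<^sub>C 1 + embed ((\<Sum>J<N. b J) - a)"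
        by (simp add: t_eq embed_diff)
      then show ?thesis
        using cseminorm_add[OF c, of "complex_of_real ((1 / 2) ^ N) *\<^sub>C 1" "embed ((\<Sum>J<N. b J) - a)"]
        by (simp add: cseminorm_scale[OF c] norm_mult norm_power norm_divide mult_seminorm_embed[OF p]
            mult_seminorm_nonneg[OF p])
    qed
    then show "\<forall>\<^sub>F N in sequentially. norm (mult_seminorm p (t N - embed a))
        \<le> (1 / 2) ^ N * mult_seminorm p 1 + p ((\<Sum>J<N. b J) - a)" by simp
  qed
  note t_lim = this
  have x_lim: "(\<lambda>N. mult_seminorm p (x - x)) \<longlonglongrightarrow> 0" for x :: "'a multiplier"
    by (simp add: cseminorm_zero[OF c])
  show ?thesis
  proof (rule that[of a])
    fix x n
    have lim: "(\<lambda>N. mult_seminorm p (x * t N) * 2) \<longlonglongrightarrow> mult_seminorm p (x * embed a) * 2"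
      by (intro tendsto_intros tendsto_cseminorm[OF c] tendsto_mult_seminorm[OF p x_lim t_lim])
    \<comment> \<open>Insert z_n = t_J (t_J^-1 z_n); the second factor stays below 2, and letting J
      grow replaces t_J by \<open>a\<close>.\<close>
    have "mult_seminorm p (x * embed (z n)) \<le> mult_seminorm p (x * t J) * 2" if "J \<ge> n" for J
    proof -
      have "mult_seminorm p (x * embed (z n)) \<le> mult_seminorm p (x * t J) * p (sl (t J) n)"
        using mult_seminorm_mult[OF p, of "x * t J" "embed (sl (t J) n)"]
        by (simp add: mult.assoc yl mult_seminorm_embed[OF p])
      then show ?thesis
        using mult_left_mono[OF bound_l[OF that] mult_seminorm_nonneg[OF p, of "x * t J"]] by linarith
    qed
    then have "mult_seminorm p (x * embed (z n)) \<le> mult_seminorm p (x * embed a) * 2"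
      by (intro LIMSEQ_le_const[OF lim]) blast
    then show "mult_seminorm p (x * embed (z n)) \<le> 2 * mult_seminorm p (x * embed a)" by simp
  next
    fix x n
    have lim: "(\<lambda>N. mult_seminorm p (t N * x) * 2) \<longlonglongrightarrow> mult_seminorm p (embed a * x) * 2"
      by (intro tendsto_intros tendsto_cseminorm[OF c] tendsto_mult_seminorm[OF p t_lim x_lim])
    have "mult_seminorm p (embed (z n) * x) \<le> mult_seminorm p (t J * x) * 2" if "J \<ge> n" for J
    proof -
      have "mult_seminorm p (embed (z n) * x) \<le> p (sr (t J) n) * mult_seminorm p (t J * x)"
        using mult_seminorm_mult[OF p, of "embed (sr (t J) n)" "t J * x"]
        by (simp add: yr mult_seminorm_embed[OF p] flip: mult.assoc)
      then show ?thesis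
        using mult_right_mono[OF bound_r[OF that] mult_seminorm_nonneg[OF p, of "t J * x"]] by linarith
    qed
    then have "mult_seminorm p (embed (z n) * x) \<le> mult_seminorm p (embed a * x) * 2"
      by (intro LIMSEQ_le_const[OF lim]) blast
    then show "mult_seminorm p (embed (z n) * x) \<le> 2 * mult_seminorm p (embed a * x)" by simp
  qed
qed

section \<open>The strict topology and its bounded sets\<close>

definition strict_seminorms :: "('a::topological_star_algebra multiplier \<Rightarrow> real) set" where
  "strict_seminorms = {\<lambda>x. mult_seminorm p (x * embed a) |p a. p \<in> cstar_seminorms} \<union>
      {\<lambda>x. mult_seminorm p (embed a * x) |p a. p \<in> cstar_seminorms}"

lemma strict_topology_eq: "strict_topology = seminorm_topology strict_seminorms"
  by (simp add: strict_topology_def strict_seminorms_def)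

lemma cseminorm_strict_seminorms:
  fixes s :: "'a::pro_cstar_algebra multiplier \<Rightarrow> real"
  assumes "s \<in> strict_seminorms"
  shows "cseminorm s"
proof -
  obtain p a where p: "p \<in> cstar_seminorms"
    and s: "s = (\<lambda>x. mult_seminorm p (x * embed a)) \<or> s = (\<lambda>x. mult_seminorm p (embed a * x))"
    using assms by (auto simp: strict_seminorms_def)
  note c = cseminorm_mult_seminorm[OF p]
  show ?thesis
    using s cseminorm_add[OF c] cseminorm_scale[OF c]
    by (auto simp: cseminorm_def distrib_left distrib_right mult_scaleC_left mult_scaleC_right)
qed

lemma locally_convex_strict_topology: "locally_convex (strict_topology :: 'a::pro_cstar_algebra multiplier topology)"
  unfolding locally_convex_def strict_topology_eq using cseminorm_strict_seminorms by blast

lemma mult_seminorm_embed_mono: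
  fixes p q :: "'a::pro_cstar_algebra \<Rightarrow> real"
  assumes "p \<in> cstar_seminorms" "q \<in> cstar_seminorms" "q \<le> p"
  shows "mult_seminorm q (x * embed a) \<le> mult_seminorm p (x * embed a)"
    "mult_seminorm q (embed a * x) \<le> mult_seminorm p (embed a * x)"
  using assms(3)
  by (simp_all add: mult_seminorm_embed assms(1,2) le_fun_def flip: embed_lact embed_ract)

text \<open>Directedness merges the finitely many seminorms into one p, leaving a finite set of test
  elements used on both sides.\<close>

lemma nhd_zero_strictE:
  fixes V :: "'a::pro_cstar_algebra multiplier set"
  assumes "nhd_zero strict_topology V"
  obtains p F \<delta> where "p \<in> cstar_seminorms" "finite F" "\<delta> > 0"
    "\<And>x. (\<And>a. a \<in> F \<Longrightarrow> mult_seminorm p (x * embed a) < \<delta>) \<Longrightarrow>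
      (\<And>a. a \<in> F \<Longrightarrow> mult_seminorm p (embed a * x) < \<delta>) \<Longrightarrow> x \<in> V"
proof -
  have "\<exists>Q \<delta>. Q \<subseteq> strict_seminorms \<and> finite Q \<and> \<delta> > 0 \<and> {y. \<forall>q\<in>Q. q y < \<delta>} \<subseteq> V"
    by (rule iffD1[OF nhd_zero_seminorm_topology assms[unfolded strict_topology_eq]])
      (rule cseminorm_strict_seminorms)
  then obtain Q \<delta> where Q: "Q \<subseteq> strict_seminorms" "finite Q" "\<delta> > 0" "{y. \<forall>q\<in>Q. q y < \<delta>} \<subseteq> V"
    by (elim exE conjE) (rule that)
  have "\<exists>p a. p \<in> cstar_seminorms \<and>
      (s = (\<lambda>x. mult_seminorm p (x * embed a)) \<or> s = (\<lambda>x. mult_seminorm p (embed a * x)))" if "s \<in> Q" for s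
    using subsetD[OF Q(1) that] by (auto simp: strict_seminorms_def)
  then obtain P A where PA: "\<And>s. s \<in> Q \<Longrightarrow> P s \<in> cstar_seminorms"
    "\<And>s. s \<in> Q \<Longrightarrow> s = (\<lambda>x. mult_seminorm (P s) (x * embed (A s))) \<or>
       s = (\<lambda>x. mult_seminorm (P s) (embed (A s) * x))"
    by metis
  obtain p where p: "p \<in> cstar_seminorms" "\<And>q. q \<in> P ` Q \<Longrightarrow> q \<le> p"
    by (rule cstar_seminorms_directed[of "P ` Q"]) (use Q(2) PA(1) in auto)
  show ?thesis
  proof (rule that[OF p(1) finite_imageI[OF Q(2), of A] Q(3)])
    fix x
    assume x: "\<And>a. a \<in> A ` Q \<Longrightarrow> mult_seminorm p (x * embed a) < \<delta>"
      "\<And>a. a \<in> A ` Q \<Longrightarrow> mult_seminorm p (embed a * x) < \<delta>"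
    have "s x < \<delta>" if s: "s \<in> Q" for s
    proof -
      have le: "P s \<le> p" using p(2) s by simp
      from PA(2)[OF s] show ?thesis
      proof
        assume eq: "s = (\<lambda>x. mult_seminorm (P s) (x * embed (A s)))"
        have "s x = mult_seminorm (P s) (x * embed (A s))" by (subst eq) (rule refl)
        also have "\<dots> \<le> mult_seminorm p (x * embed (A s))"
          by (rule mult_seminorm_embed_mono(1)[OF p(1) PA(1)[OF s] le])
        also have "\<dots> < \<delta>" using x(1) s by simp
        finally show ?thesis .
      next
        assume eq: "s = (\<lambda>x. mult_seminorm (P s) (embed (A s) * x))"
        have "s x = mult_seminorm (P s) (embed (A s) * x)" by (subst eq) (rule refl)
        also have "\<dots> \<le> mult_seminorm p (embed (A s) * x)"
          by (rule mult_seminorm_embed_mono(2)[OF p(1) PA(1)[OF s] le])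
        also have "\<dots> < \<delta>" using x(2) s by simp
        finally show ?thesis .
      qed
    qed
    then show "x \<in> V" using Q(4) by (simp add: subset_iff)
  qed
qed

lemma nhd_zero_strictI:
  fixes V :: "'a::pro_cstar_algebra multiplier set"
  assumes p: "p \<in> cstar_seminorms" and "\<delta> > 0"
    and V: "\<And>x. mult_seminorm p (x * embed a) < \<delta> \<Longrightarrow> mult_seminorm p (embed a * x) < \<delta> \<Longrightarrow> x \<in> V"
  shows "nhd_zero strict_topology V"
  unfolding strict_topology_eq
proof (rule iffD2[OF nhd_zero_seminorm_topology])
  let ?Q = "{\<lambda>x. mult_seminorm p (x * embed a), \<lambda>x. mult_seminorm p (embed a * x)}"
  show "\<exists>Q \<delta>. Q \<subseteq> strict_seminorms \<and> finite Q \<and> \<delta> > 0 \<and> {y. \<forall>q\<in>Q. q y < \<delta>} \<subseteq> V"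
    using p \<open>\<delta> > 0\<close> V
    by (intro exI[of _ ?Q] exI[of _ \<delta>]) (auto simp: strict_seminorms_def)
qed (rule cseminorm_strict_seminorms)

text \<open>Summing the finitely many tests gives one seminorm, suited to rescaling arguments. Its
  bound by \<open>c * mult_seminorm p x\<close> records that \<beta> is coarser than \<tau>.\<close>

lemma nhd_zero_strict_seminormE:
  fixes V :: "'a::pro_cstar_algebra multiplier set"
  assumes "nhd_zero strict_topology V"
  obtains s p c where "cseminorm s" "p \<in> cstar_seminorms" "0 \<le> c" "\<And>x. s x \<le> c * mult_seminorm p x"
    "\<And>x. s x < 1 \<Longrightarrow> x \<in> V"
proof -
  obtain p F \<delta> where p: "p \<in> cstar_seminorms" and F: "finite F" and \<delta>: "\<delta> > 0"
    and V: "\<And>x. (\<And>a. a \<in> F \<Longrightarrow> mult_seminorm p (x * embed a) < \<delta>) \<Longrightarrow>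
      (\<And>a. a \<in> F \<Longrightarrow> mult_seminorm p (embed a * x) < \<delta>) \<Longrightarrow> x \<in> V"
    using nhd_zero_strictE[OF assms] by blast
  note c = cseminorm_mult_seminorm[OF p] and nn = mult_seminorm_nonneg[OF p]
  define s where "s x = (\<Sum>a\<in>F. mult_seminorm p (x * embed a) + mult_seminorm p (embed a * x)) / \<delta>" for x
  have "cseminorm s"
    unfolding cseminorm_def
  proof (intro conjI allI)
    fix x y
    have "mult_seminorm p ((x + y) * embed a) + mult_seminorm p (embed a * (x + y))
        \<le> (mult_seminorm p (x * embed a) + mult_seminorm p (embed a * x))
          + (mult_seminorm p (y * embed a) + mult_seminorm p (embed a * y))" for a
      using cseminorm_add[OF c, of "x * embed a" "y * embed a"] cseminorm_add[OF c, of "embed a * x" "embed a * y"]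
      by (simp add: distrib_left distrib_right)
    then show "s (x + y) \<le> s x + s y"
      unfolding s_def add_divide_distrib[symmetric] sum.distrib[symmetric]
      using \<delta> by (intro divide_right_mono sum_mono) (simp_all add: less_imp_le)
  next
    show "s (t *\<^sub>C x) = cmod t * s x" for t x
      by (simp add: s_def mult_scaleC_left mult_scaleC_right cseminorm_scale[OF c] sum_distrib_left distrib_left)
  qed
  moreover have "s x \<le> ((\<Sum>a\<in>F. 2 * p a) / \<delta>) * mult_seminorm p x" for x
  proof -
    have "mult_seminorm p (x * embed a) + mult_seminorm p (embed a * x) \<le> 2 * p a * mult_seminorm p x" for a
      using mult_seminorm_mult[OF p, of x "embed a"] mult_seminorm_mult[OF p, of "embed a" x]
        mult_2[of "p a * mult_seminorm p x"]
      unfolding mult_seminorm_embed[OF p] mult.commute[of "mult_seminorm p x"] mult.assoc by linarith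
    then show ?thesis
      unfolding s_def times_divide_eq_left sum_distrib_right
      using \<delta> by (intro divide_right_mono sum_mono) (simp_all add: less_imp_le)
  qed
  moreover have "0 \<le> (\<Sum>a\<in>F. 2 * p a) / \<delta>"
    using \<delta> cseminorm_nonneg[OF cseminorm_cstar[OF p]] by (intro divide_nonneg_pos sum_nonneg) auto
  moreover have "x \<in> V" if "s x < 1" for x
  proof -
    have "mult_seminorm p (x * embed a) + mult_seminorm p (embed a * x)
        \<le> (\<Sum>a\<in>F. mult_seminorm p (x * embed a) + mult_seminorm p (embed a * x))" if "a \<in> F" for a
      using that F nn by (intro member_le_sum) (auto intro: add_nonneg_nonneg)
    moreover have "(\<Sum>a\<in>F. mult_seminorm p (x * embed a) + mult_seminorm p (embed a * x)) < \<delta>"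
      using that \<delta> by (simp add: s_def)
    ultimately have "mult_seminorm p (x * embed a) + mult_seminorm p (embed a * x) < \<delta>" if "a \<in> F" for a
      using that by fastforce
    then show ?thesis using nn by (intro V) (smt (verit))+
  qed
  ultimately show ?thesis using that p by blast
qed

section \<open>Bounded sets of the strict topology\<close>

lemma tvs_bounded_gauge_ball:
  "tvs_bounded strict_topology (gauge_ball \<gamma> :: 'a::pro_cstar_algebra multiplier set)"
  unfolding tvs_bounded_def
proof (intro allI impI)
  fix V :: "'a multiplier set" assume "nhd_zero strict_topology V"
  then obtain s p c where s: "cseminorm s" and p: "p \<in> cstar_seminorms" and c: "0 \<le> c"
    and le: "\<And>x. s x \<le> c * mult_seminorm p x" and V: "\<And>x. s x < 1 \<Longrightarrow> x \<in> V"
    using nhd_zero_strict_seminormE by blast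
  \<comment> \<open>The summand 1 keeps \<open>t\<close> positive and makes \<open>s x / t\<close>
    strictly less than 1.\<close>
  define t where "t = c * \<bar>\<gamma> p\<bar> + 1"
  have t: "t > 0" using c by (simp add: t_def add_nonneg_pos)
  have "x \<in> (\<lambda>x. complex_of_real t *\<^sub>C x) ` V" if x: "x \<in> gauge_ball \<gamma>" for x
  proof (rule image_eqI)
    have "mult_seminorm p x \<le> \<bar>\<gamma> p\<bar>" using x p by (fastforce simp: gauge_ball_def)
    then have "s x \<le> c * \<bar>\<gamma> p\<bar>" using le[of x] c by (meson mult_left_mono order_trans)
    then show "complex_of_real (1 / t) *\<^sub>C x \<in> V"
      using t by (intro V) (simp only: cseminorm_scale_inverse[OF s t], simp add: t_def)
    show "x = complex_of_real t *\<^sub>C complex_of_real (1 / t) *\<^sub>C x"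
      using t by (simp add: scaleC_scaleC scaleC_one)
  qed
  then show "\<exists>t>0. gauge_ball \<gamma> \<subseteq> (\<lambda>x. complex_of_real t *\<^sub>C x) ` V" using t by blast
qed

text \<open>
  A uniform boundedness principle: if \<open>p x\<^sub>n \<ge> 32\<^sup>n\<close> along \<open>B\<close>, then a single \<open>a\<close> dominating a null sequence
  \<open>2\<^sup>-\<^sup>n e\<^sub>\<lambda>\<close> with suitable indices makes \<open>p (x\<^sub>n a)\<close> unbounded.
\<close>

lemma strictly_bounded_imp_bounded:
  fixes e :: "'l::preorder \<Rightarrow> 'a::pro_cstar_algebra" and p :: "'a \<Rightarrow> real"
  assumes e: "approximate_unit e" and B: "tvs_bounded strict_topology B" and p: "p \<in> cstar_seminorms"
  shows "\<exists>K. \<forall>x\<in>B. mult_seminorm p x \<le> K"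
proof (rule ccontr)
  assume "\<nexists>K. \<forall>x\<in>B. mult_seminorm p x \<le> K"
  then have "\<exists>x\<in>B. mult_seminorm p x > 32 ^ n" for n by (meson not_le)
  then obtain x where x: "\<And>n. x n \<in> B" "\<And>n. mult_seminorm p (x n) > 32 ^ n" by metis
  \<comment> \<open>Otherwise testing on the approximate unit would bound the seminorm by half of
    itself, hence by 0.\<close>
  have "\<exists>i. p (lact (x n) (e i)) > mult_seminorm p (x n) / 2" for n
  proof (rule ccontr)
    assume "\<nexists>i. p (lact (x n) (e i)) > mult_seminorm p (x n) / 2"
    then have "mult_seminorm p (x n) \<le> mult_seminorm p (x n) / 2"
      by (intro mult_seminorm_le_unit[OF e p]) (simp add: not_less)
    then have "mult_seminorm p (x n) \<le> 0" by simp
    then show False using x(2)[of n] zero_less_power[of "32 :: real" n] by linarith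
  qed
  then obtain i where i: "\<And>n. p (lact (x n) (e (i n))) > mult_seminorm p (x n) / 2" by metis
  define z where "z n = complex_of_real ((1 / 2) ^ n) *\<^sub>C e (i n)" for n
  have "p (z n) \<le> (1 / 2) ^ n" for n
  proof -
    have "p (z n) = (1 / 2) ^ n * p (e (i n))"
      by (simp add: z_def cseminorm_scale[OF cseminorm_cstar[OF p]] norm_power norm_divide)
    also have "\<dots> \<le> (1 / 2) ^ n * 1" by (intro mult_left_mono approximate_unit_le_one[OF e p]) simp
    finally show ?thesis by simp
  qed
  then obtain a where a: "\<And>x n. mult_seminorm p (x * embed (z n)) \<le> 2 * mult_seminorm p (x * embed a)"
    using null_sequence_factorization[OF e p] by metis
  have "nhd_zero strict_topology {x. mult_seminorm p (x * embed a) < 1}"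
    by (rule nhd_zero_strictI[OF p zero_less_one]) simp
  then obtain t where t: "t > 0" "B \<subseteq> (\<lambda>x. complex_of_real t *\<^sub>C x) ` {x. mult_seminorm p (x * embed a) < 1}"
    using B unfolding tvs_bounded_def by blast
  have bound: "mult_seminorm p (y * embed a) \<le> t" if y: "y \<in> B" for y
  proof -
    obtain w where "y = complex_of_real t *\<^sub>C w" "mult_seminorm p (w * embed a) < 1"
      using subsetD[OF t(2) y] by blast
    then show ?thesis
      using t(1) by (simp add: mult_scaleC_left cseminorm_scale[OF cseminorm_mult_seminorm[OF p]])
  qed
  \<comment> \<open>The weight 2^-n reduces 32^n / 2 only to 16^n / 2, which \<open>a\<close> would
    have to keep below 2 t.\<close>
  have "2 ^ n \<le> 4 * t" for n
  proof -
    have "x n * embed (z n) = embed (complex_of_real ((1 / 2) ^ n) *\<^sub>C lact (x n) (e (i n)))"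
      by (simp add: z_def embed_scaleC embed_lact mult_scaleC_right)
    then have "mult_seminorm p (x n * embed (z n)) = (1 / 2) ^ n * p (lact (x n) (e (i n)))"
      by (simp only: mult_seminorm_embed[OF p] cseminorm_scale[OF cseminorm_cstar[OF p]])
        (simp add: norm_power norm_divide)
    then have "(1 / 2) ^ n * p (lact (x n) (e (i n))) \<le> 2 * t"
      using a[of "x n" n] bound[OF x(1)[of n]] by linarith
    moreover have "(1 / 2) ^ n * (32 ^ n / 2) \<le> (1 / 2) ^ n * p (lact (x n) (e (i n)))"
      using i[of n] x(2)[of n] by (intro mult_left_mono) auto
    moreover have "(1 / 2) ^ n * (32 ^ n / 2) = (16 :: real) ^ n / 2"
      by (simp flip: power_mult_distrib)
    moreover have "(2 :: real) ^ n \<le> 16 ^ n" by (rule power_mono) auto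
    ultimately show ?thesis by linarith
  qed
  moreover obtain n where "4 * t < 2 ^ n" using real_arch_pow[of 2 "4 * t"] by auto
  ultimately show False by (meson not_le)
qed

lemma gauges_pos: "\<gamma> \<in> gauges \<Longrightarrow> p \<in> cstar_seminorms \<Longrightarrow> \<gamma> p > 0"
  by (auto simp: gauges_def PiE_def Pi_def)

lemma restrict_gauges: "(\<And>p. p \<in> cstar_seminorms \<Longrightarrow> \<gamma> p > 0) \<Longrightarrow> restrict \<gamma> cstar_seminorms \<in> gauges"
  by (auto simp: gauges_def)

lemma gauge_ball_inverse_scaleI:
  fixes x :: "'a::pro_cstar_algebra multiplier"
  assumes t: "t > 0" and x: "\<And>q. q \<in> cstar_seminorms \<Longrightarrow> mult_seminorm q x \<le> t * \<gamma> q"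
  shows "complex_of_real (1 / t) *\<^sub>C x \<in> gauge_ball \<gamma>"
  unfolding gauge_ball_def mem_Collect_eq
proof
  fix q :: "'a \<Rightarrow> real" assume q: "q \<in> cstar_seminorms"
  show "mult_seminorm q (complex_of_real (1 / t) *\<^sub>C x) \<le> \<gamma> q"
    unfolding cseminorm_scale_inverse[OF cseminorm_mult_seminorm[OF q] t]
    using x[OF q] t by (simp add: pos_divide_le_eq mult.commute)
qed

text \<open>A gauge encodes boundedness in each seminorm separately; thus gauge balls are cofinal
  among \<beta>-bounded sets and can stand for them.\<close>

lemma strictly_bounded_imp_gauge_ball:
  fixes e :: "'l::preorder \<Rightarrow> 'a::pro_cstar_algebra"
  assumes e: "approximate_unit e" and B: "tvs_bounded strict_topology B"
  obtains \<gamma> where "\<gamma> \<in> gauges" "B \<subseteq> (gauge_ball \<gamma> :: 'a multiplier set)"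
proof -
  have "\<forall>p\<in>cstar_seminorms. \<exists>K. \<forall>x\<in>B. mult_seminorm p x \<le> K"
    using strictly_bounded_imp_bounded[OF e B] by blast
  then obtain K where K: "\<And>p x. p \<in> cstar_seminorms \<Longrightarrow> x \<in> B \<Longrightarrow> mult_seminorm p x \<le> K p" by metis
  define \<gamma> where "\<gamma> = (\<lambda>p\<in>cstar_seminorms. \<bar>K p\<bar> + 1)"
  have "\<gamma> \<in> gauges" unfolding \<gamma>_def by (rule restrict_gauges) simp
  moreover have "B \<subseteq> gauge_ball \<gamma>"
    using K by (fastforce simp: gauge_ball_def \<gamma>_def)
  ultimately show ?thesis using that by blast
qed

section \<open>Polars and the topology \<open>\<beta>\<^sub>b\<close>\<close>

lemma linear_complex_iff:
  fixes f :: "'v::complex_vector \<Rightarrow> complex"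
  shows "Vector_Spaces.linear scaleC (*) f \<longleftrightarrow>
    (\<forall>x y. f (x + y) = f x + f y) \<and> (\<forall>c x. f (c *\<^sub>C x) = c * f x)"
proof -
  have "vector_space (scaleC :: complex \<Rightarrow> 'v \<Rightarrow> 'v)"
    by unfold_locales (simp_all add: scaleC_add_right scaleC_add_left scaleC_scaleC scaleC_one)
  moreover have "vector_space ((*) :: complex \<Rightarrow> complex \<Rightarrow> complex)"
    by unfold_locales (simp_all add: algebra_simps)
  ultimately show ?thesis by (simp add: Vector_Spaces.linear_iff)
qed

lemma continuous_dualD:
  assumes "f \<in> continuous_dual \<sigma>"
  shows "f (x + y) = f x + f y" "f (c *\<^sub>C x) = c * f x" "f (x - y) = f x - f y" "f 0 = 0"
proof -
  show add: "f (x + y) = f x + f y" and scale: "f (c *\<^sub>C x) = c * f x" for x y c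
    using assms by (auto simp: continuous_dual_def linear_complex_iff)
  show "f (x - y) = f x - f y" using add[of "x - y" y] by simp
  show "f 0 = 0" using add[of 0 0] by simp
qed

lemma cseminorm_continuous_dual: "f \<in> continuous_dual \<sigma> \<Longrightarrow> cseminorm (\<lambda>x. cmod (f x))"
  by (auto simp: cseminorm_def continuous_dualD norm_mult intro: norm_triangle_ineq)

lemma openin_continuous_dual:
  assumes "f \<in> continuous_dual \<sigma>" "topspace \<sigma> = UNIV"
  shows "openin \<sigma> {x. cmod (f x) < \<epsilon>}"
proof -
  have "openin \<sigma> {x \<in> topspace \<sigma>. f x \<in> ball 0 \<epsilon>}"
    using assms(1) by (intro openin_continuous_map_preimage[of _ euclidean]) (auto simp: continuous_dual_def)
  then show ?thesis by (simp add: assms(2))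
qed

lemma topspace_locally_convex: "locally_convex \<sigma> \<Longrightarrow> topspace \<sigma> = UNIV"
  by (auto simp: locally_convex_def)

context
begin

private lemma bdd_top_strict: "is_finest_agreeing strict_topology
    (bdd_top (strict_topology :: 'a::pro_cstar_algebra multiplier topology))"
  by (rule is_finest_agreeing_bdd_top[OF locally_convex_strict_topology])

lemma locally_convex_bdd_top_strict: "locally_convex (bdd_top (strict_topology :: 'a::pro_cstar_algebra multiplier topology))"
  and agree_bdd_top_strict: "agree_on_bounded strict_topology (bdd_top (strict_topology :: 'a multiplier topology))"
  and finest_bdd_top_strict: "locally_convex T \<Longrightarrow> agree_on_bounded strict_topology T \<Longrightarrow> openin T U \<Longrightarrow>
    openin (bdd_top (strict_topology :: 'a multiplier topology)) U"
  using bdd_top_strict unfolding is_finest_agreeing_def by blast+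

end

text \<open>The practical access to \<beta>_b: gauge balls are bounded, so both topologies have the
  same traces on them.\<close>

lemma bdd_top_strict_nhd:
  fixes U :: "'a::pro_cstar_algebra multiplier set"
  assumes "openin (bdd_top strict_topology) U" "0 \<in> U" "\<gamma> \<in> gauges"
  obtains V where "nhd_zero strict_topology V" "V \<inter> gauge_ball \<gamma> \<subseteq> U"
proof -
  have "openin (subtopology (bdd_top strict_topology) (gauge_ball \<gamma>)) (U \<inter> gauge_ball \<gamma>)"
    using assms(1) by (auto simp: openin_subtopology)
  moreover have "subtopology (bdd_top strict_topology) (gauge_ball \<gamma>)
      = subtopology strict_topology (gauge_ball \<gamma> :: 'a multiplier set)"
    using agree_bdd_top_strict tvs_bounded_gauge_ball unfolding agree_on_bounded_def by blast
  ultimately have "openin (subtopology strict_topology (gauge_ball \<gamma>)) (U \<inter> gauge_ball \<gamma>)"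
    by simp
  then obtain V where V: "openin strict_topology V" "U \<inter> gauge_ball \<gamma> = V \<inter> gauge_ball \<gamma>"
    by (auto simp: openin_subtopology)
  have "0 \<in> gauge_ball \<gamma>"
    using assms(3) gauges_pos by (auto simp: gauge_ball_def cseminorm_zero[OF cseminorm_mult_seminorm] intro: less_imp_le)
  then have "0 \<in> V" using V(2) assms(2) by blast
  then have "nhd_zero strict_topology V" using V(1) by (auto simp: nhd_zero_def)
  then show ?thesis using that V(2) by blast
qed

lemma gauges_nonempty: "gauges \<noteq> ({} :: (('a::topological_star_algebra \<Rightarrow> real) \<Rightarrow> real) set)"
  using restrict_gauges[of "\<lambda>_. 1"] by fastforce

text \<open>The set where |f| \<le> 1 is absolutely convex, so a bound on the pieces passes to the
  hull.\<close>

lemma polar_W_hull: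
  "polar (W_hull \<nu>) = (\<Inter>\<gamma>\<in>gauges. polar (gauge_ball \<gamma> \<inter> \<nu> \<gamma>))"
proof (intro equalityI subsetI)
  fix f assume f: "f \<in> polar (W_hull \<nu>)"
  have "gauge_ball \<gamma> \<inter> \<nu> \<gamma> \<subseteq> W_hull \<nu>" if "\<gamma> \<in> gauges" for \<gamma>
    unfolding W_hull_def using that by (intro order_trans[OF _ hull_subset]) blast
  then show "f \<in> (\<Inter>\<gamma>\<in>gauges. polar (gauge_ball \<gamma> \<inter> \<nu> \<gamma>))"
    using f by (auto simp: polar_def)
next
  fix f assume f: "f \<in> (\<Inter>\<gamma>\<in>gauges. polar (gauge_ball \<gamma> \<inter> \<nu> \<gamma>))"
  \<comment> \<open>Continuity is read off from one polar of the family, so there must be at least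
    one gauge.\<close>
  then have dual: "f \<in> continuous_dual (bdd_top strict_topology)"
    using gauges_nonempty by (auto simp: polar_def)
  note lin = continuous_dualD[OF dual]
  have "absolutely_convex {x. cmod (f x) \<le> 1}"
    unfolding absolutely_convex_def mem_Collect_eq
  proof (intro ballI allI impI)
    fix x y c d assume xy: "x \<in> {x. cmod (f x) \<le> 1}" "y \<in> {x. cmod (f x) \<le> 1}" and cd: "cmod c + cmod d \<le> 1"
    have "cmod (f (c *\<^sub>C x + d *\<^sub>C y)) \<le> cmod c * cmod (f x) + cmod d * cmod (f y)"
      by (simp add: lin) (metis norm_mult norm_triangle_ineq)
    also have "\<dots> \<le> cmod c * 1 + cmod d * 1"
      using xy by (intro add_mono mult_left_mono) auto
    finally show "cmod (f (c *\<^sub>C x + d *\<^sub>C y)) \<le> 1" using cd by simp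
  qed
  moreover have "(\<Union>\<gamma>\<in>gauges. gauge_ball \<gamma> \<inter> \<nu> \<gamma>) \<subseteq> {x. cmod (f x) \<le> 1}"
    using f by (auto simp: polar_def)
  ultimately have "W_hull \<nu> \<subseteq> {x. cmod (f x) \<le> 1}"
    unfolding W_hull_def by (intro hull_minimal)
  then show "f \<in> polar (W_hull \<nu>)" using dual by (auto simp: polar_def)
qed

section \<open>Estimates for the functionals in the polar\<close>

lemma polar_W_hullD:
  assumes "f \<in> polar (W_hull \<nu>)"
  shows "f \<in> continuous_dual (bdd_top strict_topology)"
    "\<gamma> \<in> gauges \<Longrightarrow> x \<in> gauge_ball \<gamma> \<Longrightarrow> x \<in> \<nu> \<gamma> \<Longrightarrow> cmod (f x) \<le> 1"
  using assms polar_W_hull[of \<nu>] unfolding polar_def by blast+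

text \<open>With \<open>T = T' = 1\<close> this is the convergence in (1).\<close>

lemma polar_two_sided_small:
  fixes e :: "'l::preorder \<Rightarrow> 'a::pro_cstar_algebra"
  assumes e: "approximate_unit e" and \<nu>: "nhd_assignment \<nu>" and \<gamma>: "\<gamma> \<in> gauges" and \<epsilon>: "\<epsilon> > 0"
  shows "\<forall>\<^sub>F i in net_filter. \<forall>f\<in>polar (W_hull \<nu>). \<forall>x\<in>gauge_ball \<gamma>.
    cmod (f (T * (1 - embed (e i)) * x * (1 - embed (e i)) * T')) \<le> \<epsilon>"
proof -
  \<comment> \<open>Two complements, each of seminorm at most 2, give the 4; dividing by \<epsilon>
    lets the sandwiched element scaled by 1/\<epsilon> be tested against the polar; the 1 keeps the
    gauge positive.\<close>
  define \<gamma>' where "\<gamma>' = (\<lambda>q\<in>cstar_seminorms. (mult_seminorm q T * 4 * \<gamma> q * mult_seminorm q T' + 1) / \<epsilon>)"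
  have \<gamma>': "\<gamma>' \<in> gauges"
    unfolding \<gamma>'_def using \<epsilon> gauges_pos[OF \<gamma>]
    by (intro restrict_gauges divide_pos_pos add_nonneg_pos mult_nonneg_nonneg)
      (auto simp: mult_seminorm_nonneg less_imp_le)
  then have "nhd_zero strict_topology (\<nu> \<gamma>')" using \<nu> by (simp add: nhd_assignment_def)
  then obtain p F \<delta> where p: "p \<in> cstar_seminorms" and F: "finite F" and \<delta>: "\<delta> > 0"
    and V: "\<And>x. (\<And>a. a \<in> F \<Longrightarrow> mult_seminorm p (x * embed a) < \<delta>) \<Longrightarrow>
      (\<And>a. a \<in> F \<Longrightarrow> mult_seminorm p (embed a * x) < \<delta>) \<Longrightarrow> x \<in> \<nu> \<gamma>'"
    using nhd_zero_strictE by blast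
  have one_minus: "mult_seminorm q (1 - embed (e i)) \<le> 2" if q: "q \<in> cstar_seminorms" for q :: "'a \<Rightarrow> real" and i
    using cseminorm_diff[OF cseminorm_mult_seminorm[OF q], of 1 "embed (e i)"] mult_seminorm_one[OF q]
      approximate_unit_le_one[OF e q, of i] by (simp add: mult_seminorm_embed[OF q])
  define K where "K = mult_seminorm p T * 2 * \<gamma> p"
  define K' where "K' = \<gamma> p * 2 * mult_seminorm p T'"
  have KK: "0 \<le> K" "0 \<le> K'"
    using gauges_pos[OF \<gamma> p] by (auto simp: K_def K'_def mult_seminorm_nonneg[OF p] less_imp_le)
  have lim: "((\<lambda>i. K * p (e i * lact T' a - lact T' a)) \<longlongrightarrow> K * 0) net_filter"
    "((\<lambda>i. p (ract a T * e i - ract a T) * K') \<longlongrightarrow> 0 * K') net_filter" for a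
    by (intro tendsto_intros approximate_unit_tendsto[OF e p])+
  have "\<forall>\<^sub>F i in net_filter. K * p (e i * lact T' a - lact T' a) < \<epsilon> * \<delta> \<and> p (ract a T * e i - ract a T) * K' < \<epsilon> * \<delta>" for a
    using lim[of a] \<epsilon> \<delta> by (intro eventually_conj order_tendstoD(2)) auto
  then have "\<forall>\<^sub>F i in net_filter. \<forall>a\<in>F. K * p (e i * lact T' a - lact T' a) < \<epsilon> * \<delta> \<and>
      p (ract a T * e i - ract a T) * K' < \<epsilon> * \<delta>"
    using F by (simp add: eventually_ball_finite)
  then show ?thesis
  proof (rule eventually_mono, intro ballI)
    fix i f x
    assume small: "\<forall>a\<in>F. K * p (e i * lact T' a - lact T' a) < \<epsilon> * \<delta> \<and> p (ract a T * e i - ract a T) * K' < \<epsilon> * \<delta>"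
      and f: "f \<in> polar (W_hull \<nu>)" and x: "x \<in> gauge_ball \<gamma>"
    let ?d = "1 - embed (e i)"
    let ?w = "T * ?d * x * ?d * T'"
    let ?y = "complex_of_real (1 / \<epsilon>) *\<^sub>C ?w"
    have Px: "mult_seminorm q x \<le> \<gamma> q" if "q \<in> cstar_seminorms" for q using x that by (simp add: gauge_ball_def)
    note scale = cseminorm_scale_inverse[OF cseminorm_mult_seminorm \<epsilon>]
    have mult: "mult_seminorm q (u * v) \<le> k * l" if "q \<in> cstar_seminorms" "mult_seminorm q u \<le> k" "mult_seminorm q v \<le> l"
      for q :: "'a \<Rightarrow> real" and u v k l
      using mult_seminorm_nonneg[OF that(1)] that
      by (intro order_trans[OF mult_seminorm_mult[OF that(1)]] mult_mono) (auto intro: order_trans)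
    have "?y \<in> gauge_ball \<gamma>'"
    proof (rule gauge_ball_inverse_scaleI[OF \<epsilon>])
      fix q :: "'a \<Rightarrow> real" assume q: "q \<in> cstar_seminorms"
      have "mult_seminorm q ?w \<le> mult_seminorm q T * 2 * \<gamma> q * 2 * mult_seminorm q T'"
        by (intro mult[OF q] one_minus[OF q] Px[OF q] order_refl)
      then show "mult_seminorm q ?w \<le> \<epsilon> * \<gamma>' q"
        using q \<epsilon> by (simp add: \<gamma>'_def)
    qed
    moreover have "?y \<in> \<nu> \<gamma>'"
    proof (rule V)
      fix a assume a: "a \<in> F"
      \<comment> \<open>Next to a test element the complement acts on the fixed element
        \<open>lact T' a\<close> of A, so the smallness does not depend on \<open>x\<close>; on the
        left the other complement plays this role.\<close>
      have "?d * T' * embed a = embed (lact T' a - e i * lact T' a)"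
        by (simp add: embed_diff embed_mult embed_lact algebra_simps)
      then have "mult_seminorm p (?d * T' * embed a) \<le> p (e i * lact T' a - lact T' a)"
        by (simp add: mult_seminorm_embed[OF p] cseminorm_diff_commute[OF cseminorm_cstar[OF p]])
      then have "mult_seminorm p (T * ?d * x * (?d * T' * embed a)) \<le> K * p (e i * lact T' a - lact T' a)"
        unfolding K_def by (intro mult[OF p] one_minus[OF p] Px[OF p] order_refl)
      also have "\<dots> < \<epsilon> * \<delta>" using small a by blast
      finally show "mult_seminorm p (?y * embed a) < \<delta>"
        using \<epsilon> by (simp only: mult_scaleC_left scale[OF p]) (simp add: mult.assoc divide_simps mult.commute)
      have "embed a * T * ?d = embed (ract a T - ract a T * e i)"
        by (simp add: embed_diff embed_mult embed_ract algebra_simps)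
      then have left: "mult_seminorm p (embed a * T * ?d) \<le> p (ract a T * e i - ract a T)"
        by (simp add: mult_seminorm_embed[OF p] cseminorm_diff_commute[OF cseminorm_cstar[OF p]])
      have "mult_seminorm p (embed a * T * ?d * (x * ?d * T')) \<le> p (ract a T * e i - ract a T) * K'"
        unfolding K'_def by (intro mult[OF p] left one_minus[OF p] Px[OF p] order_refl)
      also have "\<dots> < \<epsilon> * \<delta>" using small a by blast
      finally show "mult_seminorm p (embed a * ?y) < \<delta>"
        using \<epsilon> by (simp only: mult_scaleC_right scale[OF p]) (simp add: mult.assoc divide_simps mult.commute)
    qed
    ultimately have "cmod (f ?y) \<le> 1" by (rule polar_W_hullD(2)[OF f \<gamma>'])
    then show "cmod (f ?w) \<le> \<epsilon>"
      using \<epsilon> unfolding cseminorm_scale_inverse[OF cseminorm_continuous_dual[OF polar_W_hullD(1)[OF f]] \<epsilon>] by simp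
  qed
qed

text \<open>The constant gauge 1 is enough: its \<beta>-neighbourhood absorbs the gauge ball up to
  the factor \<open>c + 1\<close>. The bound concerns elements with all seminorms below
  \<open>K\<close>, which bounded lifts will provide.\<close>

lemma polar_W_hull_bounded:
  fixes \<nu> :: "(('a::pro_cstar_algebra \<Rightarrow> real) \<Rightarrow> real) \<Rightarrow> 'a multiplier set"
  assumes \<nu>: "nhd_assignment \<nu>"
  obtains C where "C \<ge> 0"
    "\<And>f x K. f \<in> polar (W_hull \<nu>) \<Longrightarrow> 0 \<le> K \<Longrightarrow> (\<And>q. q \<in> cstar_seminorms \<Longrightarrow> mult_seminorm q x \<le> K) \<Longrightarrow>
      cmod (f x) \<le> C * K"
proof -
  define \<gamma> where "\<gamma> = (\<lambda>q\<in>(cstar_seminorms :: ('a \<Rightarrow> real) set). 1 :: real)"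
  have \<gamma>: "\<gamma> \<in> gauges" unfolding \<gamma>_def by (rule restrict_gauges) simp
  then have "nhd_zero strict_topology (\<nu> \<gamma>)" using \<nu> by (simp add: nhd_assignment_def)
  then obtain s p c where s: "cseminorm s" and p: "p \<in> cstar_seminorms" and c: "0 \<le> c"
    and le: "\<And>x. s x \<le> c * mult_seminorm p x" and V: "\<And>x. s x < 1 \<Longrightarrow> x \<in> \<nu> \<gamma>"
    using nhd_zero_strict_seminormE by blast
  note dual = cseminorm_continuous_dual[OF polar_W_hullD(1)]
  have t: "c + 1 > 0" using c by simp
  have ball: "cmod (f x) \<le> c + 1" if f: "f \<in> polar (W_hull \<nu>)"
    and x: "\<And>q. q \<in> cstar_seminorms \<Longrightarrow> mult_seminorm q x \<le> 1" for f x
  proof -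
    let ?y = "complex_of_real (1 / (c + 1)) *\<^sub>C x"
    have "?y \<in> gauge_ball \<gamma>"
    proof (rule gauge_ball_inverse_scaleI[OF t])
      show "mult_seminorm q x \<le> (c + 1) * \<gamma> q" if "q \<in> cstar_seminorms" for q
        using x[OF that] c that by (simp add: \<gamma>_def)
    qed
    moreover have "s x \<le> c" using le[of x] mult_left_mono[OF x[OF p] c] by simp
    then have "?y \<in> \<nu> \<gamma>" using c by (intro V) (simp only: cseminorm_scale_inverse[OF s t], simp)
    ultimately have "cmod (f ?y) \<le> 1" by (rule polar_W_hullD(2)[OF f \<gamma>])
    then show ?thesis using t unfolding cseminorm_scale_inverse[OF dual[OF f] t] by simp
  qed
  have "cmod (f x) \<le> (c + 1) * K" if f: "f \<in> polar (W_hull \<nu>)" and K: "0 \<le> K"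
    and x: "\<And>q. q \<in> cstar_seminorms \<Longrightarrow> mult_seminorm q x \<le> K" for f x K
  proof (cases "K = 0")
    case True
    have "mult_seminorm q (x - 0) = 0" if "q \<in> cstar_seminorms" for q
      using x[OF that] mult_seminorm_nonneg[OF that, of x] True by simp
    then have "x = 0" by (rule multiplier_eqI_seminorm)
    then show ?thesis using True continuous_dualD(4)[OF polar_W_hullD(1)[OF f]] by simp
  next
    case False
    then have K: "K > 0" using K by simp
    have "cmod (f (complex_of_real (1 / K) *\<^sub>C x)) \<le> c + 1"
      using x K by (intro ball[OF f]) (simp only: cseminorm_scale_inverse[OF cseminorm_mult_seminorm K], simp)
    then show ?thesis using K unfolding cseminorm_scale_inverse[OF dual[OF f] K] by (simp add: pos_divide_le_eq)
  qed
  then show ?thesis using that[of "c + 1"] c by simp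
qed

text \<open>On a gauge ball \<beta>_b coincides with \<beta>, so strict convergence to 0 is all that
  \<open>f\<close> needs.\<close>

lemma tendsto_bdd_top_dual:
  fixes y :: "'i \<Rightarrow> 'a::pro_cstar_algebra multiplier"
  assumes f: "f \<in> continuous_dual (bdd_top strict_topology)" and \<gamma>: "\<gamma> \<in> gauges"
    and y: "\<And>i. y i \<in> gauge_ball \<gamma>"
    and l: "\<And>p a. p \<in> cstar_seminorms \<Longrightarrow> ((\<lambda>i. mult_seminorm p (y i * embed a)) \<longlongrightarrow> 0) F"
    and r: "\<And>p a. p \<in> cstar_seminorms \<Longrightarrow> ((\<lambda>i. mult_seminorm p (embed a * y i)) \<longlongrightarrow> 0) F"
  shows "((\<lambda>i. f (y i)) \<longlongrightarrow> 0) F"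
proof (rule tendstoI)
  fix \<epsilon> :: real assume "\<epsilon> > 0"
  then have "0 \<in> {x. cmod (f x) < \<epsilon>}" by (simp add: continuous_dualD(4)[OF f])
  then obtain V where V: "nhd_zero strict_topology V" "V \<inter> gauge_ball \<gamma> \<subseteq> {x. cmod (f x) < \<epsilon>}"
    using bdd_top_strict_nhd[OF openin_continuous_dual[OF f topspace_locally_convex[OF locally_convex_bdd_top_strict]] _ \<gamma>]
    by blast
  obtain p A \<delta> where p: "p \<in> cstar_seminorms" and A: "finite A" and \<delta>: "\<delta> > 0"
    and AV: "\<And>x. (\<And>a. a \<in> A \<Longrightarrow> mult_seminorm p (x * embed a) < \<delta>) \<Longrightarrow>
      (\<And>a. a \<in> A \<Longrightarrow> mult_seminorm p (embed a * x) < \<delta>) \<Longrightarrow> x \<in> V"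
    using nhd_zero_strictE[OF V(1)] by blast
  have "\<forall>\<^sub>F i in F. mult_seminorm p (y i * embed a) < \<delta> \<and> mult_seminorm p (embed a * y i) < \<delta>" for a
    using order_tendstoD(2)[OF l[OF p] \<delta>] order_tendstoD(2)[OF r[OF p] \<delta>] by (rule eventually_conj)
  then have "\<forall>\<^sub>F i in F. \<forall>a\<in>A. mult_seminorm p (y i * embed a) < \<delta> \<and> mult_seminorm p (embed a * y i) < \<delta>"
    using A by (simp add: eventually_ball_finite)
  then show "\<forall>\<^sub>F i in F. dist (f (y i)) 0 < \<epsilon>"
  proof (rule eventually_mono)
    fix i assume "\<forall>a\<in>A. mult_seminorm p (y i * embed a) < \<delta> \<and> mult_seminorm p (embed a * y i) < \<delta>"
    then have "y i \<in> V" using AV by blast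
    then show "dist (f (y i)) 0 < \<epsilon>" using V(2) y[of i] by auto
  qed
qed

text \<open>Recovers values of \<open>f\<close> on M(A) from elements of A, since e x e lies in A.
  The net stays in one gauge ball and converges strictly.\<close>

lemma tendsto_sandwich_unit:
  fixes e :: "'l::preorder \<Rightarrow> 'a::pro_cstar_algebra"
  assumes e: "approximate_unit e" and f: "f \<in> continuous_dual (bdd_top strict_topology)"
  shows "((\<lambda>i. f (T * (embed (e i) * x * embed (e i)) * T')) \<longlongrightarrow> f (T * x * T')) net_filter"
proof -
  let ?E = "\<lambda>i. embed (e i)"
  let ?y = "\<lambda>i. T * (?E i * x * ?E i - x) * T'"
  have mult: "mult_seminorm q (u * v) \<le> k * l" if "q \<in> cstar_seminorms" "mult_seminorm q u \<le> k" "mult_seminorm q v \<le> l"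
    for q :: "'a \<Rightarrow> real" and u v k l
    using mult_seminorm_nonneg[OF that(1)] that
    by (intro order_trans[OF mult_seminorm_mult[OF that(1)]] mult_mono) (auto intro: order_trans)
  have E1: "mult_seminorm q (?E i) \<le> 1" if "q \<in> cstar_seminorms" for q i
    using approximate_unit_le_one[OF e that] by (simp add: mult_seminorm_embed[OF that])
  define \<gamma> where "\<gamma> = (\<lambda>q\<in>cstar_seminorms. mult_seminorm q T * (1 * mult_seminorm q x * 1 + mult_seminorm q x) * mult_seminorm q T' + 1)"
  have \<gamma>: "\<gamma> \<in> gauges"
    unfolding \<gamma>_def by (intro restrict_gauges add_nonneg_pos mult_nonneg_nonneg add_nonneg_nonneg)
      (auto simp: mult_seminorm_nonneg)
  have "((\<lambda>i. f (?y i)) \<longlongrightarrow> 0) net_filter"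
  proof (rule tendsto_bdd_top_dual[OF f \<gamma>])
    fix i
    show "?y i \<in> gauge_ball \<gamma>"
      unfolding gauge_ball_def mem_Collect_eq
    proof
      fix q :: "'a \<Rightarrow> real" assume q: "q \<in> cstar_seminorms"
      have "mult_seminorm q (?E i * x * ?E i - x) \<le> 1 * mult_seminorm q x * 1 + mult_seminorm q x"
        by (intro order_trans[OF cseminorm_diff[OF cseminorm_mult_seminorm[OF q]]] add_mono mult[OF q] E1[OF q] order_refl)
      then have "mult_seminorm q (?y i) \<le> mult_seminorm q T * (1 * mult_seminorm q x * 1 + mult_seminorm q x) * mult_seminorm q T'"
        by (intro mult[OF q] order_refl)
      then show "mult_seminorm q (?y i) \<le> \<gamma> q" unfolding \<gamma>_def restrict_apply'[OF q] by simp
    qed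
  next
    fix p :: "'a \<Rightarrow> real" and a assume p: "p \<in> cstar_seminorms"
    let ?b = "lact T' a"
    let ?c = "lact x ?b"
    show "((\<lambda>i. mult_seminorm p (?y i * embed a)) \<longlongrightarrow> 0) net_filter"
    proof (rule Lim_null_comparison[OF always_eventually[OF allI]])
      show "norm (mult_seminorm p (?y i * embed a))
          \<le> mult_seminorm p T * (1 * mult_seminorm p x * p (e i * ?b - ?b) + p (e i * ?c - ?c))" for i
      proof -
        \<comment> \<open>With b = T' a and c = x b, the difference e x e b - c equals e x (e b - b)
          + (e c - c), and both brackets tend to 0.\<close>
        have "?y i * embed a = T * (?E i * x * embed (e i * ?b - ?b) + embed (e i * ?c - ?c))"
          by (simp add: embed_diff embed_mult embed_lact algebra_simps)
        moreover have "mult_seminorm p (T * (?E i * x * embed (e i * ?b - ?b) + embed (e i * ?c - ?c)))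
            \<le> mult_seminorm p T * (1 * mult_seminorm p x * p (e i * ?b - ?b) + p (e i * ?c - ?c))"
          by (intro mult[OF p] order_trans[OF cseminorm_add[OF cseminorm_mult_seminorm[OF p]]] add_mono E1[OF p])
            (simp_all add: mult_seminorm_embed[OF p])
        ultimately show ?thesis by (simp add: mult_seminorm_nonneg[OF p])
      qed
      have "((\<lambda>i. mult_seminorm p T * (1 * mult_seminorm p x * p (e i * ?b - ?b) + p (e i * ?c - ?c)))
          \<longlongrightarrow> mult_seminorm p T * (1 * mult_seminorm p x * 0 + 0)) net_filter"
        by (intro tendsto_intros approximate_unit_tendsto[OF e p])
      then show "((\<lambda>i. mult_seminorm p T * (1 * mult_seminorm p x * p (e i * ?b - ?b) + p (e i * ?c - ?c)))
          \<longlongrightarrow> 0) net_filter" by simp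
    qed
    let ?b = "ract a T"
    let ?c = "ract ?b x"
    show "((\<lambda>i. mult_seminorm p (embed a * ?y i)) \<longlongrightarrow> 0) net_filter"
    proof (rule Lim_null_comparison[OF always_eventually[OF allI]])
      show "norm (mult_seminorm p (embed a * ?y i))
          \<le> (p (?b * e i - ?b) * mult_seminorm p x * 1 + p (?c * e i - ?c)) * mult_seminorm p T'" for i
      proof -
        have "embed a * ?y i = (embed (?b * e i - ?b) * x * ?E i + embed (?c * e i - ?c)) * T'"
          by (simp add: embed_diff embed_mult embed_ract algebra_simps)
        moreover have "mult_seminorm p ((embed (?b * e i - ?b) * x * ?E i + embed (?c * e i - ?c)) * T')
            \<le> (p (?b * e i - ?b) * mult_seminorm p x * 1 + p (?c * e i - ?c)) * mult_seminorm p T'"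
          by (intro mult[OF p] order_trans[OF cseminorm_add[OF cseminorm_mult_seminorm[OF p]]] add_mono E1[OF p])
            (simp_all add: mult_seminorm_embed[OF p])
        ultimately show ?thesis by (simp add: mult_seminorm_nonneg[OF p])
      qed
      have "((\<lambda>i. (p (?b * e i - ?b) * mult_seminorm p x * 1 + p (?c * e i - ?c)) * mult_seminorm p T')
          \<longlongrightarrow> (0 * mult_seminorm p x * 1 + 0) * mult_seminorm p T') net_filter"
        by (intro tendsto_intros approximate_unit_tendsto[OF e p])
      then show "((\<lambda>i. (p (?b * e i - ?b) * mult_seminorm p x * 1 + p (?c * e i - ?c)) * mult_seminorm p T')
          \<longlongrightarrow> 0) net_filter" by simp
    qed
  qed
  moreover have "f (?y i) = f (T * (?E i * x * ?E i) * T') - f (T * x * T')" for i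
    by (simp add: right_diff_distrib left_diff_distrib continuous_dualD(3)[OF f])
  ultimately show ?thesis by (simp add: LIM_zero_iff)
qed

section \<open>Functionals factoring through a quotient\<close>

lemma factors_quotient_zero:
  assumes "f \<in> continuous_dual \<sigma>" "factors_quotient p f" "cstar_seminorm p" "p a = 0"
  shows "f (embed a) = 0"
proof -
  have "coset p a = coset p 0" using assms(3,4) by (simp add: coset_eq)
  then have "f (embed a) = f (embed 0)" using assms(2) unfolding factors_quotient_def by metis
  then show ?thesis using continuous_dualD(4)[OF assms(1)] by simp
qed

text \<open>The bounded lifts reduce estimates in terms of \<open>p\<close> alone to estimates on gauge balls.\<close>

lemma factors_quotient_bound:
  fixes e :: "'l::preorder \<Rightarrow> 'a::pro_cstar_algebra" and p :: "'a \<Rightarrow> real"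
  assumes e: "approximate_unit e" and f: "f \<in> continuous_dual (bdd_top strict_topology)"
    and p: "p \<in> cstar_seminorms" and fac: "factors_quotient p f" and \<epsilon>: "0 \<le> \<epsilon>"
    and bound: "\<And>b. (\<And>q. q \<in> cstar_seminorms \<Longrightarrow> q b \<le> 32) \<Longrightarrow> cmod (f (T * embed b * T')) \<le> \<epsilon>"
  shows "cmod (f (T * y * T')) \<le> \<epsilon> * mult_seminorm p y"
proof -
  note lin = continuous_dualD[OF f]
  have *: "cmod (f (T * (embed (e i) * y * embed (e i)) * T')) \<le> \<epsilon> * mult_seminorm p y" for i
  proof -
    define K where "K = mult_seminorm p y"
    define c where "c = e i * lact y (e i)"
    have c_eq: "embed (e i) * y * embed (e i) = embed c" by (simp add: c_def embed_mult embed_lact mult.assoc)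
    have "p c \<le> p (e i) * (K * p (e i))"
      unfolding c_def K_def
      by (rule order_trans[OF sn_mult[OF cstar_seminormsD[OF p]]])
        (intro mult_left_mono lact_le p cseminorm_nonneg[OF cseminorm_cstar[OF p]])
    also have "\<dots> \<le> 1 * (K * 1)"
      using approximate_unit_le_one[OF e p, of i] mult_seminorm_nonneg[OF p, of y]
        cseminorm_nonneg[OF cseminorm_cstar[OF p], of "e i"] by (intro mult_mono) (auto simp: K_def)
    finally have pc: "p c \<le> K" by simp
    \<comment> \<open>The lift \<open>b\<close> agrees with \<open>c\<close> modulo ker p, so
      \<open>f\<close> cannot tell them apart, but all seminorms of \<open>b\<close> are at most
      \<open>32 * K\<close>.\<close>
    obtain b where b: "p (c - b) = 0" "\<And>q. q \<in> cstar_seminorms \<Longrightarrow> q b \<le> 32 * p c"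
      using bounded_lift[OF p, of c] by metis
    have "T * embed (c - b) * T' = embed (ract (lact T (c - b)) T')" by (simp add: embed_lact embed_ract)
    moreover have "p (ract (lact T (c - b)) T') = 0"
    proof -
      have "mult_seminorm p (T * embed (c - b) * T') \<le> mult_seminorm p T * 0 * mult_seminorm p T'"
        using mult_seminorm_mult[OF p, of "T * embed (c - b)" T']
          mult_right_mono[OF mult_seminorm_mult[OF p, of T "embed (c - b)"] mult_seminorm_nonneg[OF p, of T']]
        unfolding mult_seminorm_embed[OF p] b(1) by linarith
      then show ?thesis
        using cseminorm_nonneg[OF cseminorm_cstar[OF p], of "ract (lact T (c - b)) T'"]
          mult_seminorm_embed[OF p, of "ract (lact T (c - b)) T'"] by (simp add: embed_lact embed_ract)
    qed
    ultimately have "f (T * embed (c - b) * T') = 0"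
      using factors_quotient_zero[OF f fac cstar_seminormsD[OF p]] by metis
    then have eq: "f (T * embed c * T') = f (T * embed b * T')"
      by (simp add: embed_diff right_diff_distrib left_diff_distrib lin)
    show ?thesis
    proof (cases "K = 0")
      case True
      have "b = 0"
      proof (rule pro_cstar_eq_zeroI)
        fix q :: "'a \<Rightarrow> real" assume q: "q \<in> cstar_seminorms"
        show "q b = 0"
          using b(2)[OF q] pc True cseminorm_nonneg[OF cseminorm_cstar[OF q], of b] by linarith
      qed
      then show ?thesis unfolding c_eq eq using lin \<epsilon> mult_seminorm_nonneg[OF p, of y] by simp
    next
      case False
      then have K: "K > 0" using mult_seminorm_nonneg[OF p, of y] by (simp add: K_def)
      have "cmod (f (T * embed (complex_of_real (1 / K) *\<^sub>C b) * T')) \<le> \<epsilon>"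
      proof (rule bound)
        fix q :: "'a \<Rightarrow> real" assume q: "q \<in> cstar_seminorms"
        show "q (complex_of_real (1 / K) *\<^sub>C b) \<le> 32"
          unfolding cseminorm_scale_inverse[OF cseminorm_cstar[OF q] K]
          using b(2)[OF q] pc K by (simp only: pos_divide_le_eq)
      qed
      moreover have "f (T * embed (complex_of_real (1 / K) *\<^sub>C b) * T') = complex_of_real (1 / K) * f (T * embed b * T')"
        by (simp only: embed_scaleC mult_scaleC_left mult_scaleC_right lin)
      ultimately have "cmod (complex_of_real (1 / K) * f (T * embed b * T')) \<le> \<epsilon>" by (simp only:)
      then show ?thesis
        unfolding c_eq eq K_def[symmetric] using K by (simp add: norm_mult norm_divide divide_simps)
    qed
  qed
  have "((\<lambda>i. cmod (f (T * (embed (e i) * y * embed (e i)) * T'))) \<longlongrightarrow> cmod (f (T * y * T'))) net_filter"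
    by (intro tendsto_norm tendsto_sandwich_unit[OF e f])
  then show ?thesis
    using * by (intro tendsto_upperbound[OF _ always_eventually net_filter_nonbot[OF e]]) auto
qed

text \<open>Lifting costs the factor 32 and turns a bound that refers to all seminorms into one that
  refers to \<open>p\<close> alone.\<close>

lemma polar_factors_bound:
  fixes e :: "'l::preorder \<Rightarrow> 'a::pro_cstar_algebra" and p :: "'a \<Rightarrow> real"
  assumes e: "approximate_unit e" and \<nu>: "nhd_assignment \<nu>" and p: "p \<in> cstar_seminorms"
    and fac: "\<forall>f\<in>polar (W_hull \<nu>). factors_quotient p f"
  obtains C where "C \<ge> 0" "\<And>f x. f \<in> polar (W_hull \<nu>) \<Longrightarrow> cmod (f x) \<le> C * mult_seminorm p x"
proof -
  obtain C where C: "C \<ge> 0"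
    "\<And>f x K. f \<in> polar (W_hull \<nu>) \<Longrightarrow> 0 \<le> K \<Longrightarrow> (\<And>q. q \<in> cstar_seminorms \<Longrightarrow> mult_seminorm q x \<le> K) \<Longrightarrow>
      cmod (f x) \<le> C * K"
    using polar_W_hull_bounded[OF \<nu>] by blast
  have "cmod (f x) \<le> (C * 32) * mult_seminorm p x" if f: "f \<in> polar (W_hull \<nu>)" for f x
  proof -
    have "cmod (f (1 * x * 1)) \<le> (C * 32) * mult_seminorm p x"
    proof (rule factors_quotient_bound[OF e polar_W_hullD(1)[OF f] p])
      show "factors_quotient p f" using fac f by blast
      show "cmod (f (1 * embed b * 1)) \<le> C * 32" if "\<And>q. q \<in> cstar_seminorms \<Longrightarrow> q b \<le> 32" for b
        using that by (intro C(2)[OF f]) (simp_all add: mult_seminorm_embed)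
    qed (use C(1) in simp)
    then show ?thesis by simp
  qed
  then show ?thesis using that[of "C * 32"] C(1) by simp
qed

text \<open>The uniform limit is used only on the gauge ball of constant radius 32; lifts and
  homogeneity carry the estimate to all of M(A), so one index serves every \<open>y\<close>.\<close>

lemma polar_factors_two_sided:
  fixes e :: "'l::preorder \<Rightarrow> 'a::pro_cstar_algebra" and p :: "'a \<Rightarrow> real"
  assumes e: "approximate_unit e" and \<nu>: "nhd_assignment \<nu>" and p: "p \<in> cstar_seminorms"
    and fac: "\<forall>f\<in>polar (W_hull \<nu>). factors_quotient p f" and \<epsilon>: "\<epsilon> > 0"
  shows "\<exists>i. \<forall>f\<in>polar (W_hull \<nu>). \<forall>y.
    cmod (f (T * (1 - embed (e i)) * y * ((1 - embed (e i)) * T'))) \<le> \<epsilon> * mult_seminorm p y"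
proof -
  define \<gamma> where "\<gamma> = (\<lambda>q\<in>(cstar_seminorms :: ('a \<Rightarrow> real) set). 32 :: real)"
  have \<gamma>: "\<gamma> \<in> gauges" unfolding \<gamma>_def by (rule restrict_gauges) simp
  obtain i where i: "\<And>f x. f \<in> polar (W_hull \<nu>) \<Longrightarrow> x \<in> gauge_ball \<gamma> \<Longrightarrow>
      cmod (f (T * (1 - embed (e i)) * x * (1 - embed (e i)) * T')) \<le> \<epsilon>"
    using eventually_happens'[OF net_filter_nonbot[OF e] polar_two_sided_small[OF e \<nu> \<gamma> \<epsilon>]] by blast
  have "cmod (f (T * (1 - embed (e i)) * y * ((1 - embed (e i)) * T'))) \<le> \<epsilon> * mult_seminorm p y"
    if f: "f \<in> polar (W_hull \<nu>)" for f y
  proof (rule factors_quotient_bound[OF e polar_W_hullD(1)[OF f] p])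
    show "factors_quotient p f" using fac f by blast
    fix b :: 'a assume "\<And>q. q \<in> cstar_seminorms \<Longrightarrow> q b \<le> 32"
    then have "embed b \<in> gauge_ball \<gamma>" by (simp add: gauge_ball_def \<gamma>_def mult_seminorm_embed)
    from i[OF f this] show "cmod (f (T * (1 - embed (e i)) * embed b * ((1 - embed (e i)) * T'))) \<le> \<epsilon>"
      by (simp add: mult.assoc)
  qed (use \<epsilon> in simp)
  then show ?thesis by blast
qed

text \<open>
  Iterating the decomposition \<open>y = (1 - g) y (1 - g) + (g y + y g - g y g)\<close>, with the remainders
  \<open>f (T\<^sub>n \<cdot> T\<^sub>n')\<close> decaying like \<open>8\<^sup>-\<^sup>n\<close>, bounds \<open>f\<close> by seminorms of \<open>g\<^sub>n y\<close> and \<open>y g\<^sub>n\<close>;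
  all of these are controlled by a single \<open>a\<close> through factorization of \<open>2\<^sup>-\<^sup>n g\<^sub>n\<close>.
\<close>

lemma polar_factors_strict_bound:
  fixes e :: "'l::preorder \<Rightarrow> 'a::pro_cstar_algebra" and p :: "'a \<Rightarrow> real"
  assumes e: "approximate_unit e" and \<nu>: "nhd_assignment \<nu>" and p: "p \<in> cstar_seminorms"
    and fac: "\<forall>f\<in>polar (W_hull \<nu>). factors_quotient p f"
  obtains K a where "K \<ge> 0" "\<And>f x. f \<in> polar (W_hull \<nu>) \<Longrightarrow>
    cmod (f x) \<le> K * (mult_seminorm p (x * embed a) + mult_seminorm p (embed a * x))"
proof -
  note c = cseminorm_mult_seminorm[OF p]
  obtain C where C: "C \<ge> 0" "\<And>f x. f \<in> polar (W_hull \<nu>) \<Longrightarrow> cmod (f x) \<le> C * mult_seminorm p x"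
    using polar_factors_bound[OF e \<nu> p fac] by blast
  define I where "I n T T' = (SOME i. \<forall>f\<in>polar (W_hull \<nu>). \<forall>y.
    cmod (f (T * (1 - embed (e i)) * y * ((1 - embed (e i)) * T'))) \<le> (1 / 8) ^ Suc n * mult_seminorm p y)" for n T T'
  have I: "cmod (f (T * (1 - embed (e (I n T T'))) * y * ((1 - embed (e (I n T T'))) * T'))) \<le> (1 / 8) ^ Suc n * mult_seminorm p y"
    if "f \<in> polar (W_hull \<nu>)" for f n T T' y
    using someI_ex[OF polar_factors_two_sided[OF e \<nu> p fac, of "(1 / 8) ^ Suc n" T T']] that
    unfolding I_def by (simp del: power_Suc)
  \<comment> \<open>New complements are inserted on the inside, next to the element, on both sides.
    Each index depends on the two products already formed, hence a recursion on pairs.\<close>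
  define TT where "TT = rec_nat (1, 1) (\<lambda>n (T, T'). (T * (1 - embed (e (I n T T'))), (1 - embed (e (I n T T'))) * T'))"
  define T where "T n = fst (TT n)" for n
  define T' where "T' n = snd (TT n)" for n
  define g where "g n = e (I n (T n) (T' n))" for n
  have T_0: "T 0 = 1" "T' 0 = 1" by (simp_all add: T_def T'_def TT_def)
  have T_Suc: "T (Suc n) = T n * (1 - embed (g n))" "T' (Suc n) = (1 - embed (g n)) * T' n" for n
    by (simp_all add: T_def T'_def TT_def g_def case_prod_unfold)
  \<comment> \<open>\<open>C + 1\<close> covers both \<open>n = 0\<close>, where only the bound
    \<open>C\<close> is known, and \<open>n > 0\<close>, where the constant is 1.\<close>
  have decay: "cmod (f (T n * y * T' n)) \<le> (C + 1) * (1 / 8) ^ n * mult_seminorm p y"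
    if f: "f \<in> polar (W_hull \<nu>)" for f n y
  proof (cases n)
    case 0
    then show ?thesis using C(2)[OF f, of y] mult_seminorm_nonneg[OF p, of y] by (simp add: T_0 algebra_simps)
  next
    case (Suc m)
    have "cmod (f (T n * y * T' n)) \<le> (1 / 8) ^ n * mult_seminorm p y"
      using I[OF f, of "T m" m "T' m" y] unfolding Suc T_Suc g_def .
    also have "\<dots> \<le> (C + 1) * ((1 / 8) ^ n * mult_seminorm p y)"
      using C(1) mult_seminorm_nonneg[OF p, of y] by (simp add: algebra_simps)
    finally show ?thesis by simp
  qed
  define z where "z n = complex_of_real ((1 / 2) ^ n) *\<^sub>C g n" for n
  have pg: "p (g n) \<le> 1" for n unfolding g_def by (rule approximate_unit_le_one[OF e p])
  have "p (z n) \<le> (1 / 2) ^ n" for n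
  proof -
    have "p (z n) = (1 / 2) ^ n * p (g n)"
      by (simp add: z_def cseminorm_scale[OF cseminorm_cstar[OF p]] norm_power norm_divide)
    also have "\<dots> \<le> (1 / 2) ^ n * 1" by (intro mult_left_mono pg) simp
    finally show ?thesis by simp
  qed
  then obtain a where a: "\<And>x n. mult_seminorm p (x * embed (z n)) \<le> 2 * mult_seminorm p (x * embed a)"
    "\<And>x n. mult_seminorm p (embed (z n) * x) \<le> 2 * mult_seminorm p (embed a * x)"
    using null_sequence_factorization[OF e p] by metis
  have g_bound: "mult_seminorm p (x * embed (g n)) \<le> 2 ^ n * (2 * mult_seminorm p (x * embed a))"
    "mult_seminorm p (embed (g n) * x) \<le> 2 ^ n * (2 * mult_seminorm p (embed a * x))" for x n
  proof -
    have "mult_seminorm p (x * embed (z n)) = (1 / 2) ^ n * mult_seminorm p (x * embed (g n))"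
      "mult_seminorm p (embed (z n) * x) = (1 / 2) ^ n * mult_seminorm p (embed (g n) * x)"
      by (simp_all only: z_def embed_scaleC mult_scaleC_left mult_scaleC_right cseminorm_scale[OF c])
        (simp_all add: norm_power norm_divide)
    moreover have "X \<le> 2 ^ n * (2 * Y)" if "(1 / 2) ^ n * X \<le> 2 * Y" for X Y :: real
      using that by (simp add: power_one_over field_simps)
    ultimately show "mult_seminorm p (x * embed (g n)) \<le> 2 ^ n * (2 * mult_seminorm p (x * embed a))"
      "mult_seminorm p (embed (g n) * x) \<le> 2 ^ n * (2 * mult_seminorm p (embed a * x))"
      using a(1)[of x n] a(2)[of n x] by metis+
  qed
  define s where "s x = mult_seminorm p (x * embed a) + mult_seminorm p (embed a * x)" for x
  have s0: "0 \<le> s x" for x unfolding s_def by (intro add_nonneg_nonneg mult_seminorm_nonneg p)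
  \<comment> \<open>The decay 8^-n outweighs the growth 2^n from undoing the scaling of
    \<open>z n\<close>. The resulting 4^-n is relaxed to 2^-n, whose sum doubles the constant 4 to
    8.\<close>
  have step: "cmod (f (T n * y * T' n)) \<le> cmod (f (T (Suc n) * y * T' (Suc n))) + 4 * (C + 1) * s y * (1 / 2) ^ n"
    if f: "f \<in> polar (W_hull \<nu>)" for f n y
  proof -
    note lin = continuous_dualD[OF polar_W_hullD(1)[OF f]]
    let ?g = "embed (g n)"
    let ?w = "?g * y + y * ?g - ?g * y * ?g"
    have "T n * y * T' n = T (Suc n) * y * T' (Suc n) + T n * ?w * T' n"
      by (simp add: T_Suc algebra_simps)
    then have "f (T n * y * T' n) = f (T (Suc n) * y * T' (Suc n)) + f (T n * ?w * T' n)"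
      by (simp only: lin(1))
    then have "cmod (f (T n * y * T' n)) \<le> cmod (f (T (Suc n) * y * T' (Suc n))) + cmod (f (T n * ?w * T' n))"
      by (simp only: norm_triangle_ineq)
    moreover have "mult_seminorm p ?w \<le> 4 * (2 ^ n * s y)"
    proof -
      have "mult_seminorm p (?g * y * ?g) \<le> p (g n) * mult_seminorm p (y * ?g)"
        using mult_seminorm_mult[OF p, of ?g "y * ?g"] by (simp add: mult_seminorm_embed[OF p] mult.assoc)
      also have "\<dots> \<le> 1 * mult_seminorm p (y * ?g)"
        by (intro mult_right_mono pg mult_seminorm_nonneg p)
      finally have "mult_seminorm p ?w \<le> mult_seminorm p (?g * y) + 2 * mult_seminorm p (y * ?g)"
        using cseminorm_diff[OF c, of "?g * y + y * ?g" "?g * y * ?g"] cseminorm_add[OF c, of "?g * y" "y * ?g"]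
        by linarith
      also have "\<dots> \<le> 2 ^ n * (2 * mult_seminorm p (embed a * y)) + 2 * (2 ^ n * (2 * mult_seminorm p (y * embed a)))"
        using g_bound(1)[of y n] g_bound(2)[of n y] by linarith
      also have "\<dots> \<le> 4 * (2 ^ n * s y)"
        using mult_seminorm_nonneg[OF p, of "embed a * y"] by (simp add: s_def algebra_simps)
      finally show ?thesis .
    qed
    then have "(C + 1) * (1 / 8) ^ n * mult_seminorm p ?w \<le> (C + 1) * (1 / 8) ^ n * (4 * (2 ^ n * s y))"
      using C(1) by (intro mult_left_mono) auto
    then have "cmod (f (T n * ?w * T' n)) \<le> (C + 1) * (1 / 8) ^ n * (4 * (2 ^ n * s y))"
      using decay[OF f, of n ?w] by linarith
    moreover have "(C + 1) * (1 / 8) ^ n * (4 * (2 ^ n * s y)) = 4 * (C + 1) * s y * ((1 / 8) * 2) ^ n"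
      by (simp only: power_mult_distrib mult_ac)
    moreover have "4 * (C + 1) * s y * ((1 / 8) * 2) ^ n \<le> 4 * (C + 1) * s y * (1 / 2) ^ n"
      using C(1) s0[of y] by (intro mult_left_mono power_mono) auto
    ultimately show ?thesis by linarith
  qed
  have "cmod (f y) \<le> 8 * (C + 1) * s y" if f: "f \<in> polar (W_hull \<nu>)" for f y
  proof -
    have "cmod (f y) \<le> cmod (f (T N * y * T' N)) + 8 * (C + 1) * s y * (1 - (1 / 2) ^ N)" for N
    proof (induction N)
      case 0
      then show ?case by (simp add: T_0)
    next
      case (Suc N)
      then show ?case using step[OF f, of N y] by (simp add: algebra_simps)
    qed
    also have "cmod (f (T N * y * T' N)) + 8 * (C + 1) * s y * (1 - (1 / 2) ^ N)
        \<le> (C + 1) * (1 / 8) ^ N * mult_seminorm p y + 8 * (C + 1) * s y * (1 - (1 / 2) ^ N)" for N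
      using decay[OF f, of N y] by simp
    finally have bound: "cmod (f y) \<le> (C + 1) * (1 / 8) ^ N * mult_seminorm p y + 8 * (C + 1) * s y * (1 - (1 / 2) ^ N)" for N .
    have "(\<lambda>N. (C + 1) * (1 / 8) ^ N * mult_seminorm p y + 8 * (C + 1) * s y * (1 - (1 / 2) ^ N))
        \<longlonglongrightarrow> (C + 1) * 0 * mult_seminorm p y + 8 * (C + 1) * s y * (1 - 0)"
      by (intro tendsto_intros LIMSEQ_power_zero) auto
    then have "cmod (f y) \<le> (C + 1) * 0 * mult_seminorm p y + 8 * (C + 1) * s y * (1 - 0)"
      by (rule LIMSEQ_le_const) (use bound in blast)
    then show ?thesis by simp
  qed
  then show ?thesis using that[of "8 * (C + 1)" a] C(1) by (simp add: s_def)
qed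

section \<open>The Hahn--Banach theorem for seminorms\<close>

text \<open>Homogeneity is demanded only as an inequality, which is easy to check for infima;
  equality follows by scaling back. Scalars are real because the extension is first carried out over
  the reals.\<close>

definition sublinear :: "('v::complex_vector \<Rightarrow> real) \<Rightarrow> bool" where
  "sublinear m \<longleftrightarrow> (\<forall>x y. m (x + y) \<le> m x + m y) \<and>
    (\<forall>t\<ge>0. \<forall>x. m (complex_of_real t *\<^sub>C x) \<le> t * m x)"

context
  fixes m :: "'v::complex_vector \<Rightarrow> real"
  assumes m: "sublinear m"
begin

lemma sublinear_add: "m (x + y) \<le> m x + m y"
  and sublinear_scale_le: "0 \<le> t \<Longrightarrow> m (complex_of_real t *\<^sub>C x) \<le> t * m x"
  using m by (auto simp: sublinear_def)

lemma sublinear_zero: "m 0 = 0"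
  using sublinear_scale_le[of 0 0] sublinear_add[of 0 0] by simp

lemma sublinear_minus: "- m (- x) \<le> m x"
  using sublinear_add[of x "- x"] by (simp add: sublinear_zero)

lemma sublinear_scale:
  assumes "0 \<le> t"
  shows "m (complex_of_real t *\<^sub>C x) = t * m x"
proof (cases "t = 0")
  case False
  then have "m x \<le> (1 / t) * m (complex_of_real t *\<^sub>C x)"
    using sublinear_scale_le[of "1 / t" "complex_of_real t *\<^sub>C x"] assms by (simp add: scaleC_scaleC scaleC_one)
  then show ?thesis using sublinear_scale_le[OF assms, of x] assms False by (simp add: field_simps)
qed (simp add: sublinear_zero)

text \<open>The largest sublinear functional below \<open>m\<close> that is linear in direction \<open>y\<close>.\<close>

definition straighten :: "'v \<Rightarrow> 'v \<Rightarrow> real" where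
  "straighten y x = (INF t\<in>{0..}. m (x + complex_of_real t *\<^sub>C y) - t * m y)"

lemma straighten_le:
  assumes "0 \<le> t"
  shows "straighten y x \<le> m (x + complex_of_real t *\<^sub>C y) - t * m y"
  unfolding straighten_def
proof (rule cINF_lower)
  show "bdd_below ((\<lambda>t. m (x + complex_of_real t *\<^sub>C y) - t * m y) ` {0..})"
  proof (rule bdd_belowI2)
    fix t :: real assume "t \<in> {0..}"
    then show "- m (- x) \<le> m (x + complex_of_real t *\<^sub>C y) - t * m y"
      using sublinear_add[of "x + complex_of_real t *\<^sub>C y" "- x"] sublinear_scale[of t y] by simp
  qed
qed (use assms in simp)

lemma straighten_greatest:
  assumes "\<And>t. 0 \<le> t \<Longrightarrow> c \<le> m (x + complex_of_real t *\<^sub>C y) - t * m y"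
  shows "c \<le> straighten y x"
  unfolding straighten_def using assms by (intro cINF_greatest) auto

lemma straighten_le_self: "straighten y x \<le> m x"
  using straighten_le[of 0 y x] by simp

lemma straighten_minus: "straighten y (- y) \<le> - m y"
  using straighten_le[of 1 y "- y"] by (simp add: scaleC_one sublinear_zero)

text \<open>Shifts \<open>s\<close> and \<open>t\<close> for two summands combine to the shift
  \<open>s + t\<close> for their sum; for homogeneity the shift is rescaled with the vector.\<close>

lemma sublinear_straighten: "sublinear (straighten y)"
  unfolding sublinear_def
proof (intro conjI allI impI)
  fix x z
  have "straighten y (x + z) - (m (z + complex_of_real t *\<^sub>C y) - t * m y) \<le> straighten y x" if t: "0 \<le> t" for t
  proof (rule straighten_greatest)
    fix s :: real assume s: "0 \<le> s"
    have "(x + complex_of_real s *\<^sub>C y) + (z + complex_of_real t *\<^sub>C y) = (x + z) + complex_of_real (s + t) *\<^sub>C y"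
      by (simp add: scaleC_add_left add_ac)
    then have "m ((x + z) + complex_of_real (s + t) *\<^sub>C y)
        \<le> m (x + complex_of_real s *\<^sub>C y) + m (z + complex_of_real t *\<^sub>C y)"
      using sublinear_add[of "x + complex_of_real s *\<^sub>C y" "z + complex_of_real t *\<^sub>C y"] by (simp only:)
    moreover have "straighten y (x + z) \<le> m ((x + z) + complex_of_real (s + t) *\<^sub>C y) - (s + t) * m y"
      using s t by (intro straighten_le) simp
    ultimately show "straighten y (x + z) - (m (z + complex_of_real t *\<^sub>C y) - t * m y) \<le> m (x + complex_of_real s *\<^sub>C y) - s * m y"
      unfolding distrib_right by linarith
  qed
  then have "straighten y (x + z) - straighten y x \<le> straighten y z"
    by (intro straighten_greatest) (simp add: algebra_simps)
  then show "straighten y (x + z) \<le> straighten y x + straighten y z" by simp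
next
  fix c :: real and x assume c: "0 \<le> c"
  show "straighten y (complex_of_real c *\<^sub>C x) \<le> c * straighten y x"
  proof (cases "c = 0")
    case True
    then show ?thesis using straighten_le_self[of y 0] by (simp add: sublinear_zero)
  next
    case False
    then have c: "c > 0" using c by simp
    have "straighten y (complex_of_real c *\<^sub>C x) / c \<le> straighten y x"
    proof (rule straighten_greatest)
      fix t :: real assume t: "0 \<le> t"
      have eq: "complex_of_real c *\<^sub>C x + complex_of_real (c * t) *\<^sub>C y = complex_of_real c *\<^sub>C (x + complex_of_real t *\<^sub>C y)"
        by (simp add: scaleC_add_right scaleC_scaleC)
      have "straighten y (complex_of_real c *\<^sub>C x) \<le> c * (m (x + complex_of_real t *\<^sub>C y) - t * m y)"
        using straighten_le[of "c * t" y "complex_of_real c *\<^sub>C x"] c t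
        unfolding eq by (simp add: sublinear_scale right_diff_distrib)
      then show "straighten y (complex_of_real c *\<^sub>C x) / c \<le> m (x + complex_of_real t *\<^sub>C y) - t * m y"
        using c by (simp add: divide_simps mult.commute)
    qed
    then show ?thesis using c by (simp add: divide_simps mult.commute)
  qed
qed

end

text \<open>A minimal sublinear functional agrees with all its straightenings, which makes it additive.\<close>

lemma additive_minorant:
  assumes \<rho>: "sublinear \<rho>"
  obtains m where "sublinear m" "m \<le> \<rho>" "\<And>x y. m (x + y) = m x + m y"
proof -
  define A where "A = {m. sublinear m \<and> m \<le> \<rho>}"
  have "\<exists>m\<in>A. \<forall>a\<in>A. a \<le> m \<longrightarrow> a = m"
  \<comment> \<open>The order is reversed, as a minimal element is sought.\<close>
  proof (rule predicate_Zorn)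
    show "partial_order_on A (relation_of (\<lambda>a b. b \<le> a) A)"
      by (rule partial_order_on_relation_ofI) auto
    fix C assume C: "C \<in> Chains (relation_of (\<lambda>a b. b \<le> a) A)"
    show "\<exists>u\<in>A. \<forall>a\<in>C. u \<le> a"
    proof (cases "C = {}")
      case True
      then show ?thesis using \<rho> by (auto simp: A_def)
    next
      case False
      have CA: "\<And>a. a \<in> C \<Longrightarrow> sublinear a \<and> a \<le> \<rho>" and chain: "\<And>a b. a \<in> C \<Longrightarrow> b \<in> C \<Longrightarrow> b \<le> a \<or> a \<le> b"
        using C by (auto simp: Chains_def relation_of_def A_def)
      define u where "u x = (INF a\<in>C. a x)" for x
      have le: "u x \<le> a x" if "a \<in> C" for a x
        unfolding u_def
      proof (rule cINF_lower[OF bdd_belowI2 that])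
        \<comment> \<open>All members of the chain share this lower bound, so their infimum is
          finite.\<close>
        show "- \<rho> (- x) \<le> a x" if "a \<in> C" for a
          using sublinear_minus[of a x] CA[OF that] by (auto simp: le_fun_def intro: order_trans[OF le_imp_neg_le])
      qed
      have greatest: "c \<le> u x" if "\<And>a. a \<in> C \<Longrightarrow> c \<le> a x" for c x
        unfolding u_def using False that by (rule cINF_greatest)
      have "sublinear u"
        unfolding sublinear_def
      proof (intro conjI allI impI)
        fix x y
        have "u (x + y) - b y \<le> u x" if b: "b \<in> C" for b
        proof (rule greatest)
          fix a assume a: "a \<in> C"
          \<comment> \<open>Two members of the chain have a common lower one, whose subadditivity
            links values of different members.\<close>
          obtain d where d: "d \<in> C" "d \<le> a" "d \<le> b" using chain[OF a b] a b by auto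
          show "u (x + y) - b y \<le> a x"
            using le[OF d(1), of "x + y"] sublinear_add[of d x y] CA[OF d(1)] d(2,3)
            by (smt (verit) le_fun_def)
        qed
        then have "u (x + y) - u x \<le> u y" by (intro greatest) (simp add: algebra_simps)
        then show "u (x + y) \<le> u x + u y" by simp
      next
        fix t :: real and x assume t: "0 \<le> t"
        obtain a where a: "a \<in> C" using False by blast
        show "u (complex_of_real t *\<^sub>C x) \<le> t * u x"
        proof (cases "t = 0")
          case True
          then show ?thesis using le[OF a, of 0] sublinear_zero[of a] CA[OF a] by simp
        next
          case False
          have "u (complex_of_real t *\<^sub>C x) / t \<le> u x"
          proof (rule greatest)
            fix b assume b: "b \<in> C"
            have "u (complex_of_real t *\<^sub>C x) \<le> t * b x"
              using le[OF b] sublinear_scale_le[of b t x] CA[OF b] t by (meson order_trans)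
            then show "u (complex_of_real t *\<^sub>C x) / t \<le> b x"
              using t False by (simp add: divide_simps mult.commute)
          qed
          then show ?thesis using t False by (simp add: divide_simps mult.commute)
        qed
      qed
      moreover have "u \<le> \<rho>"
      proof -
        obtain a where a: "a \<in> C" using False by blast
        then show ?thesis using le[OF a] CA[OF a] by (auto simp: le_fun_def intro: order_trans)
      qed
      ultimately show ?thesis using le by (auto simp: A_def le_fun_def)
    qed
  qed
  then obtain m where m: "sublinear m" "m \<le> \<rho>"
    and min: "\<And>a. sublinear a \<Longrightarrow> a \<le> \<rho> \<Longrightarrow> a \<le> m \<Longrightarrow> a = m"
    unfolding A_def by blast
  have "m (x + y) = m x + m y" for x y
  proof -
    have "straighten m y \<le> m" using straighten_le_self[OF m(1)] by (simp add: le_fun_def)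
    then have "straighten m y = m"
      using min[OF sublinear_straighten[OF m(1)]] m(2) order_trans by blast
    \<comment> \<open>The missing half of oddness; with subadditivity at \<open>x + y\<close> and
      \<open>- y\<close> it yields superadditivity.\<close>
    then have "m (- y) \<le> - m y" using straighten_minus[OF m(1), of y] by simp
    then show ?thesis
      using sublinear_add[OF m(1), of x y] sublinear_add[OF m(1), of "x + y" "- y"] by simp
  qed
  then show ?thesis using that m by blast
qed

text \<open>Straightening \<open>\<rho>\<close> along \<open>z\<close> first forces a value at most
  \<open>- \<rho> z\<close> at \<open>- z\<close>, which every additive minorant inherits, so
  \<open>\<rho> z\<close> is attained. The real functional is complexified as m x - i m (i x), and
  multiplying \<open>x\<close> by a phase passes the real bound to the modulus.\<close>

lemma hahn_banach_seminorm:
  fixes \<rho> :: "'v::complex_vector \<Rightarrow> real"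
  assumes \<rho>: "cseminorm \<rho>"
  obtains f where "Vector_Spaces.linear scaleC (*) f" "\<And>x. cmod (f x) \<le> \<rho> x" "\<rho> z \<le> cmod (f z)"
proof -
  have "sublinear \<rho>"
    unfolding sublinear_def using cseminorm_add[OF \<rho>] cseminorm_scale[OF \<rho>] by simp
  note s = sublinear_straighten[OF this, of z] straighten_le_self[OF this, of z] straighten_minus[OF this, of z]
  obtain m where m: "sublinear m" "m \<le> straighten \<rho> z" and add: "\<And>x y. m (x + y) = m x + m y"
    using additive_minorant[OF s(1)] by blast
  have m_le: "m x \<le> \<rho> x" for x
    using le_funD[OF m(2), of x] s(2)[of x] by simp
  have m_minus: "m (- x) = - m x" for x
    using add[of x "- x"] sublinear_zero[OF m(1)] by simp
  have m_scale: "m (complex_of_real t *\<^sub>C x) = t * m x" for t x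
  proof (cases "0 \<le> t")
    case True
    then show ?thesis by (rule sublinear_scale[OF m(1)])
  next
    case False
    then have "m (complex_of_real (- t) *\<^sub>C x) = - t * m x" by (intro sublinear_scale[OF m(1)]) simp
    then show ?thesis by (simp add: scaleC_minus_left m_minus)
  qed
  have m_complex: "m (c *\<^sub>C x) = Re c * m x + Im c * m (\<i> *\<^sub>C x)" for c x
  proof -
    have "complex_of_real (Re c) + complex_of_real (Im c) * \<i> = c" by (simp add: complex_eq_iff)
    then have "c *\<^sub>C x = complex_of_real (Re c) *\<^sub>C x + complex_of_real (Im c) *\<^sub>C (\<i> *\<^sub>C x)"
      using scaleC_add_left[of "complex_of_real (Re c)" "complex_of_real (Im c) * \<i>" x]
      by (simp only: scaleC_scaleC)
    then show ?thesis by (simp only: add m_scale)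
  qed
  define f where "f x = Complex (m x) (- m (\<i> *\<^sub>C x))" for x
  have f_add: "f (x + y) = f x + f y" for x y
    by (simp add: f_def add scaleC_add_right complex_eq_iff)
  have f_scale: "f (c *\<^sub>C x) = c * f x" for c x
    using m_complex[of "\<i> * c" x] m_complex[of c x]
    by (simp add: f_def complex_eq_iff scaleC_scaleC)
  have "cmod (f x) \<le> \<rho> x" for x
  proof (cases "f x = 0")
    case True
    then show ?thesis using cseminorm_nonneg[OF \<rho>] by simp
  next
    case False
    define c where "c = cnj (f x) / cmod (f x)"
    have c: "cmod c = 1" using False by (simp add: c_def norm_divide)
    have "c * f x = complex_of_real (cmod (f x))"
      using False by (simp add: c_def complex_norm_square[symmetric] power2_eq_square mult.commute)
    then have "cmod (f x) = Re (f (c *\<^sub>C x))" by (simp add: f_scale)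
    also have "\<dots> \<le> \<rho> (c *\<^sub>C x)" using m_le by (simp add: f_def)
    finally show ?thesis by (simp add: cseminorm_scale[OF \<rho>] c)
  qed
  moreover have "\<rho> z \<le> cmod (f z)"
  proof -
    have "m (- z) \<le> - \<rho> z" using le_funD[OF m(2), of "- z"] s(3) by simp
    then have "\<rho> z \<le> Re (f z)" by (simp add: m_minus f_def)
    then show ?thesis using complex_Re_le_cmod[of "f z"] by linarith
  qed
  moreover have "Vector_Spaces.linear scaleC (*) f"
    by (simp add: linear_complex_iff f_add f_scale)
  ultimately show ?thesis using that by blast
qed

section \<open>The equivalences\<close>

lemma continuous_dualI:
  assumes P: "\<And>p. p \<in> P \<Longrightarrow> cseminorm p" and lin: "Vector_Spaces.linear scaleC (*) f"
    and \<rho>: "\<rho> \<in> P" "\<And>x. cmod (f x) \<le> \<rho> x"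
  shows "f \<in> continuous_dual (seminorm_topology P)"
  unfolding continuous_dual_def mem_Collect_eq continuous_map
proof (intro conjI lin allI impI)
  have diff: "f x - f y = f (x - y)" for x y
    using lin unfolding linear_complex_iff by (metis add_diff_cancel_right' diff_add_cancel)
  show "f ` topspace (seminorm_topology P) \<subseteq> topspace euclidean" by simp
  fix U :: "complex set" assume "openin euclidean U"
  then have U: "open U" by simp
  have "openin (seminorm_topology P) {x. f x \<in> U}"
  proof (rule iffD2[OF openin_seminorm_topology_iff[OF P]], assumption, intro ballI)
    fix x assume "x \<in> {x. f x \<in> U}"
    then obtain r where r: "r > 0" "ball (f x) r \<subseteq> U" using U by (auto simp: open_contains_ball)
    have "f y \<in> U" if "\<rho> (y - x) < r" for y
    proof -
      have "cmod (f y - f x) < r" using \<rho>(2)[of "y - x"] that by (simp add: diff)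
      then show ?thesis using r(2) by (auto simp: dist_norm norm_minus_commute)
    qed
    then show "\<exists>Q \<delta>. Q \<subseteq> P \<and> finite Q \<and> \<delta> > 0 \<and> {y. \<forall>q\<in>Q. q (y - x) < \<delta>} \<subseteq> {x. f x \<in> U}"
      using \<rho>(1) r(1) by (intro exI[of _ "{\<rho>}"] exI[of _ r]) auto
  qed
  then show "openin (seminorm_topology P) {x \<in> topspace (seminorm_topology P). f x \<in> U}" by simp
qed

lemma openin_strict_seminorm_ball:
  fixes \<rho> :: "'a::pro_cstar_algebra multiplier \<Rightarrow> real"
  assumes \<rho>: "cseminorm \<rho>" and p: "p \<in> cstar_seminorms" and K: "K \<ge> 0"
    and le: "\<And>x. \<rho> x \<le> K * (mult_seminorm p (x * embed a) + mult_seminorm p (embed a * x))"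
  shows "openin strict_topology {y. \<rho> (y - x) < r}"
  unfolding strict_topology_eq
proof (rule iffD2[OF openin_seminorm_topology_iff], erule cseminorm_strict_seminorms, intro ballI)
  fix z assume "z \<in> {y. \<rho> (y - x) < r}"
  then have z: "\<rho> (z - x) < r" by simp
  define \<delta> where "\<delta> = (r - \<rho> (z - x)) / (2 * K + 1)"
  have \<delta>: "\<delta> > 0" using z K by (simp add: \<delta>_def)
  have K\<delta>: "K * (\<delta> + \<delta>) < r - \<rho> (z - x)"
  proof -
    have "(2 * K + 1) * \<delta> = r - \<rho> (z - x)" using K by (simp add: \<delta>_def)
    then show ?thesis using \<delta> by (simp add: algebra_simps)
  qed
  let ?Q = "{\<lambda>x. mult_seminorm p (x * embed a), \<lambda>x. mult_seminorm p (embed a * x)}"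
  have "\<rho> (y - x) < r"
    if "mult_seminorm p ((y - z) * embed a) < \<delta>" "mult_seminorm p (embed a * (y - z)) < \<delta>" for y
  proof -
    have "\<rho> (y - z) \<le> K * (\<delta> + \<delta>)"
      using that K by (intro order_trans[OF le] mult_left_mono) auto
    then show ?thesis using cseminorm_add[OF \<rho>, of "y - z" "z - x"] K\<delta> by simp
  qed
  then have "?Q \<subseteq> strict_seminorms \<and> finite ?Q \<and> \<delta> > 0 \<and> {y. \<forall>q\<in>?Q. q (y - z) < \<delta>} \<subseteq> {y. \<rho> (y - x) < r}"
    using \<delta> p by (auto simp: strict_seminorms_def)
  then show "\<exists>Q \<delta>. Q \<subseteq> strict_seminorms \<and> finite Q \<and> \<delta> > 0 \<and> {y. \<forall>q\<in>Q. q (y - z) < \<delta>} \<subseteq> {y. \<rho> (y - x) < r}"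
    by (intro exI)
qed

text \<open>A seminorm \<open>\<rho>\<close> of \<beta>_b itself produces the assignment: for each
  gauge choose a \<beta>-neighbourhood whose trace on the ball lies in the unit ball of
  \<open>\<rho>\<close>. Functionals dominated by \<open>\<rho>\<close> then lie in the polar and
  recover \<open>\<rho>\<close>, which inherits the strict bound.\<close>

lemma strict_eq_bdd_top_if_factors:
  fixes e :: "'l::preorder \<Rightarrow> 'a::pro_cstar_algebra"
  assumes e: "approximate_unit e"
    and fac: "\<And>\<nu> :: (('a \<Rightarrow> real) \<Rightarrow> real) \<Rightarrow> 'a multiplier set. nhd_assignment \<nu> \<Longrightarrow>
      \<exists>p\<in>cstar_seminorms. \<forall>f\<in>polar (W_hull \<nu>). factors_quotient p f"
  shows "(strict_topology :: 'a multiplier topology) = bdd_top strict_topology"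
proof -
  let ?\<beta> = "strict_topology :: 'a multiplier topology"
  obtain P where P: "\<And>\<rho>. \<rho> \<in> P \<Longrightarrow> cseminorm \<rho>" and T: "bdd_top ?\<beta> = seminorm_topology P"
    using locally_convex_bdd_top_strict unfolding locally_convex_def by blast
  have ball: "openin ?\<beta> {y. \<rho> (y - x) < r}" if \<rho>: "\<rho> \<in> P" for \<rho> x r
  proof -
    have "openin (bdd_top ?\<beta>) {y. \<rho> y < 1}"
      using openin_seminorm_ball[of "{\<rho>}" P 1 0] \<rho> by (simp add: T)
    moreover have "0 \<in> {y. \<rho> y < 1}" by (simp add: cseminorm_zero[OF P[OF \<rho>]])
    ultimately have "\<forall>\<gamma>\<in>gauges. \<exists>V. nhd_zero ?\<beta> V \<and> V \<inter> gauge_ball \<gamma> \<subseteq> {y. \<rho> y < 1}"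
      using bdd_top_strict_nhd by metis
    then obtain \<nu> where \<nu>: "\<And>\<gamma>. \<gamma> \<in> gauges \<Longrightarrow> nhd_zero ?\<beta> (\<nu> \<gamma>)"
      "\<And>\<gamma>. \<gamma> \<in> gauges \<Longrightarrow> \<nu> \<gamma> \<inter> gauge_ball \<gamma> \<subseteq> {y. \<rho> y < 1}"
      by metis
    then have nhd: "nhd_assignment \<nu>" by (simp add: nhd_assignment_def)
    obtain p where p: "p \<in> cstar_seminorms" "\<forall>f\<in>polar (W_hull \<nu>). factors_quotient p f"
      using fac[OF nhd] by blast
    obtain K a where K: "K \<ge> 0" and bound: "\<And>f x. f \<in> polar (W_hull \<nu>) \<Longrightarrow>
        cmod (f x) \<le> K * (mult_seminorm p (x * embed a) + mult_seminorm p (embed a * x))"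
      using polar_factors_strict_bound[OF e nhd p] by blast
    have "\<rho> z \<le> K * (mult_seminorm p (z * embed a) + mult_seminorm p (embed a * z))" for z
    proof -
      obtain f where f: "Vector_Spaces.linear scaleC (*) f" "\<And>x. cmod (f x) \<le> \<rho> x" "\<rho> z \<le> cmod (f z)"
        using hahn_banach_seminorm[OF P[OF \<rho>]] by metis
      have "f \<in> continuous_dual (bdd_top ?\<beta>)"
        unfolding T by (rule continuous_dualI[OF P f(1) \<rho> f(2)])
      moreover have "cmod (f x) \<le> 1" if "\<gamma> \<in> gauges" "x \<in> gauge_ball \<gamma> \<inter> \<nu> \<gamma>" for \<gamma> x
      proof -
        have "\<rho> x < 1" using \<nu>(2)[OF that(1)] that(2) by blast
        then show ?thesis using f(2)[of x] by simp
      qed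
      ultimately have "f \<in> polar (W_hull \<nu>)" unfolding polar_W_hull by (auto simp: polar_def)
      then show ?thesis using bound f(3) order_trans by blast
    qed
    then show ?thesis by (rule openin_strict_seminorm_ball[OF P[OF \<rho>] p(1) K])
  qed
  have "openin ?\<beta> U" if "openin (bdd_top ?\<beta>) U" for U
  proof -
    have "generate_topology_on (insert UNIV {{y. p (y - x) < r} |p x r. p \<in> P \<and> r > 0}) U"
      using that unfolding T seminorm_topology_def openin_topology_generated_by_iff .
    then show ?thesis
    proof (rule generate_topology_on_coarsest[rotated 2])
      show "istopology (openin ?\<beta>)" by simp
      have "openin ?\<beta> (topspace ?\<beta>)" by (rule openin_topspace)
      then show "openin ?\<beta> S" if "S \<in> insert UNIV {{y. p (y - x) < r} |p x r. p \<in> P \<and> r > 0}" for S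
        using that ball by (auto simp: strict_topology_eq)
    qed
  qed
  moreover have "openin (bdd_top ?\<beta>) U" if "openin ?\<beta> U" for U
    using finest_bdd_top_strict[OF locally_convex_strict_topology _ that] by (simp add: agree_on_bounded_def)
  ultimately show ?thesis unfolding topology_eq by blast
qed

text \<open>
  The supremum of the functionals in the polar is a seminorm whose addition to the seminorms of
  \<open>\<beta>\<close> does not change the topology on bounded sets.
\<close>

lemma polar_equicontinuous_if_strict_eq:
  fixes e :: "'l::preorder \<Rightarrow> 'a::pro_cstar_algebra"
    and \<nu> :: "(('a \<Rightarrow> real) \<Rightarrow> real) \<Rightarrow> 'a multiplier set"
  assumes e: "approximate_unit e" and \<nu>: "nhd_assignment \<nu>"
    and eq: "(strict_topology :: 'a multiplier topology) = bdd_top strict_topology"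
  obtains V where "nhd_zero strict_topology V" "\<And>f x. f \<in> polar (W_hull \<nu>) \<Longrightarrow> x \<in> V \<Longrightarrow> cmod (f x) < 1"
proof -
  let ?\<beta> = "strict_topology :: 'a multiplier topology"
  let ?H = "polar (W_hull \<nu>)"
  note lin = continuous_dualD[OF polar_W_hullD(1)] and dual = cseminorm_continuous_dual[OF polar_W_hullD(1)]
  have zero: "(\<lambda>_. 0) \<in> ?H"
    unfolding polar_W_hull by (auto simp: polar_def continuous_dual_def linear_complex_iff)
  define \<rho> where "\<rho> x = (SUP f\<in>?H. cmod (f x))" for x
  have small: "\<exists>V. nhd_zero ?\<beta> V \<and> (\<forall>f\<in>?H. \<forall>x\<in>V \<inter> gauge_ball \<gamma>. cmod (f x) \<le> \<epsilon>)"
    if \<gamma>: "\<gamma> \<in> gauges" and \<epsilon>: "\<epsilon> > 0" for \<gamma> \<epsilon>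
  proof -
    \<comment> \<open>The polar only gives the bound 1; dividing the gauge by \<epsilon> and
      rescaling turns it into \<epsilon>.\<close>
    define \<gamma>' where "\<gamma>' = (\<lambda>q\<in>cstar_seminorms. \<gamma> q / \<epsilon>)"
    have \<gamma>': "\<gamma>' \<in> gauges"
      unfolding \<gamma>'_def using gauges_pos[OF \<gamma>] \<epsilon> by (intro restrict_gauges) simp
    let ?V = "{x. complex_of_real (1 / \<epsilon>) *\<^sub>C x \<in> \<nu> \<gamma>'}"
    have "nhd_zero ?\<beta> (\<nu> \<gamma>')" using \<nu> \<gamma>' by (simp add: nhd_assignment_def)
    then have "nhd_zero ?\<beta> ?V"
      unfolding strict_topology_eq by (rule nhd_zero_scale[OF cseminorm_strict_seminorms _ \<epsilon>, rotated])
    moreover have "cmod (f x) \<le> \<epsilon>" if f: "f \<in> ?H" and x: "x \<in> ?V" "x \<in> gauge_ball \<gamma>" for f x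
    proof -
      have "complex_of_real (1 / \<epsilon>) *\<^sub>C x \<in> gauge_ball \<gamma>'"
        using x(2) \<epsilon> by (intro gauge_ball_inverse_scaleI) (simp_all add: \<gamma>'_def gauge_ball_def)
      then have "cmod (f (complex_of_real (1 / \<epsilon>) *\<^sub>C x)) \<le> 1"
        using x(1) by (intro polar_W_hullD(2)[OF f \<gamma>']) simp_all
      then show ?thesis using \<epsilon> unfolding cseminorm_scale_inverse[OF dual[OF f] \<epsilon>] by simp
    qed
    ultimately show ?thesis by blast
  qed
  have bdd: "bdd_above ((\<lambda>f. cmod (f x)) ` ?H)" for x
  proof -
    \<comment> \<open>A gauge adapted to \<open>x\<close>, whose ball contains \<open>x\<close>;
      scaling is then needed only to enter \<open>V\<close>.\<close>
    define \<gamma> where "\<gamma> = (\<lambda>q\<in>cstar_seminorms. mult_seminorm q x + 1)"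
    have \<gamma>: "\<gamma> \<in> gauges"
      unfolding \<gamma>_def by (intro restrict_gauges add_nonneg_pos mult_seminorm_nonneg) simp_all
    obtain V where V: "nhd_zero ?\<beta> V" "\<And>f y. f \<in> ?H \<Longrightarrow> y \<in> V \<Longrightarrow> y \<in> gauge_ball \<gamma> \<Longrightarrow> cmod (f y) \<le> 1"
      using small[OF \<gamma> zero_less_one] by blast
    obtain s p c where s: "cseminorm s" and "p \<in> cstar_seminorms" "0 \<le> c"
      "\<And>x. s x \<le> c * mult_seminorm p x" and sV: "\<And>x. s x < 1 \<Longrightarrow> x \<in> V"
      using nhd_zero_strict_seminormE[OF V(1)] by blast
    have s0: "0 \<le> s x" by (rule cseminorm_nonneg[OF s])
    then have t: "s x + 1 > 0" by simp
    let ?y = "complex_of_real (1 / (s x + 1)) *\<^sub>C x"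
    have "?y \<in> gauge_ball \<gamma>"
    proof (rule gauge_ball_inverse_scaleI[OF t])
      fix q :: "'a \<Rightarrow> real" assume q: "q \<in> cstar_seminorms"
      have "1 * mult_seminorm q x \<le> (s x + 1) * (mult_seminorm q x + 1)"
        using s0 mult_seminorm_nonneg[OF q, of x] by (intro mult_mono) auto
      then show "mult_seminorm q x \<le> (s x + 1) * \<gamma> q" using q by (simp add: \<gamma>_def)
    qed
    moreover have "?y \<in> V" using s0 by (intro sV) (simp only: cseminorm_scale_inverse[OF s t], simp)
    ultimately have y: "cmod (f ?y) \<le> 1" if "f \<in> ?H" for f using V(2)[OF that] by blast
    have "cmod (f x) \<le> s x + 1" if f: "f \<in> ?H" for f
      using y[OF f] t unfolding cseminorm_scale_inverse[OF dual[OF f] t] by simp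
    then show ?thesis by (intro bdd_aboveI2)
  qed
  have f_le: "cmod (f x) \<le> \<rho> x" if "f \<in> ?H" for f x
    unfolding \<rho>_def using that by (intro cSUP_upper bdd)
  have \<rho>_le: "\<rho> x \<le> c" if "\<And>f. f \<in> ?H \<Longrightarrow> cmod (f x) \<le> c" for c x
    unfolding \<rho>_def using zero that by (intro cSUP_least) auto
  have \<rho>_scale: "\<rho> (c *\<^sub>C x) \<le> cmod c * \<rho> x" for c x
    by (rule \<rho>_le) (simp add: lin(2) norm_mult f_le mult_left_mono)
  have \<rho>: "cseminorm \<rho>"
    unfolding cseminorm_def
  proof (intro conjI allI antisym \<rho>_scale)
    show "\<rho> (x + y) \<le> \<rho> x + \<rho> y" for x y
    proof (rule \<rho>_le)
      fix f assume f: "f \<in> ?H"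
      show "cmod (f (x + y)) \<le> \<rho> x + \<rho> y"
        using norm_triangle_ineq[of "f x" "f y"] f_le[OF f, of x] f_le[OF f, of y] by (simp add: lin(1)[OF f])
    qed
    show "cmod c * \<rho> x \<le> \<rho> (c *\<^sub>C x)" for c x
    proof (cases "c = 0")
      case True
      then show ?thesis using f_le[OF zero, of 0] by simp
    next
      case False
      then show ?thesis using \<rho>_scale[of "1 / c" "c *\<^sub>C x"]
        by (simp add: scaleC_scaleC scaleC_one norm_divide field_simps)
    qed
  qed
  define T where "T = seminorm_topology (insert \<rho> strict_seminorms)"
  have T_sn: "\<And>q. q \<in> insert \<rho> strict_seminorms \<Longrightarrow> cseminorm q"
    using \<rho> cseminorm_strict_seminorms by blast
  have agree: "agree_on_bounded ?\<beta> T"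
    unfolding agree_on_bounded_def
  proof (intro allI impI)
    fix B :: "'a multiplier set" assume "tvs_bounded ?\<beta> B"
    then obtain \<gamma> where \<gamma>: "\<gamma> \<in> gauges" "B \<subseteq> gauge_ball \<gamma>"
      using strictly_bounded_imp_gauge_ball[OF e] by blast
    \<comment> \<open>Neighbourhoods of points of \<open>B\<close> are translated to 0, and
      differences of points of \<open>B\<close> lie in the ball of the doubled gauge.\<close>
    define \<gamma>' where "\<gamma>' = (\<lambda>q\<in>cstar_seminorms. \<gamma> q + \<gamma> q)"
    have \<gamma>': "\<gamma>' \<in> gauges"
      unfolding \<gamma>'_def using gauges_pos[OF \<gamma>(1)] by (intro restrict_gauges add_pos_pos)
    have diff: "y - x \<in> gauge_ball \<gamma>'" if "x \<in> B" "y \<in> B" for x y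
      unfolding gauge_ball_def mem_Collect_eq
    proof
      fix q :: "'a \<Rightarrow> real" assume q: "q \<in> cstar_seminorms"
      have "mult_seminorm q y \<le> \<gamma> q" "mult_seminorm q x \<le> \<gamma> q"
        using that \<gamma>(2) q by (auto simp: gauge_ball_def)
      then show "mult_seminorm q (y - x) \<le> \<gamma>' q"
        unfolding \<gamma>'_def restrict_apply'[OF q]
        using cseminorm_diff[OF cseminorm_mult_seminorm[OF q], of y x] by linarith
    qed
    show "subtopology T B = subtopology ?\<beta> B"
      unfolding topology_eq
    proof (intro allI iffI)
      fix U assume "openin (subtopology ?\<beta> B) U"
      then show "openin (subtopology T B) U"
        unfolding openin_subtopology T_def strict_topology_eq
        using openin_seminorm_topology_mono[of strict_seminorms "insert \<rho> strict_seminorms"] by blast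
    next
      fix U assume "openin (subtopology T B) U"
      then obtain U' where U': "openin T U'" "U = U' \<inter> B" by (auto simp: openin_subtopology)
      have "\<exists>W. openin (subtopology ?\<beta> B) W \<and> x \<in> W \<and> W \<subseteq> U" if x: "x \<in> U" for x
      proof -
        have xB: "x \<in> U'" "x \<in> B" using x U'(2) by auto
        have "\<exists>Q \<delta>. Q \<subseteq> insert \<rho> strict_seminorms \<and> finite Q \<and> \<delta> > 0 \<and> {y. \<forall>q\<in>Q. q (y - x) < \<delta>} \<subseteq> U'"
          using iffD1[OF openin_seminorm_topology_iff[OF T_sn] U'(1)[unfolded T_def]] xB(1) by blast
        then obtain Q \<delta> where Q: "Q \<subseteq> insert \<rho> strict_seminorms" "finite Q" "\<delta> > 0"
          "{y. \<forall>q\<in>Q. q (y - x) < \<delta>} \<subseteq> U'"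
          by (elim exE conjE) (rule that)
        obtain V where V: "nhd_zero ?\<beta> V" "\<And>f y. f \<in> ?H \<Longrightarrow> y \<in> V \<Longrightarrow> y \<in> gauge_ball \<gamma>' \<Longrightarrow> cmod (f y) \<le> \<delta> / 2"
          using small[OF \<gamma>', of "\<delta> / 2"] Q(3) by auto
        have "\<exists>Q \<delta>. Q \<subseteq> strict_seminorms \<and> finite Q \<and> \<delta> > 0 \<and> {y. \<forall>q\<in>Q. q y < \<delta>} \<subseteq> V"
          using V(1) unfolding strict_topology_eq
          by (rule iffD1[OF nhd_zero_seminorm_topology[OF cseminorm_strict_seminorms], rotated])
        then obtain R \<eta> where R: "R \<subseteq> strict_seminorms" "finite R" "\<eta> > 0" "{y. \<forall>q\<in>R. q y < \<eta>} \<subseteq> V"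
          by (elim exE conjE) (rule that)
        \<comment> \<open>The condition on \<open>\<rho>\<close> is traded for the strict seminorms
          in \<open>R\<close>, which control \<open>\<rho>\<close> on differences of points of
          \<open>B\<close>.\<close>
        let ?R = "R \<union> (Q - {\<rho>})"
        let ?W = "{y. \<forall>q\<in>?R. q (y - x) < min \<delta> \<eta>}"
        have R': "?R \<subseteq> strict_seminorms" using R(1) Q(1) by blast
        have "openin ?\<beta> ?W"
          unfolding strict_topology_eq using R' R(2,3) Q(2,3) by (intro openin_seminorm_ball) auto
        then have "openin (subtopology ?\<beta> B) (?W \<inter> B)" by (auto simp: openin_subtopology)
        moreover have "x \<in> ?W"
        proof -
          have "q (x - x) < min \<delta> \<eta>" if "q \<in> ?R" for q
            using cseminorm_zero[OF cseminorm_strict_seminorms[OF subsetD[OF R' that]]] Q(3) R(3) by simp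
          then show ?thesis by blast
        qed
        moreover have "y \<in> U'" if y: "y \<in> ?W" "y \<in> B" for y
        proof -
          have yR: "q (y - x) < \<eta>" if "q \<in> R" for q
          proof -
            have "q (y - x) < min \<delta> \<eta>" using y(1) that by blast
            then show ?thesis by simp
          qed
          then have "y - x \<in> V" using R(4) by blast
          then have "\<rho> (y - x) \<le> \<delta> / 2" by (intro \<rho>_le V(2) diff xB y(2))
          then have "\<rho> (y - x) < \<delta>" using Q(3) by simp
          moreover have "q (y - x) < \<delta>" if "q \<in> Q" "q \<noteq> \<rho>" for q
          proof -
            have "q (y - x) < min \<delta> \<eta>" using y(1) that by blast
            then show ?thesis by simp
          qed
          ultimately have "\<forall>q\<in>Q. q (y - x) < \<delta>" by metis
          then show ?thesis using Q(4) by blast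
        qed
        ultimately show ?thesis using xB(2) U'(2) by (intro exI[of _ "?W \<inter> B"]) blast
      qed
      then show "openin (subtopology ?\<beta> B) U" by (subst openin_subopen) blast
    qed
  qed
  have "openin T {y. \<rho> y < 1}"
    unfolding T_def using openin_seminorm_ball[of "{\<rho>}" "insert \<rho> strict_seminorms" 1 0] by simp
  moreover have "locally_convex T"
    unfolding locally_convex_def T_def using T_sn by blast
  ultimately have "openin (bdd_top ?\<beta>) {y. \<rho> y < 1}"
    using agree by (intro finest_bdd_top_strict)
  then have "nhd_zero ?\<beta> {y. \<rho> y < 1}"
    unfolding nhd_zero_def using eq cseminorm_zero[OF \<rho>] by (intro exI[of _ "{y. \<rho> y < 1}"]) simp
  then show ?thesis
    by (rule that) (use f_le in \<open>auto intro: order_le_less_trans\<close>)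
qed


section \<open>Equicontinuity, kernels and factorization\<close>

lemma vanish_on_kernel:
  assumes f: "f \<in> continuous_dual \<sigma>" and s: "cseminorm s"
    and bound: "\<And>x. s x < \<delta> \<Longrightarrow> cmod (f x) < 1" and \<delta>: "\<delta> > 0" and x: "s x = 0"
  shows "f x = 0"
proof (rule ccontr)
  assume nz: "f x \<noteq> 0"
  \<comment> \<open>Scaling keeps the seminorm at 0 while moving the value of \<open>f\<close> to
    1.\<close>
  have "cmod (f ((1 / f x) *\<^sub>C x)) < 1"
    using \<delta> x by (intro bound) (simp add: cseminorm_scale[OF s])
  then show False using nz by (simp add: continuous_dualD(2)[OF f])
qed

lemma factors_quotientI:
  assumes "f \<in> continuous_dual \<sigma>" and p: "cstar_seminorm p" and zero: "\<And>a. p a = 0 \<Longrightarrow> f (embed a) = 0"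
  shows "factors_quotient p f"
  unfolding factors_quotient_def
proof (intro exI[of _ "\<lambda>X. f (embed (rep X))"] allI)
  fix a
  have "f (embed (rep (coset p a) - a)) = 0" by (rule zero[OF rep_coset[OF p]])
  then show "f (embed a) = f (embed (rep (coset p a)))"
    by (simp add: embed_diff continuous_dualD(3)[OF assms(1)])
qed

text \<open>The polar is already equicontinuous for \<beta>, and a \<beta>-neighbourhood contains a
  ball of one \<open>mult_seminorm p\<close>.\<close>

lemma polar_tau_equicontinuous:
  fixes e :: "'l::preorder \<Rightarrow> 'a::pro_cstar_algebra"
    and \<nu> :: "(('a \<Rightarrow> real) \<Rightarrow> real) \<Rightarrow> 'a multiplier set"
  assumes e: "approximate_unit e" and \<nu>: "nhd_assignment \<nu>"
    and eq: "(strict_topology :: 'a multiplier topology) = bdd_top strict_topology"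
  shows "equicontinuous tau_topology (polar (W_hull \<nu>))"
  unfolding equicontinuous_def
proof (intro ballI allI impI)
  obtain V where V: "nhd_zero strict_topology V" and small: "\<And>f x. f \<in> polar (W_hull \<nu>) \<Longrightarrow> x \<in> V \<Longrightarrow> cmod (f x) < 1"
    using polar_equicontinuous_if_strict_eq[OF e \<nu> eq] by blast
  obtain s p c where s: "cseminorm s" and p: "p \<in> cstar_seminorms" and c: "0 \<le> c"
    and le: "\<And>x. s x \<le> c * mult_seminorm p x" and sV: "\<And>x. s x < 1 \<Longrightarrow> x \<in> V"
    using nhd_zero_strict_seminormE[OF V] by blast
  fix x :: "'a multiplier" and \<epsilon> :: real assume \<epsilon>: "\<epsilon> > 0"
  let ?U = "{y. \<forall>q\<in>{mult_seminorm p}. q (y - x) < \<epsilon> / (c + 1)}"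
  have "openin tau_topology ?U"
    unfolding tau_topology_def using p \<epsilon> c by (intro openin_seminorm_ball) auto
  moreover have "x \<in> ?U" using \<epsilon> c by (simp add: cseminorm_zero[OF cseminorm_mult_seminorm[OF p]])
  moreover have "cmod (f y - f x) < \<epsilon>" if f: "f \<in> polar (W_hull \<nu>)" and y: "y \<in> ?U" for f y
  proof -
    have "mult_seminorm p (y - x) * (c + 1) < \<epsilon>"
      using y c by (simp add: pos_less_divide_eq)
    then have "s (y - x) < \<epsilon>"
      using le[of "y - x"] mult_seminorm_nonneg[OF p, of "y - x"] by (simp add: algebra_simps)
    then have "complex_of_real (1 / \<epsilon>) *\<^sub>C (y - x) \<in> V"
      using \<epsilon> by (intro sV) (simp only: cseminorm_scale_inverse[OF s \<epsilon>], simp)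
    from small[OF f this] have "cmod (f (y - x)) < \<epsilon>"
      using \<epsilon> unfolding cseminorm_scale_inverse[OF cseminorm_continuous_dual[OF polar_W_hullD(1)[OF f]] \<epsilon>] by simp
    then show ?thesis by (simp add: continuous_dualD(3)[OF polar_W_hullD(1)[OF f]])
  qed
  ultimately show "\<exists>U. openin tau_topology U \<and> x \<in> U \<and> (\<forall>f\<in>polar (W_hull \<nu>). \<forall>y\<in>U. cmod (f y - f x) < \<epsilon>)"
    by blast
qed

text \<open>Equicontinuity at 0 and directedness bound all functionals on the ball of one p; a
  linear functional bounded on such a ball vanishes where p does.\<close>

lemma factors_if_tau_equicontinuous:
  fixes e :: "'l::preorder \<Rightarrow> 'a::pro_cstar_algebra"
    and \<nu> :: "(('a \<Rightarrow> real) \<Rightarrow> real) \<Rightarrow> 'a multiplier set"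
  assumes e: "approximate_unit e" and equi: "equicontinuous tau_topology (polar (W_hull \<nu>))"
  shows "\<exists>p\<in>cstar_seminorms. \<forall>f\<in>polar (W_hull \<nu>). factors_quotient p f"
proof -
  have sn: "\<And>s. s \<in> mult_seminorm ` (cstar_seminorms :: ('a \<Rightarrow> real) set) \<Longrightarrow> cseminorm s"
    using cseminorm_mult_seminorm by blast
  have "\<exists>U. openin tau_topology U \<and> 0 \<in> U \<and> (\<forall>f\<in>polar (W_hull \<nu>). \<forall>y\<in>U. cmod (f y - f 0) < 1)"
    using equi[unfolded equicontinuous_def, rule_format, of 0 1] by (simp add: tau_topology_def)
  then obtain U where U: "openin tau_topology U" "0 \<in> U" "\<And>f y. f \<in> polar (W_hull \<nu>) \<Longrightarrow> y \<in> U \<Longrightarrow> cmod (f y - f 0) < 1"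
    by blast
  then have nhd: "nhd_zero (seminorm_topology (mult_seminorm ` cstar_seminorms)) U"
    by (auto simp: nhd_zero_def tau_topology_def)
  have "\<exists>Q \<delta>. Q \<subseteq> mult_seminorm ` cstar_seminorms \<and> finite Q \<and> \<delta> > 0 \<and> {y. \<forall>q\<in>Q. q y < \<delta>} \<subseteq> U"
    by (rule iffD1[OF nhd_zero_seminorm_topology[OF sn] nhd])
  then obtain Q \<delta> where Q: "Q \<subseteq> mult_seminorm ` cstar_seminorms" "finite Q" "\<delta> > 0" "{y. \<forall>q\<in>Q. q y < \<delta>} \<subseteq> U"
    by (elim exE conjE) (rule that)
  obtain R where R: "R \<subseteq> cstar_seminorms" "finite R" "Q = mult_seminorm ` R"
    using finite_subset_image[OF Q(2,1)] by blast
  obtain p where p: "p \<in> cstar_seminorms" "\<And>q. q \<in> R \<Longrightarrow> q \<le> p"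
    using cstar_seminorms_directed[OF R(2,1)] by blast
  have "factors_quotient p f" if f: "f \<in> polar (W_hull \<nu>)" for f
  proof (rule factors_quotientI[OF polar_W_hullD(1)[OF f] cstar_seminormsD[OF p(1)]])
    fix a assume a: "p a = 0"
    show "f (embed a) = 0"
    proof (rule vanish_on_kernel[OF polar_W_hullD(1)[OF f] cseminorm_mult_seminorm[OF p(1)] _ Q(3)])
      fix x assume x: "mult_seminorm p x < \<delta>"
      have "mult_seminorm r x < \<delta>" if "r \<in> R" for r
        using mult_seminorm_mono[OF e p(1) subsetD[OF R(1) that] p(2)[OF that], of x] x by linarith
      then have "x \<in> U" using Q(4) R(3) by blast
      from U(3)[OF f this] show "cmod (f x) < 1" using continuous_dualD(4)[OF polar_W_hullD(1)[OF f]] by simp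
    qed (simp add: mult_seminorm_embed[OF p(1)] a)
  qed
  then show ?thesis using p(1) by blast
qed

text \<open>The bound by \<open>C * mult_seminorm p x\<close>, valid on all of M(A), makes
  \<open>f\<close> blind to differences whose component at \<open>p\<close> vanishes.\<close>

lemma factors_mult_quotient_if_factors_quotient:
  fixes e :: "'l::preorder \<Rightarrow> 'a::pro_cstar_algebra" and p :: "'a \<Rightarrow> real"
  assumes e: "approximate_unit e" and \<nu>: "nhd_assignment \<nu>" and p: "p \<in> cstar_seminorms"
    and fac: "\<forall>f\<in>polar (W_hull \<nu>). factors_quotient p f" and f: "f \<in> polar (W_hull \<nu>)"
  shows "factors_mult_quotient p f"
proof -
  obtain C where "C \<ge> 0" and C: "\<And>f x. f \<in> polar (W_hull \<nu>) \<Longrightarrow> cmod (f x) \<le> C * mult_seminorm p x"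
    using polar_factors_bound[OF e \<nu> p fac] by blast
  have "f x = f y" if eq: "component x p = component y p" for x y
  proof -
    have "component (x - y) p = component (y - y) p"
      by (simp only: diff_conv_add_uminus component_ops[OF p] eq)
    then have "mult_seminorm p (x - y) = 0"
      using cseminorm_zero[OF cseminorm_mult_seminorm[OF p]] by (simp add: mult_seminorm_def)
    then have "f (x - y) = 0" using C[OF f, of "x - y"] by simp
    then show ?thesis by (simp add: continuous_dualD(3)[OF polar_W_hullD(1)[OF f]])
  qed
  then have "f x = f (SOME y. component y p = component x p)" for x
    by (metis (mono_tags, lifting) someI)
  then show ?thesis
    unfolding factors_mult_quotient_def
    by (intro exI[of _ "\<lambda>m. f (SOME y. component y p = m)"]) blast
qed

section \<open>Uniform convergence on bounded sets\<close>

lemma polar_uniform_limit: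
  fixes e :: "'l::preorder \<Rightarrow> 'a::pro_cstar_algebra"
  assumes e: "approximate_unit e" and \<nu>: "nhd_assignment \<nu>" and B: "tvs_bounded strict_topology B"
  shows "uniform_limit (polar (W_hull \<nu>) \<times> B)
    (\<lambda>i (f, x). f ((1 - embed (e i)) * x * (1 - embed (e i)))) (\<lambda>_. 0) net_filter"
proof (rule uniform_limitI)
  fix \<epsilon> :: real assume "\<epsilon> > 0"
  obtain \<gamma> where \<gamma>: "\<gamma> \<in> gauges" "B \<subseteq> gauge_ball \<gamma>"
    using strictly_bounded_imp_gauge_ball[OF e B] by blast
  show "\<forall>\<^sub>F i in net_filter. \<forall>z\<in>polar (W_hull \<nu>) \<times> B.
      dist (case z of (f, x) \<Rightarrow> f ((1 - embed (e i)) * x * (1 - embed (e i)))) 0 < \<epsilon>"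
    \<comment> \<open>Half of \<epsilon>, because the bound on the polar is not strict.\<close>
    using polar_two_sided_small[OF e \<nu> \<gamma>(1) half_gt_zero[OF \<open>\<epsilon> > 0\<close>], of 1 1]
  proof (rule eventually_mono, intro ballI)
    fix i z
    assume small: "\<forall>f\<in>polar (W_hull \<nu>). \<forall>x\<in>gauge_ball \<gamma>.
        cmod (f (1 * (1 - embed (e i)) * x * (1 - embed (e i)) * 1)) \<le> \<epsilon> / 2"
      and z: "z \<in> polar (W_hull \<nu>) \<times> B"
    obtain f x where fx: "z = (f, x)" "f \<in> polar (W_hull \<nu>)" "x \<in> B" using z by blast
    have "cmod (f ((1 - embed (e i)) * x * (1 - embed (e i)))) \<le> \<epsilon> / 2"
      using small[rule_format, OF fx(2) subsetD[OF \<gamma>(2) fx(3)]] by simp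
    then show "dist (case z of (f, x) \<Rightarrow> f ((1 - embed (e i)) * x * (1 - embed (e i)))) 0 < \<epsilon>"
      using \<open>\<epsilon> > 0\<close> by (simp add: fx(1))
  qed
qed

theorem theorem2p15:
  fixes e :: "'l::preorder \<Rightarrow> 'a::pro_cstar_algebra"
  assumes "approximate_unit e"
  shows
    "(\<forall>\<nu> :: (('a \<Rightarrow> real) \<Rightarrow> real) \<Rightarrow> 'a multiplier set. nhd_assignment \<nu> \<longrightarrow>
        polar (W_hull \<nu>) = (\<Inter>\<gamma>\<in>gauges. polar (gauge_ball \<gamma> \<inter> \<nu> \<gamma>)) \<and>
        (\<forall>B. tvs_bounded strict_topology B \<longrightarrow>
          uniform_limit (polar (W_hull \<nu>) \<times> B)
            (\<lambda>i (f, x). f ((1 - embed (e i)) * x * (1 - embed (e i)))) (\<lambda>_. 0) net_filter)) \<and>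
     (continuous_dual (euclidean :: 'a topology) = continuous_dual (bdd_top euclidean) \<longrightarrow>
        ((strict_topology :: 'a multiplier topology) = bdd_top strict_topology \<longleftrightarrow>
          (\<forall>\<nu> :: (('a \<Rightarrow> real) \<Rightarrow> real) \<Rightarrow> 'a multiplier set. nhd_assignment \<nu> \<longrightarrow>
            equicontinuous tau_topology (polar (W_hull \<nu>)))) \<and>
        ((strict_topology :: 'a multiplier topology) = bdd_top strict_topology \<longleftrightarrow>
          (\<forall>\<nu> :: (('a \<Rightarrow> real) \<Rightarrow> real) \<Rightarrow> 'a multiplier set. nhd_assignment \<nu> \<longrightarrow>
            (\<exists>p\<in>cstar_seminorms. \<forall>f\<in>polar (W_hull \<nu>). factors_quotient p f))) \<and>
        (\<forall>\<nu> :: (('a \<Rightarrow> real) \<Rightarrow> real) \<Rightarrow> 'a multiplier set. \<forall>p\<in>cstar_seminorms. nhd_assignment \<nu> \<longrightarrow>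
            (\<forall>f\<in>polar (W_hull \<nu>). factors_quotient p f) \<longrightarrow>
            (\<forall>f\<in>polar (W_hull \<nu>). factors_mult_quotient p f)))"
  \<comment> \<open>Both equivalences come from one cycle: coinciding topologies give
    equicontinuity, which gives factorization, which gives coinciding topologies.\<close>
  by (intro conjI impI allI ballI iffI)
    (rule polar_W_hull,
     erule (1) polar_uniform_limit[OF assms],
     erule (1) polar_tau_equicontinuous[OF assms],
     rule strict_eq_bdd_top_if_factors[OF assms], rule factors_if_tau_equicontinuous[OF assms], blast,
     rule factors_if_tau_equicontinuous[OF assms], erule (1) polar_tau_equicontinuous[OF assms],
     rule strict_eq_bdd_top_if_factors[OF assms], blast,
     erule (3) factors_mult_quotient_if_factors_quotient[OF assms])

end
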